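(* Let $\rho>0$. Let $m,n\to\infty$ through positive integers with $n$ a multiple of $3$ and $\frac{n}{\sqrt3\,m}\to\rho$. Then the sequence of $\mathbb{Z}^2$-valued random variables $\mathrm{wind}_{m,n}$ (the winding number, with respect to the reference configuration $M_0$, of a uniformly random dimer configuration of the toroidal honeycomb graph $H_{m,n}$) converges in distribution to the two-dimensional discrete Gaussian random variable $\mathrm{wind}_\rho$ whose law is $$\forall (k,\ell)\in\mathbb{Z}^2,\qquad \mathbb{P}[\mathrm{wind}_\rho=(k,\ell)]=\frac{1}{Z_\rho}\,e^{-\frac{\pi}{2}\left(\frac{k^2}{\rho}+\rho\ell^2\right)},\qquad Z_\rho=\sum_{(k,\ell)\in\mathbb{Z}^2}e^{-\frac{\pi}{2}\left(\frac{k^2}{\rho}+\rho\ell^2\right)}.$$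
   Context: Honeycomb lattice: let $\Lambda\subset\mathbb{R}^2$ be the lattice generated by $u=(\tfrac32,\tfrac{\sqrt3}{2})$ and $y=(0,\sqrt3)$. $H$ is the bipartite planar graph with white vertices $\Lambda$, black vertices $\Lambda+(1,0)$, each white vertex $v$ being joined to the black vertices $v+(1,0)$ (edge of type I), $v+(-\tfrac12,\tfrac{\sqrt3}{2})$ (type II) and $v+(-\tfrac12,-\tfrac{\sqrt3}{2})$ (type III). Let $x=(3,0)$. For positive integers $m,n$, $H_{m,n}$ is the finite bipartite (multi)graph $H/(\mathbb{Z}mx+\mathbb{Z}ny)$, embedded in the torus $\mathbb{T}=\mathbb{R}^2/(\mathbb{Z}mx+\mathbb{Z}ny)$; it has $4mn$ vertices. Let $\gamma^h,\gamma^v$ be the closed loops in $\mathbb{T}$ that are the images of the segments from $0$ to $mx$ and from $0$ to $ny$; their classes form a basis of $H_1(\mathbb{T})\simeq\mathbb{Z}^2$. A dimer configuration of $H_{m,n}$ is a perfect matching (a set of edges such that every vertex is incident to exactly one of them). For $M,M_0$ dimer configurations, the superimposition of $M$ and $M_0$ is a union of doubled edges and simple alternating cycles; orient edges of $M$ from white to black and edges of $M_0$ from black to white, so that each cycle becomes an oriented loop, and let $M\ominus M_0$ be the set of these oriented loops. The winding number of $M$ is $\mathrm{wind}_{M_0}(M)=\sum_{C\in M\ominus M_0}[C]\in\mathbb{Z}^2$, where $[C]$ is the homology class of $C$ in the basis $([\gamma^h],[\gamma^v])$ (first coordinate horizontal, second vertical). Reference configuration: for $n$ a multiple of $3$, $M_0$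 is the dimer configuration of $H_{m,n}$ generated by translations of a fixed dimer configuration of $H_{1,3}$ with two edges of each type (so $M_0$ has $\frac{2mn}{3}$ edges of each type I, II, III). Concretely one may take: a white vertex $iu+jy$ is matched along its edge of type II, III, I according to whether $i-j\equiv 0,1,2\pmod 3$; the winding number is the same for every reference configuration having $\frac{2mn}{3}$ edges of each type. Write $\mathrm{wind}_{m,n}$ for the random variable $M\mapsto\mathrm{wind}_{M_0}(M)$ when $M$ is uniformly distributed among all dimer configurations of $H_{m,n}$. *)

theory Defs
  imports "HOL-Homology.Homology" "HOL-Probability.Probability"
begin

section \<open>The honeycomb lattice and its toroidal quotients\<close>

type_synonym point = "real \<times> real"

definition gen_u :: point where "gen_u = (3/2, sqrt 3 / 2)"
definition gen_y :: point where "gen_y = (0, sqrt 3)"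
definition gen_x :: point where "gen_x = (3, 0)"

definition Lambda :: "point set" where
  "Lambda = {of_int i *\<^sub>R gen_u + of_int j *\<^sub>R gen_y | i j :: int. True}"

datatype edge_type = Type_I | Type_II | Type_III

fun step :: "edge_type \<Rightarrow> point" where
  "step Type_I = (1, 0)"
| "step Type_II = (- 1/2, sqrt 3 / 2)"
| "step Type_III = (- 1/2, - sqrt 3 / 2)"

definition periods :: "nat \<Rightarrow> nat \<Rightarrow> point set" where
  "periods m n = {of_int a *\<^sub>R (real m *\<^sub>R gen_x) + of_int b *\<^sub>R (real n *\<^sub>R gen_y) | a b :: int. True}"

text \<open>A point of the torus is a coset of the period lattice. The translate by a vector \<open>d\<close> of
  such a point \<open>P\<close> is the coset \<open>(+) d ` P\<close>.\<close>

type_synonym tpoint = "point set"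

definition proj :: "nat \<Rightarrow> nat \<Rightarrow> point \<Rightarrow> tpoint" where
  "proj m n z = (+) z ` periods m n"

definition torus :: "nat \<Rightarrow> nat \<Rightarrow> tpoint topology" where
  "torus m n = topology (\<lambda>U. U \<subseteq> range (proj m n) \<and> open (proj m n -` U))"

lemma openin_torus:
  "openin (torus m n) U \<longleftrightarrow> U \<subseteq> range (proj m n) \<and> open (proj m n -` U)"
proof -
  have "istopology (\<lambda>U. U \<subseteq> range (proj m n) \<and> open (proj m n -` U))"
    unfolding istopology_def by (auto simp: vimage_Union)
  then show ?thesis
    by (simp add: torus_def)
qed

lemma topspace_torus: "topspace (torus m n) = range (proj m n)"
proof
  show "topspace (torus m n) \<subseteq> range (proj m n)"
    using openin_topspace [of "torus m n"] by (simp only: openin_torus)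
  have "openin (torus m n) (range (proj m n))"
    by (simp add: openin_torus vimage_def)
  then show "range (proj m n) \<subseteq> topspace (torus m n)"
    by (rule openin_subset)
qed

lemma quotient_map_proj: "quotient_map euclidean (torus m n) (proj m n)"
  by (simp add: quotient_map_def topspace_torus openin_torus vimage_def)

definition white :: "nat \<Rightarrow> nat \<Rightarrow> tpoint set" where
  "white m n = proj m n ` Lambda"

definition black :: "nat \<Rightarrow> nat \<Rightarrow> tpoint set" where
  "black m n = proj m n ` ((+) (1, 0) ` Lambda)"

text \<open>An edge is given by its white end and its type, so that parallel edges stay distinct.\<close>

type_synonym edge = "tpoint \<times> edge_type"

definition edges :: "nat \<Rightarrow> nat \<Rightarrow> edge set" where
  "edges m n = white m n \<times> UNIV"

definition white_end :: "edge \<Rightarrow> tpoint" where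
  "white_end e = fst e"

definition black_end :: "edge \<Rightarrow> tpoint" where
  "black_end e = (+) (step (snd e)) ` fst e"

definition dimers :: "nat \<Rightarrow> nat \<Rightarrow> edge set set" where
  "dimers m n = {M. M \<subseteq> edges m n \<and>
     (\<forall>P \<in> white m n \<union> black m n. \<exists>!e. e \<in> M \<and> (P = white_end e \<or> P = black_end e))}"


section \<open>Homology classes of loops in the torus\<close>

text \<open>The singular 1-simplex that is the image of the segment from \<open>p\<close> to \<open>p + d\<close>, where \<open>p\<close> is any
  representative of \<open>P\<close>. The barycentric coordinate \<open>s 1\<close> runs from \<open>0\<close> (vertex 0) to \<open>1\<close>
  (vertex 1).\<close>

definition segment :: "tpoint \<Rightarrow> point \<Rightarrow> (nat \<Rightarrow> real) \<Rightarrow> tpoint" where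
  "segment P d = restrict (\<lambda>s. (+) (s 1 *\<^sub>R d) ` P) (standard_simplex 1)"

definition H1_class :: "nat \<Rightarrow> nat \<Rightarrow> tpoint chain \<Rightarrow> tpoint chain set" where
  "H1_class m n c = homologous_rel_set 1 (torus m n) {} c"

definition gamma_h :: "nat \<Rightarrow> nat \<Rightarrow> tpoint chain" where
  "gamma_h m n = frag_of (segment (proj m n 0) (real m *\<^sub>R gen_x))"

definition gamma_v :: "nat \<Rightarrow> nat \<Rightarrow> tpoint chain" where
  "gamma_v m n = frag_of (segment (proj m n 0) (real n *\<^sub>R gen_y))"

definition H1_coords :: "nat \<Rightarrow> nat \<Rightarrow> tpoint chain \<Rightarrow> int \<times> int" where
  "H1_coords m n c = (THE (a, b).
     H1_class m n c =
       (H1_class m n (gamma_h m n) [^]\<^bsub>homology_group 1 (torus m n)\<^esub> a)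
         \<otimes>\<^bsub>homology_group 1 (torus m n)\<^esub>
       (H1_class m n (gamma_v m n) [^]\<^bsub>homology_group 1 (torus m n)\<^esub> b))"


section \<open>Superimposition and winding number\<close>

text \<open>An oriented edge is given by its starting point and its displacement.\<close>

type_synonym arc = "tpoint \<times> point"

definition arc_end :: "arc \<Rightarrow> tpoint" where
  "arc_end a = (+) (snd a) ` fst a"

text \<open>The non-doubled edges of the superimposition, those of \<open>M\<close> oriented from white to black and
  those of \<open>M0\<close> from black to white.\<close>

definition arcs :: "edge set \<Rightarrow> edge set \<Rightarrow> arc set" where
  "arcs M M0 = (\<lambda>e. (white_end e, step (snd e))) ` (M - M0)
             \<union> (\<lambda>e. (black_end e, - step (snd e))) ` (M0 - M)"

text \<open>The oriented loops are the connected components of these arcs, as every vertex has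
  at most one incoming and one outgoing arc.\<close>

definition ominus :: "edge set \<Rightarrow> edge set \<Rightarrow> arc set set" (infixl "\<ominus>\<^sub>d" 65) where
  "M \<ominus>\<^sub>d M0 = arcs M M0 //
     {(a, b). a \<in> arcs M M0 \<and> b \<in> arcs M M0 \<and> (arc_end a = fst b \<or> arc_end b = fst a)}\<^sup>*"

definition loop_chain :: "arc set \<Rightarrow> tpoint chain" where
  "loop_chain C = (\<Sum>(P, d) \<in> C. frag_of (segment P d))"

definition wind :: "nat \<Rightarrow> nat \<Rightarrow> edge set \<Rightarrow> edge set \<Rightarrow> int \<times> int" where
  "wind m n M0 M = (\<Sum>C \<in> M \<ominus>\<^sub>d M0. H1_coords m n (loop_chain C))"

text \<open>The configuration generated by the translates of a dimer configuration \<open>R\<close> of the quotient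
  with parameters 1 and 3; the parameter \<open>n\<close> is meant to be a multiple of 3.\<close>

definition reference :: "edge set \<Rightarrow> nat \<Rightarrow> nat \<Rightarrow> edge set" where
  "reference R m n = {(proj m n v, t) | v t. v \<in> Lambda \<and> (proj 1 3 v, t) \<in> R}"

definition wind_pmf :: "edge set \<Rightarrow> nat \<Rightarrow> nat \<Rightarrow> (int \<times> int) pmf" where
  "wind_pmf R m n = map_pmf (wind m n (reference R m n)) (pmf_of_set (dimers m n))"


section \<open>The limiting law and convergence in distribution\<close>

definition gauss_weight :: "real \<Rightarrow> int \<times> int \<Rightarrow> real" where
  "gauss_weight \<rho> = (\<lambda>(k, l). exp (- (pi / 2) * ((of_int k)\<^sup>2 / \<rho> + \<rho> * (of_int l)\<^sup>2)))"

definition gauss_Z :: "real \<Rightarrow> real" where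
  "gauss_Z \<rho> = (\<Sum>\<^sub>\<infinity> kl \<in> UNIV. gauss_weight \<rho> kl)"

definition wind_limit :: "real \<Rightarrow> (int \<times> int) pmf" where
  "wind_limit \<rho> = embed_pmf (\<lambda>kl. gauss_weight \<rho> kl / gauss_Z \<rho>)"

definition converges_in_distribution ::
    "(nat \<Rightarrow> 'a::topological_space pmf) \<Rightarrow> 'a pmf \<Rightarrow> bool" where
  "converges_in_distribution P Q \<longleftrightarrow>
     (\<forall>f :: 'a \<Rightarrow> real. continuous_on UNIV f \<and> bounded (range f) \<longrightarrow>
        (\<lambda>i. measure_pmf.expectation (P i) f) \<longlonglongrightarrow> measure_pmf.expectation Q f)"


section \<open>Sanity checks: segments are singular simplices, and a reference configuration exists\<close>

lemma segment_simplex: "singular_simplex 1 (torus m n) (segment (proj m n p) d)"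
proof -
  have 1: "segment (proj m n p) d = restrict (proj m n \<circ> (\<lambda>s. p + s 1 *\<^sub>R d)) (standard_simplex 1)"
    unfolding segment_def proj_def by (auto simp: fun_eq_iff restrict_def image_image algebra_simps)
  have "continuous_map (powertop_real UNIV) euclidean (\<lambda>s::nat\<Rightarrow>real. p + s 1 *\<^sub>R d)"
    by (auto simp: euclidean_product_topology intro!: continuous_intros)
  then have "continuous_map (subtopology (powertop_real UNIV) (standard_simplex 1)) (torus m n)
     (proj m n \<circ> (\<lambda>s. p + s 1 *\<^sub>R d))"
    using quotient_map_proj[of m n]
    by (meson continuous_map_compose continuous_map_from_subtopology quotient_imp_continuous_map)
  then show ?thesis unfolding 1 singular_simplex_def
    by (auto simp: continuous_map_eq restrict_def extensional_def elim: continuous_map_eq)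
qed

lemma proj_eq_iff: "proj m n v = proj m n w \<longleftrightarrow> v - w \<in> periods m n"
proof
  have z: "0 \<in> periods m n"
    unfolding periods_def by (rule CollectI, rule exI[of _ 0], rule exI[of _ 0]) auto
  assume "proj m n v = proj m n w"
  moreover have "v \<in> proj m n v" using z unfolding proj_def by force
  ultimately obtain l where "l \<in> periods m n" "v = w + l" unfolding proj_def by auto
  then show "v - w \<in> periods m n" by simp
next
  have add: "k + l \<in> periods m n" if kl: "k \<in> periods m n" "l \<in> periods m n" for k l
  proof -
    obtain a b :: int where
      "k = of_int a *\<^sub>R (real m *\<^sub>R gen_x) + of_int b *\<^sub>R (real n *\<^sub>R gen_y)"
      using kl(1) unfolding periods_def by blast
    moreover obtain a' b' :: int where
      "l = of_int a' *\<^sub>R (real m *\<^sub>R gen_x) + of_int b' *\<^sub>R (real n *\<^sub>R gen_y)"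
      using kl(2) unfolding periods_def by blast
    ultimately show ?thesis unfolding periods_def
      by (intro CollectI exI[of _ "a + a'"] exI[of _ "b + b'"]) (simp add: algebra_simps)
  qed
  have neg: "- k \<in> periods m n" if kl: "k \<in> periods m n" for k
  proof -
    obtain a b :: int where
      "k = of_int a *\<^sub>R (real m *\<^sub>R gen_x) + of_int b *\<^sub>R (real n *\<^sub>R gen_y)"
      using kl unfolding periods_def by blast
    then show ?thesis unfolding periods_def
      by (intro CollectI exI[of _ "- a"] exI[of _ "- b"]) (simp add: algebra_simps)
  qed
  assume l: "v - w \<in> periods m n"
  show "proj m n v = proj m n w"
  proof (intro equalityI subsetI)
    fix p assume "p \<in> proj m n v"
    then obtain k where "k \<in> periods m n" "p = v + k" unfolding proj_def by auto
    then have "p = w + ((v - w) + k)" "(v - w) + k \<in> periods m n" using add l by auto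
    then show "p \<in> proj m n w" unfolding proj_def by blast
  next
    fix p assume "p \<in> proj m n w"
    then obtain k where "k \<in> periods m n" "p = w + k" unfolding proj_def by auto
    moreover have "- (v - w) + k \<in> periods m n" using add neg l \<open>k \<in> periods m n\<close> by blast
    ultimately have "p = v + (- (v - w) + k)" "- (v - w) + k \<in> periods m n" by simp_all
    then show "p \<in> proj m n v" unfolding proj_def by blast
  qed
qed

lemma translate_proj: "(+) d ` proj m n v = proj m n (d + v)"
  unfolding proj_def by (auto simp: image_image algebra_simps)

lemma reference_exists: "\<exists>R \<in> dimers 1 3. \<forall>t. card {e \<in> R. snd e = t} = 2"
proof -
  have per: "p \<in> periods 1 3 \<longleftrightarrow> (\<exists>a b::int. p = (3 * of_int a, 3 * sqrt 3 * of_int b))" for p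
    unfolding periods_def gen_x_def gen_y_def by (auto simp: algebra_simps)
  define c where "c s = proj 1 3 (of_int s *\<^sub>R gen_u)" for s :: int
  define b where "b s = (+) (1,0) ` c s" for s
  have c_eq: "c s = c t \<longleftrightarrow> 6 dvd (s - t)" for s t
  proof
    assume "c s = c t"
    then obtain k l :: int where
      "of_int s *\<^sub>R gen_u - of_int t *\<^sub>R gen_u = (3 * of_int k, 3 * sqrt 3 * of_int l)"
      unfolding c_def proj_eq_iff per by blast
    then have "(of_int s - of_int t) * sqrt 3 = (6 * of_int l) * sqrt 3"
      by (simp add: gen_u_def algebra_simps)
    then have "real_of_int (s - t) = real_of_int (6 * l)" by simp
    then show "6 dvd (s - t)" by (metis dvd_triv_left of_int_eq_iff)
  next
    assume "6 dvd (s - t)"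
    then obtain k where "s = t + 6 * k" by (metis add.commute diff_add_cancel dvdE)
    then show "c s = c t" unfolding c_def proj_eq_iff per
      by (intro exI[of _ "3 * k"] exI[of _ k]) (simp add: gen_u_def algebra_simps)
  qed
  have b_eq: "b s = b t \<longleftrightarrow> 6 dvd (s - t)" for s t
    unfolding b_def c_eq[symmetric] by (rule inj_image_eq_iff) (auto intro: injI)
  have cb: "c s \<noteq> b t" for s t
  proof
    assume "c s = b t"
    then obtain k l :: int where
      "of_int s *\<^sub>R gen_u - ((1,0) + of_int t *\<^sub>R gen_u) = (3 * of_int k, 3 * sqrt 3 * of_int l)"
      unfolding c_def b_def translate_proj proj_eq_iff per by blast
    then have "real_of_int (3 * s - 3 * t - 2) = real_of_int (6 * k)"
      by (simp add: gen_u_def algebra_simps)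
    then have "3 * s - 3 * t - 2 = 6 * k" by (simp only: of_int_eq_iff)
    then show False by presburger
  qed
  have lam: "proj 1 3 (of_int i *\<^sub>R gen_u + of_int j *\<^sub>R gen_y) = c (i + 2 * j)" for i j
    unfolding c_def proj_eq_iff per
    by (intro exI[of _ "- j"] exI[of _ 0]) (simp add: gen_u_def gen_y_def algebra_simps)
  have wh: "white 1 3 = range c"
  proof (intro equalityI subsetI)
    fix p assume "p \<in> range c"
    then obtain s where "p = c s" by auto
    then have "p = proj 1 3 (of_int s *\<^sub>R gen_u + of_int 0 *\<^sub>R gen_y)" using lam[of s 0] by simp
    then show "p \<in> white 1 3" unfolding white_def Lambda_def by blast
  next
    fix p assume "p \<in> white 1 3"
    then obtain i j where "p = proj 1 3 (of_int i *\<^sub>R gen_u + of_int j *\<^sub>R gen_y)"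
      unfolding white_def Lambda_def by blast
    then show "p \<in> range c" unfolding lam by blast
  qed
  have bl: "black 1 3 = range b"
  proof -
    have "black 1 3 = (\<lambda>p. (+) (1,0) ` p) ` white 1 3"
      unfolding black_def white_def image_image translate_proj ..
    then show ?thesis unfolding wh by (auto simp: b_def)
  qed
  have st: "(+) (step Type_I) ` c s = b s" "(+) (step Type_II) ` c s = b (s + 1)"
    "(+) (step Type_III) ` c s = b (s - 1)" for s
  proof -
    show "(+) (step Type_I) ` c s = b s" by (simp add: b_def)
    show "(+) (step Type_II) ` c s = b (s + 1)"
      unfolding b_def c_def translate_proj proj_eq_iff per
      by (intro exI[of _ "- 1"] exI[of _ 0]) (simp add: gen_u_def algebra_simps)
    show "(+) (step Type_III) ` c s = b (s - 1)"
      unfolding b_def c_def translate_proj proj_eq_iff per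
      by (intro exI[of _ 0] exI[of _ 0]) (simp add: gen_u_def field_simps zero_prod_def)
  qed
  define ty where "ty s = (if s mod 3 = 0 then Type_II else if s mod 3 = 1 then Type_III else Type_I)"
    for s :: int
  define f where "f s = (if s mod 3 = 0 then s + 1 else if s mod 3 = 1 then s - 1 else s)"
    for s :: int
  define R where "R = range (\<lambda>s. (c s, ty s))"
  have be: "black_end (c s, ty s) = b (f s)" for s
    by (simp add: black_end_def ty_def f_def st del: step.simps)
  have same: "(c s, ty s) = (c t, ty t)" if "6 dvd (s - t)" for s t
  proof -
    have "s mod 3 = t mod 3" using that by presburger
    then show ?thesis using that by (simp add: c_eq ty_def)
  qed
  have ff: "6 dvd (f (f s) - s)" for s unfolding f_def by presburger
  have fi: "6 dvd (s - t)" if "6 dvd (f s - f t)" for s t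
    using that unfolding f_def by (simp split: if_splits; presburger)
  have "R \<in> dimers 1 3"
    unfolding dimers_def
  proof (intro CollectI conjI ballI)
    show "R \<subseteq> edges 1 3" by (auto simp: R_def edges_def wh simp del: One_nat_def)
  next
    fix P assume "P \<in> white 1 3 \<union> black 1 3"
    then consider s where "P = c s" | s where "P = b s" unfolding wh bl by auto
    then show "\<exists>!e. e \<in> R \<and> (P = white_end e \<or> P = black_end e)"
    proof cases
      case (1 s)
      show ?thesis
      proof (rule ex1I[of _ "(c s, ty s)"])
        fix e assume "e \<in> R \<and> (P = white_end e \<or> P = black_end e)"
        then obtain t where t: "e = (c t, ty t)" "c s = c t \<or> c s = b (f t)"
          using 1 unfolding R_def by (auto simp: be white_end_def)
        then have "6 dvd (t - s)" using cb c_eq by metis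
        then show "e = (c s, ty s)" using same t by blast
      qed (auto simp: 1 R_def white_end_def)
    next
      case (2 s)
      show ?thesis
      proof (rule ex1I[of _ "(c (f s), ty (f s))"])
        have "b s = b (f (f s))" using ff b_eq by metis
        then show "(c (f s), ty (f s)) \<in> R \<and>
          (P = white_end (c (f s), ty (f s)) \<or> P = black_end (c (f s), ty (f s)))"
          by (auto simp: 2 R_def be)
        fix e assume "e \<in> R \<and> (P = white_end e \<or> P = black_end e)"
        then obtain t where t: "e = (c t, ty t)" "b s = c t \<or> b s = b (f t)"
          using 2 unfolding R_def by (auto simp: be white_end_def)
        then have "b (f t) = b (f (f s))" using cb \<open>b s = b (f (f s))\<close> by metis
        then have "6 dvd (t - f s)" using b_eq fi by blast
        then show "e = (c (f s), ty (f s))" using same t by blast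
      qed
    qed
  qed
  moreover have "card {e \<in> R. snd e = t} = 2" for t
  proof -
    define k :: int where "k = (case t of Type_II \<Rightarrow> 0 | Type_III \<Rightarrow> 1 | Type_I \<Rightarrow> 2)"
    have tk: "ty s = t \<longleftrightarrow> 3 dvd (s - k)" for s
      by (cases t; simp add: ty_def k_def; presburger)
    have "{e \<in> R. snd e = t} = {(c k, t), (c (k + 3), t)}" (is "?A = ?B")
    proof (intro equalityI subsetI)
      fix e assume "e \<in> ?A"
      then obtain s where "e = (c s, t)" "ty s = t" unfolding R_def by auto
      then have s: "e = (c s, t)" "3 dvd (s - k)" using tk by blast+
      then have "6 dvd (s - k) \<or> 6 dvd (s - (k + 3))" by presburger
      then show "e \<in> ?B" using s c_eq by auto
    next
      fix e assume "e \<in> ?B"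
      moreover have "ty k = t" "ty (k + 3) = t" using tk[of k] tk[of "k + 3"] by auto
      ultimately show "e \<in> ?A" unfolding R_def by force
    qed
    moreover have "c k \<noteq> c (k + 3)" by (simp add: c_eq)
    ultimately show ?thesis by simp
  qed
  ultimately show ?thesis by blast
qed

end

(* Displacements of oriented edges determine homology classes, so the winding number of a
configuration is read off from its numbers of edges of each type: the non-horizontal edges form k
lattice paths that cross every column and make l turns around the vertical direction in total, and
the winding number is (2n/3 - k, l). Configurations are permutations whose sign depends only on
the parities of k and l, so a determinant over Fourier modes evaluates
  sum over M of (-1)^(k l) z^k e^(i l t) = product over b < n of (1 + z (2 cos((2 pi b + pi + t)/(2n)))^(2m)).
The modes above 1 are factored out; their product is asymptotically Gaussian in t. The remaining
modes concentrate at the two Fermi points, where they become geometric progressions, and by the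
Jacobi triple product the limit is a product of two theta functions. Its Fourier coefficients are
the discrete Gaussian weights. Four of these signed sums recover the unsigned one, which bounds
all Fourier integrands and gives tightness, hence the normalization. *)
theory Submission
  imports Defs "Jordan_Normal_Form.Determinant" "HOL-Real_Asymp.Real_Asymp"
begin

section \<open>Homology of the torus\<close>

text \<open>With n = 3p, the outer 2p of the n modes have 2|cos| at least 1, so the power z^(2n/3)
  dominates and the winding number comes out centred. At a Fermi point (2 cos)^2 has slope -sqrt 3
  in the doubled angle, neighbouring modes are 2 pi/n apart and m/n tends to 1/(sqrt 3 rho).
  Successive factors thus have limiting ratio exp(-2 pi/rho) = r^2, and the half step in the angles
  yields the odd powers of r. The signed sums have terms of both signs, so they do not bound
  themselves, and their limit is derived for |t| <= pi, where no mode crosses a Fermi point. The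
  unsigned sum uses t and t + pi, which leaves the window [-pi, 0]; tightness in l therefore works
  with one-sided averages. The limit of the total count is never evaluated: tightness identifies it
  with the sum of the coefficientwise limits, so every product formula is needed only up to a
  positive constant. On the topological side, the definite description of homology coordinates
  requires that the two basis loops be independent; this is read off from continuous logarithms of
  phase functions on the torus.\<close>

lemma zero_in_periods: "0 \<in> periods m n"
  unfolding periods_def by (rule CollectI, rule exI[of _ 0], rule exI[of _ 0]) auto

lemma linear_simplex:
  "singular_simplex q (torus m n)
     (restrict (\<lambda>s. proj m n (p + s 1 *\<^sub>R d + s 2 *\<^sub>R e)) (standard_simplex q))"
proof -
  have "continuous_map (powertop_real UNIV) euclidean (\<lambda>s::nat\<Rightarrow>real. p + s 1 *\<^sub>R d + s 2 *\<^sub>R e)"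
    by (auto simp: euclidean_product_topology intro!: continuous_intros)
  then have "continuous_map (subtopology (powertop_real UNIV) (standard_simplex q)) (torus m n)
     (proj m n \<circ> (\<lambda>s. p + s 1 *\<^sub>R d + s 2 *\<^sub>R e))"
    using quotient_map_proj[of m n]
    by (meson continuous_map_compose continuous_map_from_subtopology quotient_imp_continuous_map)
  then show ?thesis unfolding singular_simplex_def
    by (auto simp: restrict_def extensional_def elim: continuous_map_eq)
qed

lemma standard_simplex_1D: "s \<in> standard_simplex 1 \<Longrightarrow> s 0 + s 1 = 1"
  by (auto simp: standard_simplex_def)

lemma segment_proj: "segment (proj m n p) d = restrict (\<lambda>s. proj m n (p + s 1 *\<^sub>R d)) (standard_simplex 1)"
  unfolding segment_def translate_proj by (simp add: add.commute)

text \<open>The triangle with vertices \<open>p\<close>, \<open>p + d\<close>,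
  \<open>p + d + e\<close> is mapped affinely into the torus; its faces are exactly the three
  segments, so their alternating sum is a boundary.\<close>

lemma segment_add:
  "homologous_rel 1 (torus m n) {}
     (frag_of (segment (proj m n p) d) + frag_of (segment (proj m n (p + d)) e))
     (frag_of (segment (proj m n p) (d + e)))"
proof -
  define T where "T = restrict (\<lambda>s. proj m n (p + s 1 *\<^sub>R d + s 2 *\<^sub>R (d + e))) (standard_simplex 2)"
  have T: "singular_simplex 2 (torus m n) T"
    unfolding T_def by (rule linear_simplex)
  have mem: "simplical_face k s \<in> standard_simplex 2" if "s \<in> standard_simplex 1" "k \<le> 2"
    for k and s :: "nat \<Rightarrow> real"
    using simplical_face_in_standard_simplex[of 2 k s] that by simp
  have f0: "singular_face 2 0 T = segment (proj m n (p + d)) e"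
  proof -
    have "T (simplical_face 0 s) = proj m n (p + d + s 1 *\<^sub>R e)" if s: "s \<in> standard_simplex 1" for s
    proof -
      \<comment> \<open>Face 0 omits the vertex \<open>p\<close>, so the barycentric coordinates are
        shifted by one; \<open>s 0 + s 1 = 1\<close> then moves the base point to
        \<open>p + d\<close>.\<close>
      have "T (simplical_face 0 s) = proj m n (p + s 0 *\<^sub>R d + s 1 *\<^sub>R (d + e))"
        using mem[OF s, of 0] by (simp add: T_def simplical_face_def)
      also have "p + s 0 *\<^sub>R d + s 1 *\<^sub>R (d + e) = p + (s 0 + s 1) *\<^sub>R d + s 1 *\<^sub>R e"
        by (simp add: algebra_simps)
      finally show ?thesis unfolding standard_simplex_1D[OF s] by simp
    qed
    then show ?thesis by (auto simp: singular_face_def segment_proj restrict_def fun_eq_iff)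
  qed
  have f1: "singular_face 2 1 T = segment (proj m n p) (d + e)"
  proof -
    have "T (simplical_face 1 s) = proj m n (p + s 1 *\<^sub>R (d + e))" if s: "s \<in> standard_simplex 1" for s
      using mem[OF s, of 1] by (simp add: T_def simplical_face_def)
    then show ?thesis by (auto simp: singular_face_def segment_proj restrict_def fun_eq_iff)
  qed
  have f2: "singular_face 2 2 T = segment (proj m n p) d"
  proof -
    have "T (simplical_face 2 s) = proj m n (p + s 1 *\<^sub>R d)" if s: "s \<in> standard_simplex 1" for s
      using mem[OF s, of 2] by (simp add: T_def simplical_face_def)
    then show ?thesis by (auto simp: singular_face_def segment_proj restrict_def fun_eq_iff)
  qed
  have "chain_boundary 2 (frag_of T) = frag_of (singular_face 2 0 T)
      - frag_of (singular_face 2 1 T) + frag_of (singular_face 2 2 T)"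
    by (simp add: chain_boundary_of numeral_2_eq_2 frag_cmul_minus_one)
  then have "chain_boundary 2 (frag_of T) =
     (frag_of (segment (proj m n p) d) + frag_of (segment (proj m n (p + d)) e))
      - frag_of (segment (proj m n p) (d + e))"
    unfolding f0 f1 f2 by (simp add: algebra_simps)
  moreover have "singular_chain 2 (torus m n) (frag_of T)"
    using T by (simp add: singular_chain_of)
  ultimately show ?thesis
    unfolding homologous_rel_def singular_boundary
    by (metis Suc_1)
qed

section \<open>Increments of continuous logarithms as a homology invariant\<close>

definition lift_incr :: "(tpoint \<Rightarrow> complex) \<Rightarrow> ((nat \<Rightarrow> real) \<Rightarrow> tpoint) \<Rightarrow> complex" where
  "lift_incr \<phi> f = (THE w. \<exists>g. continuous_on {0..1::real} g \<and>
     (\<forall>t\<in>{0..1}. \<phi> (f (\<lambda>i. if i = 0 then 1 - t else if i = 1 then t else 0)) = exp (g t)) \<and>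
     w = g 1 - g 0)"

text \<open>Two continuous logarithms along the path differ by a continuous function with values in
  the multiples of 2 pi i, hence by a constant. The definite description may thus be evaluated with
  any explicit logarithm.\<close>

lemma lift_incr_eq:
  assumes "continuous_on {0..1::real} g"
    and "\<And>t. t \<in> {0..1} \<Longrightarrow> \<phi> (f (\<lambda>i. if i = 0 then 1 - t else if i = 1 then t else 0)) = exp (g t)"
  shows "lift_incr \<phi> f = g 1 - g 0"
  unfolding lift_incr_def
proof (rule the_equality)
  show "\<exists>g'. continuous_on {0..1} g' \<and>
     (\<forall>t\<in>{0..1}. \<phi> (f (\<lambda>i. if i = 0 then 1 - t else if i = 1 then t else 0)) = exp (g' t)) \<and>
     g 1 - g 0 = g' 1 - g' 0"
    using assms by blast
next
  fix w
  assume "\<exists>h. continuous_on {0..1} h \<and>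
     (\<forall>t\<in>{0..1}. \<phi> (f (\<lambda>i. if i = 0 then 1 - t else if i = 1 then t else 0)) = exp (h t)) \<and>
     w = h 1 - h 0"
  then obtain h where h: "continuous_on {0..1} h"
    "\<And>t. t \<in> {0..1} \<Longrightarrow> \<phi> (f (\<lambda>i. if i = 0 then 1 - t else if i = 1 then t else 0)) = exp (h t)"
    "w = h 1 - h 0" by blast
  have "\<exists>k::int. g t - h t = complex_of_real (2 * pi * of_int k) * \<i>" if "t \<in> {0..1}" for t
  proof -
    have "exp (g t) = exp (h t)" using assms(2)[OF that] h(2)[OF that] by simp
    then obtain k :: int where "g t = h t + (of_int (2 * k) * pi) * \<i>" unfolding exp_eq by blast
    then show ?thesis by (intro exI[of _ k]) simp
  qed
  then obtain k :: "real \<Rightarrow> int"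
    where k: "\<And>t. t \<in> {0..1} \<Longrightarrow> g t - h t = complex_of_real (2 * pi * of_int (k t)) * \<i>" by metis
  have "(\<lambda>t. g t - h t) constant_on {0..1}"
  proof (rule continuous_discrete_range_constant)
    show "connected {0..1::real}" by simp
    show "continuous_on {0..1} (\<lambda>t. g t - h t)" using assms(1) h(1) by (intro continuous_intros)
    fix x :: real assume x: "x \<in> {0..1}"
    \<comment> \<open>Distinct multiples of 2 pi i are at least 2 pi apart, which is the gap
      demanded by \<open>continuous_discrete_range_constant\<close>.\<close>
    have "2 * pi \<le> norm ((g y - h y) - (g x - h x))"
      if y: "y \<in> {0..1}" "g y - h y \<noteq> g x - h x" for y
    proof -
      have "k y \<noteq> k x" using y k[OF x] k[OF y(1)] by auto
      then have "\<bar>real_of_int (k y - k x)\<bar> \<ge> 1" by linarith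
      moreover have "(g y - h y) - (g x - h x) = complex_of_real (2 * pi * of_int (k y - k x)) * \<i>"
        unfolding k[OF x] k[OF y(1)] by (simp add: algebra_simps)
      then have "norm ((g y - h y) - (g x - h x)) = 2 * pi * \<bar>real_of_int (k y - k x)\<bar>"
        by (simp only: norm_mult norm_of_real norm_ii abs_mult) simp
      ultimately show ?thesis by simp
    qed
    then show "\<exists>e>0. \<forall>y. y \<in> {0..1} \<and> g y - h y \<noteq> g x - h x \<longrightarrow> e \<le> norm (g y - h y - (g x - h x))"
      by (intro exI[of _ "2 * pi"]) auto
  qed
  then obtain c where "\<And>t. t \<in> {0..1} \<Longrightarrow> g t - h t = c" unfolding constant_on_def by blast
  then have "g 1 - h 1 = g 0 - h 0" by simp
  then show "w = g 1 - g 0" unfolding h(3) by (simp add: algebra_simps)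
qed

definition chain_incr :: "(tpoint \<Rightarrow> complex) \<Rightarrow> tpoint chain \<Rightarrow> complex" where
  "chain_incr \<phi> c = (\<Sum>f \<in> Poly_Mapping.keys c. of_int (poly_mapping.lookup c f) * lift_incr \<phi> f)"

lemma chain_incr_add: "chain_incr \<phi> (a + b) = chain_incr \<phi> a + chain_incr \<phi> b"
  unfolding chain_incr_def
  by (rule setsum_keys_plus_distrib[where f = "\<lambda>f k. of_int k * lift_incr \<phi> f"])
     (auto simp: algebra_simps)

lemma chain_incr_zero [simp]: "chain_incr \<phi> 0 = 0"
  by (simp add: chain_incr_def)

lemma chain_incr_diff: "chain_incr \<phi> (a - b) = chain_incr \<phi> a - chain_incr \<phi> b"
  using chain_incr_add[of \<phi> "a - b" b] by simp

lemma chain_incr_of [simp]: "chain_incr \<phi> (frag_of f) = lift_incr \<phi> f"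
  by (simp add: chain_incr_def)

lemma chain_incr_cmul: "chain_incr \<phi> (frag_cmul k a) = of_int k * chain_incr \<phi> a"
proof (cases "k = 0")
  case False
  then have "Poly_Mapping.keys (frag_cmul k a) = Poly_Mapping.keys a" by (auto simp: in_keys_iff)
  then show ?thesis by (simp add: chain_incr_def sum_distrib_left mult.assoc)
qed simp

text \<open>The cocycle property: on a contractible triangle a nowhere zero function has one global
  logarithm \<open>G\<close>, and the increments along the three faces are differences of its vertex
  values, which cancel.\<close>

lemma chain_incr_face_sum:
  assumes \<phi>: "continuous_map X euclidean \<phi>" "\<And>P. P \<in> topspace X \<Longrightarrow> \<phi> P \<noteq> 0"
    and \<tau>: "singular_simplex 2 X \<tau>"
  shows "chain_incr \<phi> (chain_boundary 2 (frag_of \<tau>)) = 0"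
proof -
  \<comment> \<open>Coordinates 1 and 2 parametrize the 2-simplex by a planar triangle, whose
    convexity is clear from three half-planes.\<close>
  define pt where "pt = (\<lambda>(a::real,b::real) (i::nat). if i = 0 then 1 - a - b else if i = 1 then a else if i = 2 then b else 0)"
  define Tr where "Tr = {(a::real,b::real). 0 \<le> a \<and> 0 \<le> b \<and> a + b \<le> 1}"
  have pt_in: "pt z \<in> standard_simplex 2" if "z \<in> Tr" for z
    using that by (auto simp: pt_def Tr_def standard_simplex_def numeral_2_eq_2)
  have "continuous_map (top_of_set Tr) (powertop_real UNIV) pt"
    unfolding continuous_map_componentwise_UNIV
  proof
    fix k :: nat
    consider "k = 0" | "k = 1" | "k = 2" | "k > 2" by linarith
    then show "continuous_map (top_of_set Tr) euclideanreal (\<lambda>z. pt z k)"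
      by cases (auto simp: pt_def case_prod_unfold intro!: continuous_intros)
  qed
  then have "continuous_map (top_of_set Tr) (subtopology (powertop_real UNIV) (standard_simplex 2)) pt"
    using pt_in by (auto simp: continuous_map_in_subtopology)
  moreover have "continuous_map (subtopology (powertop_real UNIV) (standard_simplex 2)) X \<tau>"
    using \<tau> by (simp add: singular_simplex_def)
  ultimately have ct: "continuous_map (top_of_set Tr) X (\<tau> \<circ> pt)" by (rule continuous_map_compose)
  have "continuous_map (top_of_set Tr) euclidean (\<phi> \<circ> (\<tau> \<circ> pt))"
    using ct \<phi>(1) by (rule continuous_map_compose)
  then have "continuous_on Tr (\<phi> \<circ> (\<tau> \<circ> pt))" by simp
  moreover have "(\<phi> \<circ> (\<tau> \<circ> pt)) z \<noteq> 0" if "z \<in> Tr" for z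
    using \<phi>(2) ct that by (auto simp: continuous_map_def Pi_iff)
  moreover have "contractible Tr"
  proof (rule convex_imp_contractible)
    have "Tr = {z. inner (-1,0) z \<le> 0} \<inter> {z. inner (0,-1) z \<le> 0} \<inter> {z. inner (1,1) z \<le> 1}"
      by (auto simp: Tr_def)
    then show "convex Tr" by (simp add: convex_Int convex_halfspace_le)
  qed
  ultimately obtain G where G: "continuous_on Tr G" "\<And>z. z \<in> Tr \<Longrightarrow> (\<phi> \<circ> (\<tau> \<circ> pt)) z = exp (G z)"
    using continuous_logarithm_on_contractible by metis
  \<comment> \<open>\<open>r\<close> is the path in \<open>Tr\<close> swept out by the k-th face;
    \<open>G\<close> along it is a logarithm to which \<open>lift_incr_eq\<close> applies.\<close>
  have face: "lift_incr \<phi> (singular_face 2 k \<tau>) = G (r 1) - G (r 0)"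
    if r: "continuous_on {0..1} r" "\<And>t. t \<in> {0..1} \<Longrightarrow> r t \<in> Tr"
      "\<And>t. t \<in> {0..1} \<Longrightarrow> simplical_face k (\<lambda>i. if i = 0 then 1 - t else if i = 1 then t else 0) = pt (r t)"
    for k and r :: "real \<Rightarrow> real \<times> real"
  proof -
    have "lift_incr \<phi> (singular_face 2 k \<tau>) = (G \<circ> r) 1 - (G \<circ> r) 0"
    proof (rule lift_incr_eq)
      show "continuous_on {0..1} (G \<circ> r)"
        using r G(1) by (intro continuous_on_compose) (auto intro: continuous_on_subset)
      fix t :: real assume t: "t \<in> {0..1}"
      have "(\<lambda>i. if i = 0 then 1 - t else if i = 1 then t else 0) \<in> standard_simplex 1"
        using t by (auto simp: standard_simplex_def)
      then show "\<phi> (singular_face 2 k \<tau> (\<lambda>i. if i = 0 then 1 - t else if i = 1 then t else 0)) = exp ((G \<circ> r) t)"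
        using r(3)[OF t] G(2)[OF r(2)[OF t]] by (simp add: singular_face_def)
    qed
    then show ?thesis by simp
  qed
  have 0: "lift_incr \<phi> (singular_face 2 0 \<tau>) = G (0,1) - G (1,0)"
  proof -
    have "simplical_face 0 (\<lambda>i. if i = 0 then 1 - t else if i = 1 then t else 0) = pt (1 - t, t)" for t
    proof
      fix i :: nat
      consider "i = 0" | "i = 1" | "i = 2" | "i > 2" by linarith
      then show "simplical_face 0 (\<lambda>i. if i = 0 then 1 - t else if i = 1 then t else 0) i = pt (1 - t, t) i"
        by cases (auto simp: pt_def simplical_face_def)
    qed
    moreover have "continuous_on {0..1::real} (\<lambda>t. (1 - t, t))" by (intro continuous_intros)
    ultimately show ?thesis using face[of "\<lambda>t. (1 - t, t)" 0] by (auto simp: Tr_def)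
  qed
  have 1: "lift_incr \<phi> (singular_face 2 1 \<tau>) = G (0,1) - G (0,0)"
  proof -
    have "simplical_face 1 (\<lambda>i. if i = 0 then 1 - t else if i = 1 then t else 0) = pt (0, t)" for t
    proof
      fix i :: nat
      consider "i = 0" | "i = 1" | "i = 2" | "i > 2" by linarith
      then show "simplical_face 1 (\<lambda>i. if i = 0 then 1 - t else if i = 1 then t else 0) i = pt (0, t) i"
        by cases (auto simp: pt_def simplical_face_def)
    qed
    moreover have "continuous_on {0..1::real} (\<lambda>t. (0::real, t))" by (intro continuous_intros)
    ultimately show ?thesis using face[of "\<lambda>t. (0, t)" 1] by (auto simp: Tr_def)
  qed
  have 2: "lift_incr \<phi> (singular_face 2 2 \<tau>) = G (1,0) - G (0,0)"
  proof -
    have "simplical_face 2 (\<lambda>i. if i = 0 then 1 - t else if i = 1 then t else 0) = pt (t, 0)" for t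
    proof
      fix i :: nat
      consider "i = 0" | "i = 1" | "i = 2" | "i > 2" by linarith
      then show "simplical_face 2 (\<lambda>i. if i = 0 then 1 - t else if i = 1 then t else 0) i = pt (t, 0) i"
        by cases (auto simp: pt_def simplical_face_def)
    qed
    moreover have "continuous_on {0..1::real} (\<lambda>t. (t, 0::real))" by (intro continuous_intros)
    ultimately show ?thesis using face[of "\<lambda>t. (t, 0)" 2] by (auto simp: Tr_def)
  qed
  have "chain_boundary 2 (frag_of \<tau>) = frag_of (singular_face 2 0 \<tau>)
      - frag_of (singular_face 2 1 \<tau>) + frag_of (singular_face 2 2 \<tau>)"
    by (simp add: chain_boundary_of numeral_2_eq_2 frag_cmul_minus_one)
  then show ?thesis using 0 1 2 by (simp add: chain_incr_add chain_incr_diff)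
qed

lemma chain_incr_homologous:
  assumes \<phi>: "continuous_map X euclidean \<phi>" "\<And>P. P \<in> topspace X \<Longrightarrow> \<phi> P \<noteq> 0"
    and h: "homologous_rel 1 X {} a b"
  shows "chain_incr \<phi> a = chain_incr \<phi> b"
proof -
  obtain c where c: "singular_chain 2 X c" "chain_boundary 2 c = a - b"
    using h unfolding homologous_rel_def singular_boundary by (metis Suc_1)
  have "Poly_Mapping.keys c \<subseteq> singular_simplex_set 2 X" using c(1) by (simp add: singular_chain_def)
  then have "chain_incr \<phi> (chain_boundary 2 c) = 0"
  proof (induction c rule: frag_induction)
    case zero show ?case by simp
  next
    case (one x) then show ?case using chain_incr_face_sum[OF \<phi>] by simp
  next
    case (diff a b) then show ?case by (simp add: chain_boundary_diff chain_incr_diff)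
  qed
  then show ?thesis using c(2) by (simp add: chain_incr_diff)
qed

section \<open>The basis loops and the coordinates they define\<close>

lemma torus_H1_pow:
  assumes "singular_relcycle 1 X {} c"
  shows "homologous_rel_set 1 X {} c [^]\<^bsub>homology_group 1 X\<^esub> (k::int) = homologous_rel_set 1 X {} (frag_cmul k c)"
proof -
  have cc: "c \<in> carrier (subgroup_generated (free_Abelian_group (singular_simplex_set 1 X)) (singular_relcycle_set 1 X {}))"
    using assms by (metis carrier_relcycle_group chain_group_def mem_Collect_eq relcycle_group_def)
  have "Poly_Mapping.keys c \<subseteq> singular_simplex_set 1 X"
    using assms by (simp add: singular_relcycle singular_chain_def)
  then have ff: "c [^]\<^bsub>relcycle_group 1 X {}\<^esub> k = frag_cmul k c"
    using cc by (simp add: relcycle_group_def chain_group_def group.int_pow_subgroup_generated)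
  have "homology_group 1 X = relcycle_group 1 X {} Mod singular_relboundary_set 1 X {}"
    by (simp add: relative_homology_group_def)
  moreover have "homologous_rel_set 1 X {} x = r_coset (relcycle_group 1 X {}) (singular_relboundary_set 1 X {}) x" for x
    unfolding right_coset_singular_relboundary ..
  ultimately show ?thesis
    using normal.FactGroup_int_pow[OF normal_subgroup_singular_relboundary_relcycle[of 1 X "{}"], of c k] assms ff
    by simp
qed

text \<open>Together with the rule for powers this brings the group expression in
  \<open>H1_coords\<close> down to chains: the homology group is a quotient of the cycles, so its
  operations act on representatives.\<close>

lemma torus_H1_mult:
  assumes "singular_relcycle 1 X {} a" "singular_relcycle 1 X {} b"
  shows "homologous_rel_set 1 X {} a \<otimes>\<^bsub>homology_group 1 X\<^esub> homologous_rel_set 1 X {} b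
     = homologous_rel_set 1 X {} (a + b)"
proof -
  have "homology_group 1 X = relcycle_group 1 X {} Mod singular_relboundary_set 1 X {}"
    by (simp add: relative_homology_group_def)
  moreover have "homologous_rel_set 1 X {} x = r_coset (relcycle_group 1 X {}) (singular_relboundary_set 1 X {}) x" for x
    unfolding right_coset_singular_relboundary ..
  ultimately show ?thesis
    using normal.rcos_sum[OF normal_subgroup_singular_relboundary_relcycle[of 1 X "{}"], of a b] assms
    by simp
qed

definition coord_h :: "nat \<Rightarrow> nat \<Rightarrow> point \<Rightarrow> real" where
  "coord_h m n z = fst z / (3 * real m)"

definition coord_v :: "nat \<Rightarrow> nat \<Rightarrow> point \<Rightarrow> real" where
  "coord_v m n z = snd z / (sqrt 3 * real n)"

lemma linear_coords: "linear (coord_h m n)" "linear (coord_v m n)"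
  by (auto simp: coord_h_def coord_v_def algebra_simps add_divide_distrib intro!: linearI)

lemma periods_coords:
  assumes "z \<in> periods m n" "m > 0" "n > 0"
  obtains a b :: int where "coord_h m n z = of_int a" "coord_v m n z = of_int b"
    "z = of_int a *\<^sub>R (real m *\<^sub>R gen_x) + of_int b *\<^sub>R (real n *\<^sub>R gen_y)"
proof -
  obtain a b :: int where z: "z = of_int a *\<^sub>R (real m *\<^sub>R gen_x) + of_int b *\<^sub>R (real n *\<^sub>R gen_y)"
    using assms(1) unfolding periods_def by blast
  moreover have "coord_h m n z = of_int a" "coord_v m n z = of_int b"
    using assms(2,3) unfolding z by (auto simp: coord_h_def coord_v_def gen_x_def gen_y_def)
  ultimately show ?thesis using that by blast
qed

text \<open>Choosing a representative makes the phase a function on cosets; the choice is harmless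
  when \<open>L\<close> takes integer values on the periods.\<close>

definition torus_phase :: "(point \<Rightarrow> real) \<Rightarrow> nat \<Rightarrow> nat \<Rightarrow> tpoint \<Rightarrow> complex" where
  "torus_phase L m n P = exp (2 * pi * \<i> * of_real (L (SOME z. proj m n z = P)))"

lemma torus_phase_proj:
  assumes "linear L" "\<And>z. z \<in> periods m n \<Longrightarrow> L z \<in> \<int>"
  shows "torus_phase L m n (proj m n z) = exp (2 * pi * \<i> * of_real (L z))"
proof -
  define y where "y = (SOME y. proj m n y = proj m n z)"
  have "proj m n y = proj m n z" unfolding y_def by (rule someI_ex) blast
  then have "L (y - z) \<in> \<int>" using assms(2) proj_eq_iff by blast
  then obtain k :: int where "L (y - z) = of_int k" by (auto elim: Ints_cases)
  then have "L y = L z + of_int k" using assms(1) by (simp add: linear_diff)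
  then have "exp (2 * pi * \<i> * of_real (L y)) = exp (2 * pi * \<i> * of_real (L z))"
    unfolding exp_eq by (intro exI[of _ k]) (simp add: algebra_simps)
  then show ?thesis unfolding torus_phase_def y_def .
qed

lemma chain_incr_segment:
  assumes "linear L" "\<And>z. z \<in> periods m n \<Longrightarrow> L z \<in> \<int>"
  shows "chain_incr (torus_phase L m n) (frag_of (segment (proj m n p) d)) = 2 * pi * \<i> * of_real (L d)"
proof -
  have "lift_incr (torus_phase L m n) (segment (proj m n p) d)
     = (\<lambda>t. 2 * pi * \<i> * of_real (L p + t * L d)) 1 - (\<lambda>t. 2 * pi * \<i> * of_real (L p + t * L d)) 0"
  proof (rule lift_incr_eq)
    show "continuous_on {0..1::real} (\<lambda>t. 2 * pi * \<i> * of_real (L p + t * L d))"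
      by (intro continuous_intros)
    fix t :: real assume t: "t \<in> {0..1}"
    have "(\<lambda>i. if i = 0 then 1 - t else if i = 1 then t else 0) \<in> standard_simplex 1"
      using t by (auto simp: standard_simplex_def)
    then show "torus_phase L m n (segment (proj m n p) d (\<lambda>i. if i = 0 then 1 - t else if i = 1 then t else 0))
        = exp (2 * pi * \<i> * of_real (L p + t * L d))"
      using torus_phase_proj[OF assms, where z = "p + t *\<^sub>R d"] assms(1)
      by (simp add: segment_proj linear_add linear_scale)
  qed
  then show ?thesis by (simp add: algebra_simps)
qed

lemma chain_incr_torus_homologous:
  assumes "linear L" "\<And>z. z \<in> periods m n \<Longrightarrow> L z \<in> \<int>"
    and "homologous_rel 1 (torus m n) {} a b"
  shows "chain_incr (torus_phase L m n) a = chain_incr (torus_phase L m n) b"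
proof (rule chain_incr_homologous[OF _ _ assms(3)])
  have "continuous_on UNIV (\<lambda>z. exp (2 * pi * \<i> * of_real (L z)))"
    using assms(1) by (intro continuous_intros linear_continuous_on) (simp add: linear_conv_bounded_linear)
  moreover have "torus_phase L m n \<circ> proj m n = (\<lambda>z. exp (2 * pi * \<i> * of_real (L z)))"
    using torus_phase_proj[OF assms(1,2)] by auto
  ultimately show "continuous_map (torus m n) euclidean (torus_phase L m n)"
    using quotient_map_proj continuous_compose_quotient_map by (metis continuous_map_iff_continuous2)
qed (simp add: torus_phase_def)

text \<open>Existence of the coordinates is the hypothesis. Uniqueness comes from the phases of
  \<open>coord_h\<close> and \<open>coord_v\<close>: their increments along the two basis loops form
  2 pi i times the identity matrix, so homologous combinations have equal coefficients.\<close>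

lemma H1_coords_eq:
  assumes mn: "m > 0" "n > 0"
    and h: "homologous_rel 1 (torus m n) {} c (frag_cmul a (gamma_h m n) + frag_cmul b (gamma_v m n))"
  shows "H1_coords m n c = (a, b)"
proof -
  have Lh: "coord_h m n z \<in> \<int>" and Lv: "coord_v m n z \<in> \<int>" if "z \<in> periods m n" for z
    by (rule periods_coords[OF that mn], simp)+
  \<comment> \<open>A segment along a period closes up in the torus, so its two 0-faces coincide and
    it is a cycle.\<close>
  have loop: "singular_relcycle 1 (torus m n) {} (frag_of (segment (proj m n 0) d))"
    if "d \<in> periods m n" for d
  proof -
    have "segment (proj m n 0) d (\<lambda>i. if i = 0 then 0 else if i = 1 then 1 else 0)
        = segment (proj m n 0) d (\<lambda>i. if i = 0 then 1 else 0)"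
    proof -
      have "proj m n d = proj m n 0" using that proj_eq_iff by simp
      moreover have "(\<lambda>i. if i = 0 then 0 else if i = 1 then 1 else 0) \<in> standard_simplex 1"
        "(\<lambda>i. if i = 0 then 1 else 0) \<in> standard_simplex 1"
        by (auto simp: standard_simplex_def)
      ultimately show ?thesis by (simp add: segment_proj)
    qed
    moreover have "simplical_face 0 (\<lambda>j. if j = 0 then 1 else 0) = (\<lambda>i. if i = 0 then 0 else if i = 1 then 1 else (0::real))"
      "simplical_face 1 (\<lambda>j. if j = 0 then 1 else 0) = (\<lambda>i. if i = 0 then 1 else (0::real))"
      by (auto simp: simplical_face_def fun_eq_iff)
    ultimately have "singular_face 1 0 (segment (proj m n 0) d) = singular_face 1 1 (segment (proj m n 0) d)"
      unfolding singular_face_def by (intro restrict_ext) (simp add: standard_simplex_0)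
    then have "chain_boundary 1 (frag_of (segment (proj m n 0) d)) = 0"
      by (simp add: chain_boundary_of frag_cmul_minus_one)
    then show ?thesis
      using segment_simplex by (simp add: singular_cycle singular_chain_of)
  qed
  have per: "real m *\<^sub>R gen_x \<in> periods m n" "real n *\<^sub>R gen_y \<in> periods m n"
    unfolding periods_def
    by (rule CollectI, rule exI[of _ 1], rule exI[of _ 0], simp,
        rule CollectI, rule exI[of _ 0], rule exI[of _ 1], simp)
  have cyc: "singular_relcycle 1 (torus m n) {} (gamma_h m n)" "singular_relcycle 1 (torus m n) {} (gamma_v m n)"
    unfolding gamma_h_def gamma_v_def using loop per by auto
  have cls: "(H1_class m n (gamma_h m n) [^]\<^bsub>homology_group 1 (torus m n)\<^esub> a')
         \<otimes>\<^bsub>homology_group 1 (torus m n)\<^esub>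
       (H1_class m n (gamma_v m n) [^]\<^bsub>homology_group 1 (torus m n)\<^esub> b')
      = H1_class m n (frag_cmul a' (gamma_h m n) + frag_cmul b' (gamma_v m n))" for a' b'
    unfolding H1_class_def torus_H1_pow[OF cyc(1)] torus_H1_pow[OF cyc(2)]
    by (intro torus_H1_mult singular_relcycle_cmul cyc)
  have incr: "chain_incr (torus_phase L m n) (frag_cmul a' (gamma_h m n) + frag_cmul b' (gamma_v m n))
     = 2 * pi * \<i> * of_real (of_int a' * L (real m *\<^sub>R gen_x) + of_int b' * L (real n *\<^sub>R gen_y))"
    if "linear L" "\<And>z. z \<in> periods m n \<Longrightarrow> L z \<in> \<int>" for L a' b'
    unfolding gamma_h_def gamma_v_def chain_incr_add chain_incr_cmul
    using chain_incr_segment[OF that] by (simp add: algebra_simps)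
  have vals: "coord_h m n (real m *\<^sub>R gen_x) = 1" "coord_h m n (real n *\<^sub>R gen_y) = 0"
    "coord_v m n (real m *\<^sub>R gen_x) = 0" "coord_v m n (real n *\<^sub>R gen_y) = 1"
    using mn by (auto simp: coord_h_def coord_v_def gen_x_def gen_y_def)
  show ?thesis unfolding H1_coords_def cls
  proof (rule the_equality)
    show "case (a, b) of (a', b') \<Rightarrow> H1_class m n c = H1_class m n (frag_cmul a' (gamma_h m n) + frag_cmul b' (gamma_v m n))"
      using h by (simp add: H1_class_def homologous_rel_set_eq)
  next
    fix ab' assume "case ab' of (a', b') \<Rightarrow> H1_class m n c = H1_class m n (frag_cmul a' (gamma_h m n) + frag_cmul b' (gamma_v m n))"
    then obtain a' b' where ab': "ab' = (a', b')"
      "homologous_rel 1 (torus m n) {} c (frag_cmul a' (gamma_h m n) + frag_cmul b' (gamma_v m n))"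
      by (auto simp: H1_class_def homologous_rel_set_eq split: prod.splits)
    have hh: "homologous_rel 1 (torus m n) {} (frag_cmul a (gamma_h m n) + frag_cmul b (gamma_v m n))
       (frag_cmul a' (gamma_h m n) + frag_cmul b' (gamma_v m n))"
      using h ab'(2) by (meson homologous_rel_sym homologous_rel_trans)
    have "a' = a"
      using chain_incr_torus_homologous[OF linear_coords(1) Lh hh]
        incr[OF linear_coords(1) Lh, of a b] incr[OF linear_coords(1) Lh, of a' b'] vals by simp
    moreover have "b' = b"
      using chain_incr_torus_homologous[OF linear_coords(2) Lv hh]
        incr[OF linear_coords(2) Lv, of a b] incr[OF linear_coords(2) Lv, of a' b'] vals by simp
    ultimately show "ab' = (a, b)" using ab'(1) by simp
  qed
qed

section \<open>Calculus of segments along periods\<close>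

lemma homologous_add_cancel:
  "homologous_rel p X S (a + b) c \<Longrightarrow> homologous_rel p X S b (c - a)"
  unfolding homologous_rel_def by (simp add: algebra_simps)

lemma segment_zero: "homologous_rel 1 (torus m n) {} (frag_of (segment (proj m n p) 0)) 0"
proof -
  have "homologous_rel 1 (torus m n) {} (frag_of (segment (proj m n p) 0) + frag_of (segment (proj m n p) 0))
     (frag_of (segment (proj m n p) 0))"
    using segment_add[of m n p 0 0] unfolding add_0_right .
  from homologous_add_cancel[OF this] show ?thesis unfolding diff_self .
qed

text \<open>After a displacement by a period the base point is the same point of the torus, so the
  second segment may start at \<open>p\<close> again.\<close>

lemma segment_add_period:
  assumes "d \<in> periods m n"
  shows "homologous_rel 1 (torus m n) {} (frag_of (segment (proj m n p) (d + e)))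
    (frag_of (segment (proj m n p) d) + frag_of (segment (proj m n p) e))"
proof -
  have "proj m n (p + d) = proj m n p" using assms proj_eq_iff by simp
  then show ?thesis using segment_add[of m n p d e] homologous_rel_sym by metis
qed

lemma periods_add:
  assumes "a \<in> periods m n" "b \<in> periods m n"
  shows "a + b \<in> periods m n"
proof -
  have "proj m n (a + b) = proj m n b" "proj m n b = proj m n 0"
    using assms by (simp_all add: proj_eq_iff)
  then have "proj m n (a + b) = proj m n 0" by simp
  then show ?thesis by (simp add: proj_eq_iff)
qed

lemma periods_sum: "(\<And>a. a \<in> A \<Longrightarrow> f a \<in> periods m n) \<Longrightarrow> sum f A \<in> periods m n"
  by (induction A rule: infinite_finite_induct) (auto simp: zero_in_periods intro: periods_add)

lemma periods_of_int: "d \<in> periods m n \<Longrightarrow> of_int k *\<^sub>R d \<in> periods m n"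
proof -
  assume "d \<in> periods m n"
  then obtain a b :: int where d: "d = of_int a *\<^sub>R (real m *\<^sub>R gen_x) + of_int b *\<^sub>R (real n *\<^sub>R gen_y)"
    unfolding periods_def by blast
  show ?thesis unfolding periods_def d
    by (intro CollectI exI[of _ "k * a"] exI[of _ "k * b"]) (simp add: algebra_simps)
qed

lemma segment_multiple:
  assumes "d \<in> periods m n"
  shows "homologous_rel 1 (torus m n) {} (frag_of (segment (proj m n p) (of_int k *\<^sub>R d)))
    (frag_cmul k (frag_of (segment (proj m n p) d)))"
proof (induction k rule: int_induct[where k = 0])
  case base then show ?case using segment_zero by simp
next
  case (step1 i)
  have "homologous_rel 1 (torus m n) {} (frag_of (segment (proj m n p) (of_int i *\<^sub>R d + d)))
    (frag_of (segment (proj m n p) (of_int i *\<^sub>R d)) + frag_of (segment (proj m n p) d))"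
    by (rule segment_add_period[OF periods_of_int[OF assms]])
  from homologous_rel_trans[OF homologous_rel_add[OF step1.IH homologous_rel_refl] this]
  show ?case by (simp add: frag_cmul_distrib algebra_simps)
next
  case (step2 i)
  have "homologous_rel 1 (torus m n) {} (frag_of (segment (proj m n p) (of_int (i - 1) *\<^sub>R d + d)))
    (frag_of (segment (proj m n p) (of_int (i - 1) *\<^sub>R d)) + frag_of (segment (proj m n p) d))"
    by (rule segment_add_period[OF periods_of_int[OF assms]])
  then have "homologous_rel 1 (torus m n) {}
    (frag_of (segment (proj m n p) (of_int (i - 1) *\<^sub>R d)) + frag_of (segment (proj m n p) d))
    (frag_of (segment (proj m n p) (of_int i *\<^sub>R d)))"
    by (subst homologous_rel_sym) (simp add: algebra_simps)
  from homologous_rel_diff[OF homologous_rel_trans[OF step2.IH this] homologous_rel_refl[of _ _ _ "frag_of (segment (proj m n p) d)"]]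
  have "homologous_rel 1 (torus m n) {} (frag_of (segment (proj m n p) (of_int (i - 1) *\<^sub>R d)))
     (frag_cmul i (frag_of (segment (proj m n p) d)) - frag_of (segment (proj m n p) d))" by simp
  moreover have "frag_cmul i (frag_of (segment (proj m n p) d)) - frag_of (segment (proj m n p) d)
     = frag_cmul (i - 1) (frag_of (segment (proj m n p) d))"
    by (simp add: frag_cmul_diff_distrib)
  ultimately show ?case by simp
qed

lemma segment_period_sum:
  assumes "finite A" "\<And>a. a \<in> A \<Longrightarrow> f a \<in> periods m n"
  shows "homologous_rel 1 (torus m n) {} (\<Sum>a\<in>A. frag_of (segment (proj m n p) (f a)))
     (frag_of (segment (proj m n p) (sum f A)))"
  using assms
proof (induction A rule: finite_induct)
  case empty then show ?case using segment_zero[of m n p] by (simp add: homologous_rel_sym)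
next
  case (insert x F)
  have "homologous_rel 1 (torus m n) {}
     (frag_of (segment (proj m n p) (f x)) + frag_of (segment (proj m n p) (sum f F)))
     (frag_of (segment (proj m n p) (f x + sum f F)))"
    using segment_add_period[of "f x" m n p "sum f F"] insert.prems by (simp add: homologous_rel_sym)
  from homologous_rel_trans[OF this homologous_rel_add[OF homologous_rel_refl insert.IH]]
  show ?case using insert by simp
qed

text \<open>A finite family of arcs in which every point is entered as often as it is left has zero
  boundary, and its class is read off its total displacement.\<close>

lemma H1_coords_balanced:
  assumes mn: "m > 0" "n > 0" and C: "finite C" "fst ` C \<subseteq> range (proj m n)"
    and inj: "inj_on fst C" "inj_on arc_end C" "arc_end ` C = fst ` C"
  shows "of_int (fst (H1_coords m n (loop_chain C))) = coord_h m n (sum snd C)"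
    "of_int (snd (H1_coords m n (loop_chain C))) = coord_v m n (sum snd C)"
proof -
  define r where "r P = (SOME z. proj m n z = P)" for P
  have r: "proj m n (r P) = P" if "P \<in> range (proj m n)" for P
    using that unfolding r_def by (metis (mono_tags) rangeE someI)
  \<comment> \<open>\<open>r\<close> lifts each vertex to the plane; \<open>lam a\<close> is the
    period by which the lifted arc misses the chosen lift of its end.\<close>
  define lam where "lam a = r (fst a) + snd a - r (arc_end a)" for a
  have ends: "proj m n (r (arc_end a)) = proj m n (r (fst a) + snd a)" "proj m n (r (fst a)) = fst a" if "a \<in> C" for a
  proof -
    have a1: "fst a \<in> range (proj m n)" using C(2) that by blast
    have a2: "arc_end a \<in> range (proj m n)" using C(2) that unfolding inj(3)[symmetric] by blast
    note rr = r[OF a1] r[OF a2]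
    have "arc_end a = (+) (snd a) ` proj m n (r (fst a))" unfolding rr(1) arc_end_def ..
    then have "arc_end a = proj m n (r (fst a) + snd a)" by (simp only: translate_proj add.commute)
    then show "proj m n (r (arc_end a)) = proj m n (r (fst a) + snd a)" using rr(2) by simp
    show "proj m n (r (fst a)) = fst a" by (rule rr(1))
  qed
  have lam: "lam a \<in> periods m n" if "a \<in> C" for a
    unfolding lam_def using ends(1)[OF that] proj_eq_iff by metis
  let ?s = "\<lambda>d. frag_of (segment (proj m n 0) d)"
  \<comment> \<open>Joining the origin to the lifts of both ends replaces the arc by a loop along
    \<open>lam a\<close> and two radial segments, one for each end.\<close>
  have one: "homologous_rel 1 (torus m n) {} (frag_of (segment (fst a) (snd a)))
      (?s (lam a) + ?s (r (arc_end a)) - ?s (r (fst a)))" if a: "a \<in> C" for a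
  proof -
    have h1: "homologous_rel 1 (torus m n) {} (?s (r (fst a)) + frag_of (segment (fst a) (snd a))) (?s (r (fst a) + snd a))"
      using segment_add[of m n 0 "r (fst a)" "snd a"] ends(2)[OF a] by simp
    have h2: "homologous_rel 1 (torus m n) {} (?s (r (fst a) + snd a)) (?s (lam a) + ?s (r (arc_end a)))"
      using segment_add_period[OF lam[OF a], of 0 "r (arc_end a)"] by (simp add: lam_def)
    show ?thesis by (rule homologous_add_cancel[OF homologous_rel_trans[OF h2 h1]])
  qed
  have "homologous_rel 1 (torus m n) {} (\<Sum>a\<in>C. frag_of (segment (fst a) (snd a)))
     (\<Sum>a\<in>C. ?s (lam a) + ?s (r (arc_end a)) - ?s (r (fst a)))"
    by (rule homologous_rel_sum) (use C one in \<open>auto intro: finite_subset[OF _ C(1)]\<close>)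
  \<comment> \<open>Starts and ends of the arcs run through the same vertices, once each, so the
    radial terms cancel; by the same token the lifts drop out of \<open>sum lam C\<close>.\<close>
  moreover have ends_sum: "(\<Sum>a\<in>C. g (arc_end a)) = (\<Sum>a\<in>C. g (fst a))" for g :: "tpoint \<Rightarrow> 'z::comm_monoid_add"
    using sum.reindex[OF inj(1), of g] sum.reindex[OF inj(2), of g] inj(3) by simp
  ultimately have "homologous_rel 1 (torus m n) {} (loop_chain C) (\<Sum>a\<in>C. ?s (lam a))"
    using ends_sum[of "\<lambda>P. ?s (r P)"]
    by (simp add: loop_chain_def case_prod_unfold sum.distrib sum_subtractf)
  moreover have "homologous_rel 1 (torus m n) {} (\<Sum>a\<in>C. ?s (lam a)) (?s (sum lam C))"
    by (rule segment_period_sum) (use C lam in auto)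
  moreover have tot: "sum lam C = sum snd C"
    unfolding lam_def using ends_sum[of r] by (simp add: sum.distrib sum_subtractf)
  ultimately have 1: "homologous_rel 1 (torus m n) {} (loop_chain C) (?s (sum snd C))"
    by (metis (no_types) homologous_rel_trans)
  have "sum snd C \<in> periods m n" unfolding tot[symmetric] using lam by (rule periods_sum)
  then obtain a b :: int where ab: "coord_h m n (sum snd C) = of_int a" "coord_v m n (sum snd C) = of_int b"
    "sum snd C = of_int a *\<^sub>R (real m *\<^sub>R gen_x) + of_int b *\<^sub>R (real n *\<^sub>R gen_y)"
    using periods_coords[OF _ mn] by metis
  have per: "real m *\<^sub>R gen_x \<in> periods m n" "real n *\<^sub>R gen_y \<in> periods m n"
    unfolding periods_def
    by (rule CollectI, rule exI[of _ 1], rule exI[of _ 0], simp,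
        rule CollectI, rule exI[of _ 0], rule exI[of _ 1], simp)
  have "homologous_rel 1 (torus m n) {} (?s (sum snd C))
    (?s (of_int a *\<^sub>R (real m *\<^sub>R gen_x)) + ?s (of_int b *\<^sub>R (real n *\<^sub>R gen_y)))"
    unfolding ab(3) by (rule segment_add_period[OF periods_of_int[OF per(1)]])
  then have "homologous_rel 1 (torus m n) {} (loop_chain C)
     (?s (of_int a *\<^sub>R (real m *\<^sub>R gen_x)) + ?s (of_int b *\<^sub>R (real n *\<^sub>R gen_y)))"
    using 1 by (rule homologous_rel_trans)
  moreover have "homologous_rel 1 (torus m n) {} \<dots> (frag_cmul a (gamma_h m n) + frag_cmul b (gamma_v m n))"
    unfolding gamma_h_def gamma_v_def by (intro homologous_rel_add segment_multiple per)
  ultimately have "homologous_rel 1 (torus m n) {} (loop_chain C)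
     (frag_cmul a (gamma_h m n) + frag_cmul b (gamma_v m n))"
    by (rule homologous_rel_trans[rotated])
  then have "H1_coords m n (loop_chain C) = (a, b)" by (rule H1_coords_eq[OF mn])
  then show "of_int (fst (H1_coords m n (loop_chain C))) = coord_h m n (sum snd C)"
    "of_int (snd (H1_coords m n (loop_chain C))) = coord_v m n (sum snd C)"
    using ab by auto
qed

section \<open>Winding numbers as edge counts\<close>

definition latt :: "int \<Rightarrow> int \<Rightarrow> point" where
  "latt i j = of_int i *\<^sub>R gen_u + of_int j *\<^sub>R gen_y"

lemma Lambda_iff: "v \<in> Lambda \<longleftrightarrow> (\<exists>i j. v = latt i j)"
  by (auto simp: Lambda_def latt_def)

lemma latt_in_Lambda [simp]: "latt i j \<in> Lambda"
  unfolding Lambda_iff by blast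

lemma latt_add: "latt i j + latt i' j' = latt (i + i') (j + j')"
  and latt_diff: "latt i j - latt i' j' = latt (i - i') (j - j')"
  by (simp_all add: latt_def algebra_simps)

lemma latt_coords: "latt i j = (3 / 2 * of_int i, sqrt 3 / 2 * of_int i + sqrt 3 * of_int j)"
  by (simp add: latt_def gen_u_def gen_y_def)

lemma latt_inject [simp]: "latt i j = latt i' j' \<longleftrightarrow> i = i' \<and> j = j'"
  by (auto simp: latt_coords)

lemma one_notin_Lambda: "(1, 0) \<notin> Lambda"
proof
  assume "(1, 0) \<in> Lambda"
  then obtain i j where "(1, 0) = latt i j" unfolding Lambda_iff by blast
  then have "real_of_int (3 * i) = real_of_int 2" by (simp add: latt_coords)
  then have "3 * i = 2" by (simp only: of_int_eq_iff)
  then show False by presburger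
qed

text \<open>A black vertex is indexed by the lattice point to its left, the white end of its type I
  edge. In this indexing an edge becomes a lattice displacement, so both colours are labelled by
  \<open>Lambda\<close>.\<close>

definition dv :: "edge_type \<Rightarrow> point" where
  "dv t = step t - (1, 0)"

lemma dv_latt: "dv Type_I = latt 0 0" "dv Type_II = latt (-1) 1" "dv Type_III = latt (-1) 0"
  by (auto simp: dv_def latt_coords zero_prod_def field_simps)

lemma dv_in_Lambda: "dv t \<in> Lambda"
  by (cases t) (simp_all only: dv_latt latt_in_Lambda)

lemma Lambda_add: "v \<in> Lambda \<Longrightarrow> w \<in> Lambda \<Longrightarrow> v + w \<in> Lambda"
  and Lambda_diff: "v \<in> Lambda \<Longrightarrow> w \<in> Lambda \<Longrightarrow> v - w \<in> Lambda"
  by (auto simp: Lambda_iff latt_add latt_diff)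

text \<open>Since x = 2u - y, the horizontal period crosses 2m columns and lowers the row by m. This
  shear is the source of every correction by \<open>m\<close> below.\<close>

lemma periods_latt:
  "z \<in> periods m n \<longleftrightarrow> (\<exists>a b. z = latt (2 * int m * a) (int n * b - int m * a))"
proof -
  have "of_int a *\<^sub>R (real m *\<^sub>R gen_x) + of_int b *\<^sub>R (real n *\<^sub>R gen_y)
     = latt (2 * int m * a) (int n * b - int m * a)" for a b
    by (simp add: latt_coords gen_x_def gen_y_def algebra_simps)
  then show ?thesis unfolding periods_def by auto
qed

lemma periods_Lambda: "z \<in> periods m n \<Longrightarrow> z \<in> Lambda"
  by (auto simp: periods_latt)

lemma proj_latt_eq:
  "proj m n (latt i j) = proj m n (latt i' j') \<longleftrightarrow>
     (\<exists>a b. i = i' + 2 * int m * a \<and> j = j' + int n * b - int m * a)"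
  unfolding proj_eq_iff latt_diff periods_latt latt_inject by (auto simp: algebra_simps)

lemma white_black_disjoint: "white m n \<inter> black m n = {}"
proof -
  have False if "v \<in> Lambda" "w \<in> Lambda" "proj m n v = proj m n ((1, 0) + w)" for v w
  proof -
    have "v - ((1, 0) + w) \<in> Lambda" using that(3) periods_Lambda proj_eq_iff by blast
    from Lambda_diff[OF Lambda_diff[OF that(1,2)] this]
    have "v - w - (v - ((1, 0) + w)) \<in> Lambda" .
    moreover have "v - w - (v - ((1, 0) + w)) = (1, 0)" by (simp add: algebra_simps)
    ultimately show False using one_notin_Lambda by metis
  qed
  then show ?thesis unfolding white_def black_def by auto
qed

lemma black_end_proj: "black_end (proj m n v, t) = proj m n ((1, 0) + (v + dv t))"
  unfolding black_end_def fst_conv snd_conv translate_proj dv_def by (simp add: algebra_simps)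

lemma white_end_in: "e \<in> edges m n \<Longrightarrow> white_end e \<in> white m n"
  by (auto simp: edges_def white_end_def)

lemma black_end_in: "e \<in> edges m n \<Longrightarrow> black_end e \<in> black m n"
proof -
  assume "e \<in> edges m n"
  then obtain v t where "v \<in> Lambda" "e = (proj m n v, t)" by (auto simp: edges_def white_def)
  moreover have "v + dv t \<in> Lambda" using calculation(1) dv_in_Lambda by (rule Lambda_add)
  ultimately show ?thesis unfolding black_def by (metis black_end_proj image_eqI)
qed

lemma dimers_subset: "M \<in> dimers m n \<Longrightarrow> M \<subseteq> edges m n"
  by (simp add: dimers_def)

lemma ex1_pair_iff: "(\<exists>!e. e \<in> M \<and> fst e = f (snd e)) \<longleftrightarrow> (\<exists>!t. (f t, t) \<in> M)"
proof
  assume "\<exists>!e. e \<in> M \<and> fst e = f (snd e)"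
  then obtain e where e: "e \<in> M" "fst e = f (snd e)"
    and u: "\<And>e'. e' \<in> M \<Longrightarrow> fst e' = f (snd e') \<Longrightarrow> e' = e" by blast
  show "\<exists>!t. (f t, t) \<in> M"
  proof (rule ex1I[of _ "snd e"])
    show "(f (snd e), snd e) \<in> M" using e by (metis prod.collapse)
    show "t = snd e" if "(f t, t) \<in> M" for t using u[OF that] by force
  qed
next
  assume "\<exists>!t. (f t, t) \<in> M"
  then obtain t where t: "(f t, t) \<in> M" and u: "\<And>t'. (f t', t') \<in> M \<Longrightarrow> t' = t" by blast
  show "\<exists>!e. e \<in> M \<and> fst e = f (snd e)"
  proof (rule ex1I[of _ "(f t, t)"])
    show "(f t, t) \<in> M \<and> fst (f t, t) = f (snd (f t, t))" using t by simp
    show "e = (f t, t)" if "e \<in> M \<and> fst e = f (snd e)" for e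
      using u[of "snd e"] that by (metis prod.collapse)
  qed
qed

text \<open>Vertices are replaced by their lifts to the plane.\<close>

lemma dimers_iff:
  "M \<in> dimers m n \<longleftrightarrow> M \<subseteq> edges m n \<and> (\<forall>v \<in> Lambda. \<exists>!t. (proj m n v, t) \<in> M)
     \<and> (\<forall>v \<in> Lambda. \<exists>!t. (proj m n (v - dv t), t) \<in> M)"
proof -
  have W: "(\<exists>!e. e \<in> M \<and> (P = white_end e \<or> P = black_end e)) \<longleftrightarrow> (\<exists>!t. (P, t) \<in> M)"
    if "M \<subseteq> edges m n" "P \<in> white m n" for P
  proof -
    have *: "e \<in> M \<and> (P = white_end e \<or> P = black_end e) \<longleftrightarrow> e \<in> M \<and> fst e = P" for e
    proof (cases "e \<in> M")
      case True
      then have "black_end e \<in> black m n" using that(1) black_end_in by blast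
      then have "P \<noteq> black_end e" using that(2) white_black_disjoint[of m n] by blast
      then show ?thesis by (auto simp: white_end_def)
    qed simp
    show ?thesis unfolding * by (rule ex1_pair_iff)
  qed
  have B: "(\<exists>!e. e \<in> M \<and> (proj m n ((1, 0) + v) = white_end e \<or> proj m n ((1, 0) + v) = black_end e))
      \<longleftrightarrow> (\<exists>!t. (proj m n (v - dv t), t) \<in> M)"
    if M: "M \<subseteq> edges m n" and v: "v \<in> Lambda" for v
  proof -
    have bl: "proj m n ((1, 0) + v) \<in> black m n" using v by (auto simp: black_def)
    have *: "e \<in> M \<and> (proj m n ((1, 0) + v) = white_end e \<or> proj m n ((1, 0) + v) = black_end e)
       \<longleftrightarrow> e \<in> M \<and> fst e = proj m n (v - dv (snd e))" for e
    proof (cases "e \<in> M")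
      case True
      then obtain w t where e: "e = (proj m n w, t)" using M by (auto simp: edges_def white_def)
      have "proj m n ((1, 0) + v) \<noteq> white_end e"
        using white_end_in[of e m n] True M bl white_black_disjoint[of m n] by (metis disjoint_iff subsetD)
      moreover have "proj m n ((1, 0) + v) = black_end e \<longleftrightarrow> proj m n w = proj m n (v - dv t)"
      proof -
        have "((1, 0) + v) - ((1, 0) + (w + dv t)) = - (w - (v - dv t))" by (simp add: algebra_simps)
        moreover have "- z \<in> periods m n \<longleftrightarrow> z \<in> periods m n" for z
          using periods_of_int[of z m n "-1"] periods_of_int[of "- z" m n "-1"] by auto
        ultimately show ?thesis unfolding e black_end_proj proj_eq_iff by metis
      qed
      ultimately show ?thesis using True e by simp
    qed simp
    show ?thesis unfolding * by (rule ex1_pair_iff)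
  qed
  show ?thesis
  proof (cases "M \<subseteq> edges m n")
    case True
    have "M \<in> dimers m n \<longleftrightarrow> (\<forall>v\<in>Lambda. \<exists>!e. e \<in> M \<and> (proj m n v = white_end e \<or> proj m n v = black_end e))
      \<and> (\<forall>v\<in>Lambda. \<exists>!e. e \<in> M \<and> (proj m n ((1, 0) + v) = white_end e \<or> proj m n ((1, 0) + v) = black_end e))"
      using True by (simp add: dimers_def white_def black_def ball_Un)
    then show ?thesis
      using True W[OF True] B[OF True] by (simp add: white_def)
  qed (simp add: dimers_def)
qed

text \<open>At each vertex the edges of \<open>M\<close> and of \<open>M0\<close> either coincide or
  are both single. In the second case the arc of \<open>M\<close> leaves a white vertex and that of
  \<open>M0\<close> enters it; at a black vertex the roles are exchanged.\<close>

lemma arcs_balanced: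
  assumes M: "M \<in> dimers m n" and M0: "M0 \<in> dimers m n"
  shows "inj_on fst (arcs M M0)" "inj_on arc_end (arcs M M0)" "arc_end ` arcs M M0 = fst ` arcs M M0"
    "fst ` arcs M M0 \<subseteq> range (proj m n)"
    "inj_on (\<lambda>e. (white_end e, step (snd e))) (M - M0)"
    "inj_on (\<lambda>e. (black_end e, - step (snd e))) (M0 - M)"
    "(\<lambda>e. (white_end e, step (snd e))) ` (M - M0) \<inter> (\<lambda>e. (black_end e, - step (snd e))) ` (M0 - M) = {}"
proof -
  have dim: "\<exists>!e. e \<in> N \<and> (P = white_end e \<or> P = black_end e)"
    if "N \<in> dimers m n" "P \<in> white m n \<union> black m n" for N P
    using that unfolding dimers_def by (elim CollectE conjE) (rule bspec)
  have un: "e = e'" if e: "N \<in> dimers m n" "e \<in> N" "e' \<in> N" "white_end e = white_end e' \<or> black_end e = black_end e'" for N e e'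
  proof -
    have "white_end e \<in> white m n \<union> black m n" "black_end e \<in> white m n \<union> black m n"
      using e dimers_subset white_end_in black_end_in by blast+
    then show ?thesis using dim[OF e(1)] e(2-4) by metis
  qed
  have ex: "P \<in> white m n \<Longrightarrow> \<exists>e\<in>N. white_end e = P" "P \<in> black m n \<Longrightarrow> \<exists>e\<in>N. black_end e = P"
    if N: "N \<in> dimers m n" for N P
  proof -
    have *: "white_end e \<in> white m n" "black_end e \<in> black m n" if "e \<in> N" for e
      using that N dimers_subset white_end_in black_end_in by blast+
    show "\<exists>e\<in>N. white_end e = P" if P: "P \<in> white m n"
    proof -
      obtain e where "e \<in> N" "P = white_end e \<or> P = black_end e" using dim[OF N, of P] P by blast
      then show ?thesis using * P white_black_disjoint[of m n] by blast
    qed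
    show "\<exists>e\<in>N. black_end e = P" if P: "P \<in> black m n"
    proof -
      obtain e where "e \<in> N" "P = white_end e \<or> P = black_end e" using dim[OF N, of P] P by blast
      then show ?thesis using * P white_black_disjoint[of m n] by blast
    qed
  qed
  have in_w: "white_end e \<in> white m n" and in_b: "black_end e \<in> black m n" if "e \<in> M \<union> M0" for e
    using that M M0 dimers_subset white_end_in black_end_in by blast+
  have disj: "white_end e \<noteq> black_end e'" if "e \<in> M \<union> M0" "e' \<in> M \<union> M0" for e e'
    using in_w[OF that(1)] in_b[OF that(2)] white_black_disjoint[of m n] by auto
  have arc_end1: "arc_end (white_end e, step (snd e)) = black_end e" for e
    by (simp add: arc_end_def white_end_def black_end_def)
  have arc_end2: "arc_end (black_end e, - step (snd e)) = white_end e" for e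
    by (simp add: arc_end_def white_end_def black_end_def image_image)
  show "inj_on (\<lambda>e. (white_end e, step (snd e))) (M - M0)"
    using un[OF M] by (auto simp: inj_on_def)
  show "inj_on (\<lambda>e. (black_end e, - step (snd e))) (M0 - M)"
    using un[OF M0] by (auto simp: inj_on_def)
  show "(\<lambda>e. (white_end e, step (snd e))) ` (M - M0) \<inter> (\<lambda>e. (black_end e, - step (snd e))) ` (M0 - M) = {}"
    using disj by auto
  show "inj_on fst (arcs M M0)"
  proof (rule inj_onI)
    fix x y assume "x \<in> arcs M M0" "y \<in> arcs M M0" "fst x = fst y"
    then show "x = y" unfolding arcs_def
      using un[OF M] un[OF M0] disj by (elim UnE imageE) (auto; metis UnI1 UnI2)+
  qed
  show "inj_on arc_end (arcs M M0)"
  proof (rule inj_onI)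
    fix x y assume "x \<in> arcs M M0" "y \<in> arcs M M0" "arc_end x = arc_end y"
    then show "x = y" unfolding arcs_def
      using un[OF M] un[OF M0] disj
      by (elim UnE imageE) (auto simp only: arc_end1 arc_end2; metis DiffD1 UnI1 UnI2)+
  qed
  have f: "fst ` arcs M M0 = white_end ` (M - M0) \<union> black_end ` (M0 - M)"
    by (auto simp: arcs_def image_Un image_image)
  have a: "arc_end ` arcs M M0 = black_end ` (M - M0) \<union> white_end ` (M0 - M)"
    by (simp add: arcs_def image_Un image_image arc_end1 arc_end2)
  \<comment> \<open>If the edge of \<open>N\<close> at a vertex is not in \<open>N'\<close>, then
    the edge of \<open>N'\<close> there is not in \<open>N\<close>, since otherwise two edges of
    \<open>N\<close> would meet at this vertex.\<close>
  have w: "white_end ` (N - N') \<subseteq> white_end ` (N' - N)" "black_end ` (N - N') \<subseteq> black_end ` (N' - N)"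
    if N: "N \<in> dimers m n" "N' \<in> dimers m n" for N N'
  proof -
    have "white_end e \<in> white_end ` (N' - N) \<and> black_end e \<in> black_end ` (N' - N)" if e: "e \<in> N" "e \<notin> N'" for e
    proof -
      have "white_end e \<in> white m n" "black_end e \<in> black m n"
        using e(1) N(1) dimers_subset white_end_in black_end_in by blast+
      then obtain e1 e2 where "e1 \<in> N'" "white_end e1 = white_end e" "e2 \<in> N'" "black_end e2 = black_end e"
        using ex[OF N(2)] by metis
      moreover from this have "e1 \<notin> N" "e2 \<notin> N" using un[OF N(1) e(1)] e(2) by metis+
      ultimately show ?thesis by (metis DiffI image_eqI)
    qed
    then show "white_end ` (N - N') \<subseteq> white_end ` (N' - N)" "black_end ` (N - N') \<subseteq> black_end ` (N' - N)" by auto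
  qed
  show "arc_end ` arcs M M0 = fst ` arcs M M0"
  proof -
    have "white_end ` (M - M0) = white_end ` (M0 - M)" "black_end ` (M - M0) = black_end ` (M0 - M)"
      by (intro equalityI w M M0)+
    then show ?thesis unfolding f a by (simp add: Un_commute)
  qed
  show "fst ` arcs M M0 \<subseteq> range (proj m n)"
    unfolding f using in_w in_b unfolding white_def black_def by blast
qed

text \<open>Every connected component inherits the balance of the whole arc set, so its homology
  coordinates are linear in its displacement. Summing over the components yields a quantity that
  depends only on how many edges of each type there are.\<close>

lemma wind_displacement:
  assumes mn: "m > 0" "n > 0" and M: "M \<in> dimers m n" "finite M" and M0: "M0 \<in> dimers m n" "finite M0"
  defines "tot \<equiv> (\<Sum>e\<in>M. step (snd e)) - (\<Sum>e\<in>M0. step (snd e))"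
  shows "of_int (fst (wind m n M0 M)) = coord_h m n tot" "of_int (snd (wind m n M0 M)) = coord_v m n tot"
proof -
  define A where "A = arcs M M0"
  define r where "r = {(a, b). a \<in> A \<and> b \<in> A \<and> (arc_end a = fst b \<or> arc_end b = fst a)}"
  note bal = arcs_balanced[OF M(1) M0(1), folded A_def]
  have finA: "finite A" unfolding A_def arcs_def using M M0 by auto
  have "sym r" by (auto simp: r_def sym_def)
  \<comment> \<open>The reflexive closure relates any arc outside \<open>A\<close> only to itself,
    so this is an equivalence on the whole type, although only \<open>A\<close> is divided by
    it.\<close>
  then have eq: "equiv UNIV (r\<^sup>*)"
    by (intro equivI refl_rtrancl sym_rtrancl trans_rtrancl) auto
  have cls: "C \<subseteq> A" "arc_end ` C = fst ` C" if C: "C \<in> A // r\<^sup>*" for C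
  proof -
    obtain a where a: "a \<in> A" "C = r\<^sup>* `` {a}" using C by (auto elim: quotientE)
    have sub: "x \<in> A" if "(a, x) \<in> r\<^sup>*" for x
      using that a(1) by (induction rule: rtrancl_induct) (auto simp: r_def)
    then show CA: "C \<subseteq> A" using a by auto
    have ext: "y \<in> C" if "x \<in> C" "(x, y) \<in> r" for x y
      using that a(2) by (auto intro: rtrancl_into_rtrancl)
    show "arc_end ` C = fst ` C"
    proof (intro equalityI subsetI)
      fix P assume "P \<in> arc_end ` C"
      then obtain x where x: "x \<in> C" "P = arc_end x" by auto
      then have "P \<in> fst ` A" using CA bal(3) by blast
      then obtain y where y: "y \<in> A" "P = fst y" by auto
      then have "(x, y) \<in> r" using x CA by (auto simp: r_def)
      then show "P \<in> fst ` C" using ext x y by blast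
    next
      fix P assume "P \<in> fst ` C"
      then obtain x where x: "x \<in> C" "P = fst x" by auto
      then have "P \<in> arc_end ` A" using CA bal(3) by blast
      then obtain y where y: "y \<in> A" "P = arc_end y" by auto
      then have "(x, y) \<in> r" using x CA by (auto simp: r_def)
      then show "P \<in> arc_end ` C" using ext x y by blast
    qed
  qed
  have om: "M \<ominus>\<^sub>d M0 = A // r\<^sup>*" by (simp add: ominus_def A_def r_def)
  have H: "of_int (fst (H1_coords m n (loop_chain C))) = coord_h m n (sum snd C)"
     "of_int (snd (H1_coords m n (loop_chain C))) = coord_v m n (sum snd C)" if "C \<in> A // r\<^sup>*" for C
    using H1_coords_balanced[OF mn, of C] cls[OF that] bal finA
    by (meson finite_subset image_mono inj_on_subset order_trans)+
  have UQ: "\<Union> (A // r\<^sup>*) = A"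
  proof
    show "\<Union> (A // r\<^sup>*) \<subseteq> A" using cls by blast
    show "A \<subseteq> \<Union> (A // r\<^sup>*)" by (auto simp: quotient_def)
  qed
  have dQ: "\<forall>C\<in>A // r\<^sup>*. \<forall>D\<in>A // r\<^sup>*. C \<noteq> D \<longrightarrow> C \<inter> D = {}"
  proof (intro ballI impI)
    fix C D assume "C \<in> A // r\<^sup>*" "D \<in> A // r\<^sup>*" "C \<noteq> D"
    moreover have "A // r\<^sup>* \<subseteq> UNIV // r\<^sup>*" by (auto simp: quotient_def)
    ultimately show "C \<inter> D = {}" using quotient_disj[OF eq] by blast
  qed
  have "sum snd (\<Union> (A // r\<^sup>*)) = (sum \<circ> sum) snd (A // r\<^sup>*)"
  proof (rule sum.Union_disjoint[OF _ dQ])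
    show "\<forall>C\<in>A // r\<^sup>*. finite C" using cls(1) finite_subset[OF _ finA] by blast
  qed
  then have S: "(\<Sum>C\<in>A // r\<^sup>*. sum snd C) = sum snd A" unfolding UQ by simp
  have "sum snd A = (\<Sum>e\<in>M - M0. step (snd e)) + (\<Sum>e\<in>M0 - M. - step (snd e))"
    unfolding A_def arcs_def
    by (subst sum.union_disjoint) (use bal M M0 in \<open>auto simp: sum.reindex\<close>)
  \<comment> \<open>Doubled edges contribute equally to both sums and cancel.\<close>
  also have "\<dots> = tot"
    unfolding tot_def sum_negf
    using sum_diff1_nat M(2) M0(2) sum.Int_Diff[of M "\<lambda>e. step (snd e)" M0] sum.Int_Diff[of M0 "\<lambda>e. step (snd e)" M]
    by (simp add: Int_commute)
  finally have T: "sum snd A = tot" .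
  have fs: "fst (\<Sum>C\<in>Q. g C) = (\<Sum>C\<in>Q. fst (g C))" "snd (\<Sum>C\<in>Q. g C) = (\<Sum>C\<in>Q. snd (g C))"
    for g :: "arc set \<Rightarrow> int \<times> int" and Q
    by (induction Q rule: infinite_finite_induct; simp)+
  show "of_int (fst (wind m n M0 M)) = coord_h m n tot"
    unfolding wind_def om fs of_int_sum using H(1) S T linear_sum[OF linear_coords(1)]
    by (simp add: linear_sum[OF linear_coords(1), symmetric])
  show "of_int (snd (wind m n M0 M)) = coord_v m n tot"
    unfolding wind_def om fs of_int_sum using H(2) S T
    by (simp add: linear_sum[OF linear_coords(2), symmetric])
qed

section \<open>Signs of permutations that shift columns\<close>

definition inversions :: "nat set \<Rightarrow> (nat \<Rightarrow> nat) \<Rightarrow> (nat \<times> nat) set" where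
  "inversions S f = {(p, q). p \<in> S \<and> q \<in> S \<and> p < q \<and> f q < f p}"

text \<open>Besides \<open>(a, b)\<close> itself, each element strictly between \<open>a\<close> and
  \<open>b\<close> takes part in exactly two inversions.\<close>

lemma odd_inversions_transpose:
  assumes "finite S" "a \<in> S" "b \<in> S" "a < b"
  shows "odd (card (inversions S (Transposition.transpose a b)))"
proof -
  define C where "C = {c \<in> S. a < c \<and> c < b}"
  have eq: "inversions S (Transposition.transpose a b) = insert (a, b) (Pair a ` C \<union> (\<lambda>c. (c, b)) ` C)"
  proof (intro Set.set_eqI, clarify)
    fix p q :: nat
    have "Transposition.transpose a b q < Transposition.transpose a b p \<longleftrightarrow>
        (p = a \<and> q = b) \<or> (p = a \<and> a < q \<and> q < b) \<or> (q = b \<and> a < p \<and> p < b)" if "p < q"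
      using that assms(4) unfolding Transposition.transpose_def
      by (cases "p = a"; cases "p = b"; cases "q = a"; cases "q = b") auto
    then show "(p, q) \<in> inversions S (Transposition.transpose a b) \<longleftrightarrow>
        (p, q) \<in> insert (a, b) (Pair a ` C \<union> (\<lambda>c. (c, b)) ` C)"
      using assms by (cases "p < q") (auto simp: inversions_def C_def)
  qed
  have "finite C" using assms by (simp add: C_def)
  have "card (Pair a ` C \<union> (\<lambda>c. (c, b)) ` C) = card (Pair a ` C) + card ((\<lambda>c. (c, b)) ` C)"
    using \<open>finite C\<close> by (intro card_Un_disjoint) (auto simp: C_def)
  also have "\<dots> = 2 * card C"
    by (simp add: card_image inj_on_def)
  finally have "card (Pair a ` C \<union> (\<lambda>c. (c, b)) ` C) = 2 * card C" .
  moreover have "(a, b) \<notin> Pair a ` C \<union> (\<lambda>c. (c, b)) ` C" by (auto simp: C_def)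
  ultimately show ?thesis unfolding eq using \<open>finite C\<close> by simp
qed

text \<open>The parity of inversions is a product of signs over two-element subsets. Reindexing
  these subsets by \<open>f\<close> splits the product for the composition into those for
  \<open>g\<close> and \<open>f\<close>.\<close>

lemma even_inversions_comp:
  assumes S: "finite S" and f: "f permutes S" and g: "inj_on g S"
  shows "even (card (inversions S (g \<circ> f))) \<longleftrightarrow> even (card (inversions S g) + card (inversions S f))"
proof -
  define P where "P = {(p, q). p \<in> S \<and> q \<in> S \<and> p < q}"
  define e where "e h pq = (if h (fst pq) < h (snd pq) then 1 else -1 :: int)" for h :: "nat \<Rightarrow> nat" and pq
  have finP: "finite P" by (rule finite_subset[of _ "S \<times> S"]) (use S in \<open>auto simp: P_def\<close>)
  have prod_e: "prod (e h) P = (-1) ^ card (inversions S h)" if "inj_on h S" for h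
  proof -
    have "prod (e h) P = prod (e h) (inversions S h)"
    proof (rule prod.mono_neutral_right[OF finP])
      show "inversions S h \<subseteq> P" by (auto simp: inversions_def P_def)
      show "\<forall>i\<in>P - inversions S h. e h i = 1"
      proof
        fix i assume i: "i \<in> P - inversions S h"
        then have "h (fst i) \<noteq> h (snd i)" using inj_onD[OF that, of "fst i" "snd i"] by (auto simp: P_def)
        then show "e h i = 1" using i by (auto simp: P_def inversions_def e_def)
      qed
    qed
    also have "\<dots> = (\<Prod>i\<in>inversions S h. -1)"
      by (rule prod.cong) (auto simp: inversions_def e_def)
    finally show ?thesis by simp
  qed
  have fS: "f p \<in> S" if "p \<in> S" for p using f that by (simp add: permutes_in_image)
  have finj: "f p = f q \<longleftrightarrow> p = q" for p q using permutes_inj[OF f] by (simp add: inj_eq)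
  \<comment> \<open>The action of \<open>f\<close> on two-element subsets, each written in
    increasing order.\<close>
  define r where "r = (\<lambda>(p, q). (min (f p) (f q), max (f p) (f q)))"
  have inj_r: "inj_on r P"
    by (auto simp: inj_on_def r_def P_def min_def max_def finj split: if_splits)
  have rP: "r ` P \<subseteq> P"
    by (auto simp: r_def P_def min_def max_def finj fS order_less_le split: if_splits)
  have bij: "bij_betw r P P"
    using inj_r rP finP by (simp add: bij_betw_def endo_inj_surj)
  have "prod (e (g \<circ> f)) P = (\<Prod>pq\<in>P. e g (r pq) * e f pq)"
  proof (rule prod.cong[OF refl], clarify)
    fix p q assume "(p, q) \<in> P"
    then have "p \<noteq> q" "p \<in> S" "q \<in> S" by (auto simp: P_def)
    then have "g (f p) \<noteq> g (f q)" "f p \<noteq> f q" using inj_onD[OF g, of "f p" "f q"] fS finj by auto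
    then show "e (g \<circ> f) (p, q) = e g (r (p, q)) * e f (p, q)"
      by (auto simp: e_def r_def min_def max_def)
  qed
  also have "\<dots> = prod (e g) P * prod (e f) P"
    unfolding prod.distrib using prod.reindex_bij_betw[OF bij, of "e g"] by simp
  finally have "prod (e (g \<circ> f)) P = prod (e g) P * prod (e f) P" .
  moreover have "inj_on f S" "inj_on (g \<circ> f) S"
    using permutes_inj_on[OF f] g permutes_image[OF f] by (auto intro: comp_inj_on)
  ultimately have "(-1::int) ^ card (inversions S (g \<circ> f)) = (-1) ^ (card (inversions S g) + card (inversions S f))"
    using g prod_e by (simp add: power_add)
  then show ?thesis by (metis neg_one_even_power neg_one_odd_power one_neq_neg_one)
qed

lemma sign_inversions:
  assumes "finite S" "f permutes S"
  shows "sign f = (if even (card (inversions S f)) then 1 else -1)"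
  using assms(2,1)
proof (induction f rule: permutes_induct)
  case id
  have "inversions S id = {}" by (auto simp: inversions_def)
  then show ?case by (simp add: id_def)
next
  case (swap a b p)
  have odd: "odd (card (inversions S (Transposition.transpose a b)))"
  proof (cases "a < b")
    case True then show ?thesis using odd_inversions_transpose swap assms(1) by blast
  next
    case False
    then show ?thesis using odd_inversions_transpose[of S b a] swap assms(1)
      by (simp add: transpose_commute)
  qed
  have sg: "sign (Transposition.transpose a b \<circ> p) = - sign p"
    using swap permutes_imp_permutation[OF assms(1)]
    by (subst sign_compose) (auto simp: sign_swap_id permutation_swap_id)
  have ev: "even (card (inversions S (Transposition.transpose a b \<circ> p)))
      \<longleftrightarrow> even (card (inversions S (Transposition.transpose a b)) + card (inversions S p))"
    by (rule even_inversions_comp) (use swap assms(1) in auto)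
  show ?case unfolding sg ev using odd swap by (cases "even (card (inversions S p))") simp_all
qed

text \<open>The values of \<open>w\<close> are some w0 on an initial part of a points and w0 + 1 on
  the remaining b, so there are ab such pairs. Modulo 2 this equals (a + b - 1)((a + b) w0 + b),
  because N(N - 1) and b(b - 1) are even.\<close>

lemma column_inversions:
  fixes w :: "nat \<Rightarrow> int"
  assumes fin: "finite S"
    and w: "\<And>p q. p \<in> S \<Longrightarrow> q \<in> S \<Longrightarrow> p < q \<Longrightarrow> w p \<le> w q \<and> w q \<le> w p + 1"
  shows "even (int (card {(p, q). p \<in> S \<and> q \<in> S \<and> p < q \<and> w p < w q}) - (int (card S) - 1) * sum w S)"
proof (cases "S = {}")
  case False
  define w0 where "w0 = Min (w ` S)"
  define A where "A = {p \<in> S. w p = w0}"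
  define B where "B = {p \<in> S. w p = w0 + 1}"
  have "w0 \<in> w ` S" unfolding w0_def using fin False by (intro Min_in) auto
  then obtain p0 where p0: "p0 \<in> S" "w p0 = w0" by auto
  have ge: "w0 \<le> w p" if "p \<in> S" for p unfolding w0_def using fin that by simp
  have le: "w p \<le> w0 + 1" if "p \<in> S" for p
    using w[OF p0(1) that] w[OF that p0(1)] p0(2) by (cases p p0 rule: linorder_cases) auto
  have "w p = w0 \<or> w p = w0 + 1" if "p \<in> S" for p using ge[OF that] le[OF that] by linarith
  then have AB: "S = A \<union> B" "A \<inter> B = {}" by (auto simp: A_def B_def)
  have finAB: "finite A" "finite B" using fin by (auto simp: A_def B_def)
  have "{(p, q). p \<in> S \<and> q \<in> S \<and> p < q \<and> w p < w q} = A \<times> B"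
  proof (intro equalityI subsetI, goal_cases)
    case (1 x)
    then obtain p q where x: "x = (p, q)" "p \<in> S" "q \<in> S" "p < q" "w p < w q" by auto
    then have "w p = w0" "w q = w0 + 1" using ge[OF x(2)] le[OF x(3)] by linarith+
    then show ?case using x by (auto simp: A_def B_def)
  next
    case (2 x)
    then obtain p q where x: "x = (p, q)" "p \<in> A" "q \<in> B" by auto
    then have "p < q" using w[of q p] by (cases p q rule: linorder_cases) (auto simp: A_def B_def)
    then show ?case using x by (auto simp: A_def B_def)
  qed
  then have c: "card {(p, q). p \<in> S \<and> q \<in> S \<and> p < q \<and> w p < w q} = card A * card B"
    by (simp add: card_cartesian_product)
  have k: "card S = card A + card B" using AB finAB by (simp add: card_Un_disjoint)
  have "sum w S = sum w A + sum w B" using AB finAB by (simp add: sum.union_disjoint)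
  also have "sum w A = int (card A) * w0" by (simp add: A_def)
  also have "sum w B = int (card B) * (w0 + 1)" by (simp add: B_def)
  finally have s: "sum w S = int (card A) * w0 + int (card B) * (w0 + 1)" .
  show ?thesis unfolding c k s by (auto simp: algebra_simps)
qed simp

text \<open>The moved points form paths that step one column to the left. Inversions between
  different columns involve only column 0, which wraps around, and number (c - 1)k^2, which has the
  parity of k for even c. Inversions inside columns come from rows that wrap around and have the
  parity of (k - 1)l.\<close>

lemma sign_column_shift:
  fixes c n :: nat and d :: "nat \<Rightarrow> int" and s :: "nat \<Rightarrow> int"
  assumes f: "f permutes {0..<c * n}" and c: "even c" "c > 0" and n: "n > 0"
  defines "S \<equiv> {p. p < c * n \<and> f p \<noteq> p}"
  assumes col: "\<And>p. p \<in> S \<Longrightarrow> f p div n = (if p div n = 0 then c - 1 else p div n - 1)"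
    and row: "\<And>p. p \<in> S \<Longrightarrow> int (f p mod n) = (int (p mod n) + d p - s (p div n)) mod int n"
    and d: "\<And>p. p \<in> S \<Longrightarrow> d p = 0 \<or> d p = 1"
  obtains k l where "\<And>i. i < c \<Longrightarrow> card {p \<in> S. p div n = i} = k"
    "(\<Sum>p\<in>S. d p - s (p div n)) = int n * l"
    "sign f = (if even (int k + (int k - 1) * l) then 1 else -1)"
proof -
  have finS: "finite S" by (simp add: S_def)
  have perm: "f permutes S"
    by (rule permutes_superset[OF f]) (auto simp: S_def)
  have fS: "f p \<in> S \<longleftrightarrow> p \<in> S" for p by (rule permutes_in_image[OF perm])
  have inj: "f p = f q \<longleftrightarrow> p = q" for p q using permutes_inj[OF perm] by (simp add: inj_eq)
  define C where "C i = {p \<in> S. p div n = i}" for i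
  have finC: "finite (C i)" for i using finS by (simp add: C_def)
  have colc: "p div n < c" if "p \<in> S" for p using that n by (simp add: S_def less_mult_imp_div_less)
  \<comment> \<open>The moved points of a column inject into those of the previous one. Following
    this around the cycle makes all the cardinalities equal.\<close>
  have step: "card (C i) \<le> card (C (if i = 0 then c - 1 else i - 1))" for i
    by (rule card_inj_on_le[of f]) (use col fS finC inj in \<open>auto simp: C_def inj_on_def\<close>)
  have le0: "card (C (i + j)) \<le> card (C i)" for i j
  proof (induction j)
    case (Suc j) then show ?case using step[of "i + Suc j"] by simp
  qed simp
  define k where "k = card (C 0)"
  have k: "card (C i) = k" if "i < c" for i
  proof -
    have "card (C i) \<le> k" using le0[of 0 i] by (simp add: k_def)
    moreover have "k \<le> card (C (c - 1))" using step[of 0] by (simp add: k_def)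
    moreover have "card (C (c - 1)) \<le> card (C i)" using le0[of i "c - 1 - i"] that by simp
    ultimately show ?thesis by simp
  qed
  \<comment> \<open>\<open>v\<close> is the image row before reduction modulo \<open>n\<close>, and
    \<open>w\<close> counts how often it wraps; the wraps add up to \<open>l\<close>.\<close>
  define v where "v p = int (p mod n) + d p - s (p div n)" for p
  define w where "w p = v p div int n" for p
  define l where "l = sum w S"
  have vmod: "int (f p mod n) = v p - int n * w p" if "p \<in> S" for p
    using row[OF that] by (simp add: v_def w_def minus_mult_div_eq_mod)
  have "(\<Sum>p\<in>S. int (f p mod n)) = (\<Sum>p\<in>S. int (p mod n))"
    using sum.permute[OF perm, of "\<lambda>p. int (p mod n)"] by (simp add: o_def)
  moreover have "(\<Sum>p\<in>S. int (f p mod n)) = (\<Sum>p\<in>S. int (p mod n)) + (\<Sum>p\<in>S. d p - s (p div n)) - int n * l"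
    by (simp add: vmod v_def l_def sum.distrib sum_subtractf sum_distrib_left)
  ultimately have l: "(\<Sum>p\<in>S. d p - s (p div n)) = int n * l" by simp
  \<comment> \<open>Within a column \<open>v\<close> is weakly increasing, as the increments
    \<open>d\<close> are 0 or 1, and its spread stays below \<open>n\<close>: a spread of exactly
    \<open>n\<close> would give two points the same image.\<close>
  have w: "w p \<le> w q \<and> w q \<le> w p + 1" if pq: "p \<in> C i" "q \<in> C i" "p < q" for p q i
  proof -
    have S: "p \<in> S" "q \<in> S" "p div n = i" "q div n = i" using pq by (auto simp: C_def)
    have "p mod n < q mod n"
      using pq(3) S(3,4) by (metis add_less_cancel_left div_mult_mod_eq)
    moreover have "q mod n < n" using n by simp
    ultimately have v: "v p \<le> v q" "v q \<le> v p + int n"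
      using d[OF S(1)] d[OF S(2)] S(3,4) by (auto simp: v_def)
    have "f p mod n \<noteq> f q mod n"
      using inj[of p q] pq(3) col[OF S(1)] col[OF S(2)] S(3,4) by (metis div_mult_mod_eq less_irrefl)
    then have "v q \<noteq> v p + int n" using row[OF S(1)] row[OF S(2)] by (auto simp: v_def)
    then have "v q < v p + int n" using v by simp
    then have "w q \<le> (v p + int n) div int n" unfolding w_def by (intro zdiv_mono1) (use n in auto)
    moreover have "w p \<le> w q" unfolding w_def using v(1) n by (intro zdiv_mono1) auto
    ultimately show ?thesis using n by (simp add: w_def)
  qed
  define I where "I i = {(p, q). p \<in> C i \<and> q \<in> C i \<and> p < q \<and> w p < w q}" for i
  have split: "inversions S f = C 0 \<times> (S - C 0) \<union> (\<Union>i<c. I i)"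
  proof (rule Set.set_eqI)
    fix x :: "nat \<times> nat"
    obtain p q where x: "x = (p, q)" by (cases x)
    have "(p, q) \<in> inversions S f \<longleftrightarrow> (p, q) \<in> C 0 \<times> (S - C 0) \<union> (\<Union>i<c. I i)"
    proof (cases "p \<in> S \<and> q \<in> S")
      case True
      note cp = col[of p] and cq = col[of q]
      have lt: "x < y \<longleftrightarrow> x div n < y div n \<or> (x div n = y div n \<and> x mod n < y mod n)" for x y :: nat
      proof -
        have "x = x div n * n + x mod n" "y = y div n * n + y mod n" by simp_all
        moreover have "x div n * n + x mod n < y div n * n + y mod n" if "x div n < y div n"
        proof -
          have "x div n * n + x mod n < (x div n + 1) * n"
            using dividend_less_div_times[OF n, of x] by simp
          also have "\<dots> \<le> y div n * n" using that by (intro mult_right_mono) auto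
          finally show ?thesis by (rule trans_less_add1)
        qed
        moreover have "y div n * n + y mod n < x div n * n + x mod n" if "y div n < x div n"
        proof -
          have "y div n * n + y mod n < (y div n + 1) * n"
            using dividend_less_div_times[OF n, of y] by simp
          also have "\<dots> \<le> x div n * n" using that by (intro mult_right_mono) auto
          finally show ?thesis by (rule trans_less_add1)
        qed
        ultimately show ?thesis
          by (metis add_less_cancel_left linorder_neqE_nat order_less_asym)
      qed
      show ?thesis
      proof (cases "p div n = q div n")
        case eq: True
        have pq: "p \<in> C (p div n)" "q \<in> C (p div n)" using True eq by (auto simp: C_def)
        have key: "f q < f p \<longleftrightarrow> w p < w q" if "p < q"
        proof -
        have "f q < f p \<longleftrightarrow> f q mod n < f p mod n" using lt[of "f q" "f p"] cp cq True eq by auto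
        also have "\<dots> \<longleftrightarrow> v q - int n * w q < v p - int n * w p"
          using vmod[of p] vmod[of q] True by (metis of_nat_less_iff)
        also have "\<dots> \<longleftrightarrow> w p < w q"
        proof
          assume "w p < w q"
          then have "w q = w p + 1" using w[OF pq that] by simp
          moreover have "v q < v p + int n"
          proof -
            have "p mod n < q mod n"
              using that eq by (metis add_less_cancel_left div_mult_mod_eq)
            moreover have "q mod n < n" using n by simp
            ultimately have v: "v q \<le> v p + int n"
              using d[of p] d[of q] True eq by (auto simp: v_def)
            have "f p mod n \<noteq> f q mod n"
              using inj[of p q] that cp cq True eq by (metis div_mult_mod_eq less_irrefl)
            then have "v q \<noteq> v p + int n" using row[of p] row[of q] True by (auto simp: v_def)
            then show ?thesis using v by simp
          qed
          ultimately show "v q - int n * w q < v p - int n * w p" by (simp add: algebra_simps)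
        next
          assume less: "v q - int n * w q < v p - int n * w p"
          have "p mod n < q mod n"
            using that eq by (metis add_less_cancel_left div_mult_mod_eq)
          then have "v p \<le> v q" using d[of p] d[of q] True eq by (auto simp: v_def)
          then have "int n * w p < int n * w q" using less by linarith
          then show "w p < w q" using n by simp
        qed
        finally show ?thesis .
        qed
        show ?thesis
        proof (cases "p < q")
          case True
          then show ?thesis using key pq \<open>p \<in> S \<and> q \<in> S\<close> eq colc[of p]
            by (auto simp: inversions_def I_def C_def)
        next
          case False
          then show ?thesis using eq by (auto simp: inversions_def I_def C_def)
        qed
      next
        case neq: False
        \<comment> \<open>Columns other than 0 keep their relative order when moved; column 0 is
          sent to the last place and jumps over all the others.\<close>
        have "(p, q) \<in> inversions S f \<longleftrightarrow> p div n = 0"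
        proof
          assume "(p, q) \<in> inversions S f"
          then have "p < q" "f q < f p" by (auto simp: inversions_def)
          then have "p div n < q div n" using lt neq by blast
          moreover have "f q div n \<le> f p div n" using \<open>f q < f p\<close> by (intro div_le_mono) simp
          ultimately show "p div n = 0" using cp cq True by (auto split: if_splits)
        next
          assume p: "p div n = 0"
          then have "p div n < q div n" using neq by simp
          then have "p < q" using lt by blast
          moreover have "f q div n < f p div n" using p neq cp cq True colc[of q] by auto
          then have "f q < f p" using lt by blast
          ultimately show "(p, q) \<in> inversions S f" using True by (auto simp: inversions_def)
        qed
        then show ?thesis using True neq by (auto simp: C_def I_def)
      qed
    qed (auto simp: inversions_def C_def I_def)
    then show "x \<in> inversions S f \<longleftrightarrow> x \<in> C 0 \<times> (S - C 0) \<union> (\<Union>i<c. I i)" by (simp add: x)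
  qed
  have finI: "finite (I i)" for i
    by (rule finite_subset[of _ "C i \<times> C i"]) (use finC in \<open>auto simp: I_def\<close>)
  have "card (\<Union>i<c. I i) = (\<Sum>i<c. card (I i))"
    by (rule card_UN_disjoint) (use finI in \<open>auto simp: I_def C_def\<close>)
  moreover have "card (C 0 \<times> (S - C 0) \<union> (\<Union>i<c. I i)) = card (C 0 \<times> (S - C 0)) + card (\<Union>i<c. I i)"
    by (rule card_Un_disjoint) (use finI finC finS in \<open>auto simp: I_def C_def\<close>)
  ultimately have cI: "card (inversions S f) = k * card (S - C 0) + (\<Sum>i<c. card (I i))"
    unfolding split by (simp add: card_cartesian_product k_def)
  have UC: "S = (\<Union>i<c. C i)" using colc by (auto simp: C_def)
  have "card S = (\<Sum>i<c. card (C i))"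
    unfolding UC by (rule card_UN_disjoint) (use finC in \<open>auto simp: C_def\<close>)
  then have "card S = c * k" using k by simp
  moreover have "card (S - C 0) = card S - k"
    using finC by (subst card_Diff_subset) (auto simp: C_def k_def)
  ultimately have cS: "card (S - C 0) = (c - 1) * k" by (simp add: diff_mult_distrib)
  have "l = (\<Sum>i<c. sum w (C i))" unfolding l_def
    by (subst UC, rule sum.UNION_disjoint) (use finC in \<open>auto simp: C_def\<close>)
  then have "(\<Sum>i<c. int (card (I i)) - (int (card (C i)) - 1) * sum w (C i))
     = (\<Sum>i<c. int (card (I i))) - (int k - 1) * l"
    using k by (simp add: sum_subtractf sum_distrib_left)
  moreover have "even (\<Sum>i<c. int (card (I i)) - (int (card (C i)) - 1) * sum w (C i))"
    unfolding I_def by (intro dvd_sum column_inversions finC w) auto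
  ultimately have "even ((\<Sum>i<c. int (card (I i))) - (int k - 1) * l)" by metis
  moreover have "int (card (inversions S f)) = int k * (int (c - 1) * int k) + (\<Sum>i<c. int (card (I i)))"
    unfolding cI cS by simp
  moreover have "odd (c - 1)" using c by auto
  ultimately have "even (int (card (inversions S f))) \<longleftrightarrow> even (int k + (int k - 1) * l)"
    by auto
  then have sgn: "sign f = (if even (int k + (int k - 1) * l) then 1 else -1)"
    using sign_inversions[OF finS perm] by simp
  show ?thesis by (rule that[of k l]) (use k l sgn in \<open>auto simp: C_def\<close>)
qed

section \<open>The Kasteleyn determinant\<close>

text \<open>Two monic polynomials of degree \<open>c\<close> that agree at \<open>c\<close> points
  are equal.\<close>

lemma prod_minus_roots_unity:
  fixes X :: complex
  assumes c: "c > 0"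
  shows "(\<Prod>a<c. X - cis (2 * pi * real a / real c)) = X ^ c - 1"
proof -
  define w where "w a = cis (2 * pi * real a / real c)" for a :: nat
  define P where "P = (\<Prod>a<c. [:- w a, 1:])"
  define Q where "Q = monom 1 c - (1 :: complex poly)"
  have bij: "bij_betw w {..<c} {z. z ^ c = 1}"
    using Complex.bij_betw_roots_unity[OF c] unfolding w_def by simp
  have cardA: "card (w ` {..<c}) = c"
    by (simp add: card_image bij_betw_imp_inj_on[OF bij])
  have degP: "degree P = c" unfolding P_def
    by (subst degree_prod_eq_sum_degree) auto
  have leadP: "lead_coeff P = 1" unfolding P_def by (simp add: lead_coeff_prod)
  have degQ: "degree Q \<le> c" unfolding Q_def
    by (intro degree_diff_le) (auto simp: degree_monom_le)
  have leadQ: "coeff Q c = 1" unfolding Q_def using c by simp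
  have "P = Q"
  proof (rule poly_eqI_degree_lead_coeff[where A = "w ` {..<c}" and n = c])
    fix z assume "z \<in> w ` {..<c}"
    then obtain a where a: "a < c" "z = w a" by auto
    then have "z ^ c = 1" using bij by (auto simp: bij_betw_def)
    moreover have "poly P z = 0" unfolding P_def poly_prod using a
      by (intro prod_zero) auto
    ultimately show "poly P z = poly Q z" by (simp add: Q_def poly_monom)
  qed (use degP degQ leadP leadQ cardA in auto)
  then have "poly P X = poly Q X" by simp
  then show ?thesis by (simp add: P_def Q_def poly_prod poly_monom w_def)
qed

text \<open>Pulling the root of unity out of each factor reduces this to the previous product at -y;
  evenness of \<open>c\<close> removes the sign of y.\<close>

lemma prod_one_plus_roots_unity:
  fixes y :: complex
  assumes c: "c > 0" "even c"
  shows "(\<Prod>a<c. 1 + y * cis (- (2 * pi * real a / real c))) = 1 - y ^ c"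
proof -
  have fac: "1 + y * cis (- t) = inverse (- cis t) * (- y - cis t)" for t
    by (simp add: field_simps flip: cis_inverse)
  have "(\<Prod>a<c. - cis (2 * pi * real a / real c)) = - 1"
    using prod_minus_roots_unity[OF c(1), of 0] c by (simp add: power_0_left)
  then have "(\<Prod>a<c. inverse (- cis (2 * pi * real a / real c))) = - 1"
    using prod_inversef[of "\<lambda>a. - cis (2 * pi * real a / real c)" "{..<c}"] by (simp add: o_def)
  then show ?thesis
    unfolding fac prod.distrib prod_minus_roots_unity[OF c(1)] using c by simp
qed

lemma sum_roots_unity_power:
  fixes d :: int
  assumes n: "n > 0"
  shows "(\<Sum>j<n. cis (2 * pi * of_int d * real j / real n)) = (if int n dvd d then of_nat n else 0)"
proof -
  define z where "z = cis (2 * pi * of_int d / real n)"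
  have zj: "cis (2 * pi * of_int d * real j / real n) = z ^ j" for j
    by (simp only: z_def Complex.DeMoivre times_divide_eq_right mult_ac)
  have "z ^ n = 1"
  proof -
    have "z ^ n = cis (2 * pi * of_int d)"
      unfolding z_def Complex.DeMoivre using n by (simp only: times_divide_eq_right) simp
    then show ?thesis by (simp add: cis_multiple_2pi)
  qed
  have z1: "z = 1 \<longleftrightarrow> int n dvd d"
  proof
    assume "z = 1"
    then have "cos (2 * pi * of_int d / real n) = 1" by (simp add: z_def complex_eq_iff)
    then obtain k :: int where "2 * pi * of_int d / real n = of_int k * 2 * pi"
      using cos_one_2pi_int by blast
    then have "real_of_int d = of_int (k * int n)" using n by (simp add: field_simps)
    then show "int n dvd d" by (metis dvd_triv_right of_int_eq_iff)
  next
    assume "int n dvd d"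
    then obtain k where d: "d = int n * k" by blast
    have "2 * pi * of_int d / real n = 2 * pi * of_int k" unfolding d using n by simp
    then have "z = cis (2 * pi * of_int k)" unfolding z_def by (rule arg_cong)
    then show "z = 1" by (simp only: cis_multiple_2pi Ints_of_int)
  qed
  show ?thesis
  proof (cases "int n dvd d")
    case True
    then show ?thesis unfolding zj using z1 by simp
  next
    case False
    then show ?thesis unfolding zj using z1 \<open>z ^ n = 1\<close> by (simp add: geometric_sum)
  qed
qed

lemma mult_add_less_mult:
  fixes i j c n :: nat
  assumes "i < c" "j < n"
  shows "i * n + j < c * n"
proof -
  have "i * n + j < (i + 1) * n" using assms by simp
  also have "\<dots> \<le> c * n" using assms by (intro mult_right_mono) auto
  finally show ?thesis .
qed

lemma bij_betw_div_mod:
  assumes "n > 0"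
  shows "bij_betw (\<lambda>p. (p div n, p mod n)) {..<c * n} ({..<c} \<times> {..<n::nat})"
  by (rule bij_betw_byWitness[where f' = "\<lambda>(i, j). i * n + j"])
     (use assms in \<open>auto simp: less_mult_imp_div_less mult_add_less_mult\<close>)

text \<open>With the eigenvectors as columns of \<open>F\<close> one has A F = F D. The matrix
  \<open>G\<close> only serves to show that det F is nonzero, through G F = s I.\<close>

lemma det_eigenbasis:
  fixes A F G :: "complex mat"
  assumes A: "A \<in> carrier_mat N N" and F: "F \<in> carrier_mat N N" and G: "G \<in> carrier_mat N N"
    and eig: "\<And>p r. p < N \<Longrightarrow> r < N \<Longrightarrow> (\<Sum>q<N. A $$ (p, q) * F $$ (q, r)) = d r * F $$ (p, r)"
    and inv: "\<And>r r'. r < N \<Longrightarrow> r' < N \<Longrightarrow> (\<Sum>q<N. G $$ (r, q) * F $$ (q, r')) = (if r = r' then s else 0)"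
    and s: "s \<noteq> 0"
  shows "Determinant.det A = (\<Prod>r<N. d r)"
proof -
  define D where "D = mat N N (\<lambda>(p, r). if p = r then d r else 0)"
  define S where "S = mat N N (\<lambda>(p, r). if p = r then s else (0::complex))"
  have D: "D \<in> carrier_mat N N" and S: "S \<in> carrier_mat N N" by (simp_all add: D_def S_def)
  have detdiag: "Determinant.det (mat N N (\<lambda>(p, r). if p = r then f r else 0)) = (\<Prod>r<N. f r)"
    for f :: "nat \<Rightarrow> complex"
    by (subst det_upper_triangular[of _ N])
       (auto simp: upper_triangular_def prod_list_diag_prod atLeast0LessThan)
  have "A * F = F * D"
  proof (rule eq_matI)
    fix p r assume "p < dim_row (F * D)" "r < dim_col (F * D)"
    then have pr: "p < N" "r < N" using F D by auto
    have "(A * F) $$ (p, r) = (\<Sum>q<N. A $$ (p, q) * F $$ (q, r))"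
      using A F pr by (simp add: scalar_prod_def atLeast0LessThan)
    also have "\<dots> = (\<Sum>q<N. F $$ (p, q) * (if q = r then d r else 0))"
      using eig[OF pr] pr by (simp add: if_distrib[of "\<lambda>x. _ * x"] mult.commute cong: if_cong)
    also have "\<dots> = (F * D) $$ (p, r)"
      using F D pr by (simp add: scalar_prod_def atLeast0LessThan D_def)
    finally show "(A * F) $$ (p, r) = (F * D) $$ (p, r)" .
  qed (use A F D in auto)
  then have "Determinant.det A * Determinant.det F = Determinant.det F * Determinant.det D"
    by (metis A D F det_mult)
  moreover have "G * F = S"
  proof (rule eq_matI)
    fix p r assume "p < dim_row S" "r < dim_col S"
    then have pr: "p < N" "r < N" using S by auto
    have "(G * F) $$ (p, r) = (\<Sum>q<N. G $$ (p, q) * F $$ (q, r))"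
      using G F pr by (simp add: scalar_prod_def atLeast0LessThan)
    then show "(G * F) $$ (p, r) = S $$ (p, r)" using inv[OF pr] pr by (simp add: S_def)
  qed (use G F S in auto)
  then have "Determinant.det G * Determinant.det F = s ^ N"
    using det_mult[OF G F] detdiag[of "\<lambda>_. s"] by (simp add: S_def)
  then have "Determinant.det F \<noteq> 0" using s by auto
  ultimately have "Determinant.det A = Determinant.det D" by (simp add: mult.commute)
  then show ?thesis unfolding D_def detdiag .
qed

text \<open>The vertex with lattice coordinates \<open>(i, j)\<close> has number \<open>i * n + j\<close>; \<open>nbr\<close> gives
  the number of the white vertex to the left of the black end of an edge.\<close>

definition nbr :: "nat \<Rightarrow> nat \<Rightarrow> edge_type \<Rightarrow> nat \<Rightarrow> nat" where
  "nbr m n t p = (if t = Type_I then p else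
     (if p div n = 0 then 2 * m - 1 else p div n - 1) * n +
       nat ((int (p mod n) + (if t = Type_II then 1 else 0) - (if p div n = 0 then int m else 0)) mod int n))"

text \<open>\<open>x\<close> marks non-horizontal edges and \<open>\<phi>\<close> the excess of type
  II over type III. For a configuration with k paths and l turns these numbers are 2mk and 2nl, so
  its weight is x^(2mk) exp(2 i n l \<open>\<phi>\<close>).\<close>

definition edge_weight :: "complex \<Rightarrow> complex \<Rightarrow> edge_type \<Rightarrow> complex" where
  "edge_weight x \<phi> t = (case t of Type_I \<Rightarrow> 1 | Type_II \<Rightarrow> x * exp (\<i> * \<phi>) | Type_III \<Rightarrow> x * exp (- (\<i> * \<phi>)))"

text \<open>No signs are inserted, as is customary for hexagonal faces; the signs that remain come
  from the topology of the torus alone.\<close>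

definition kasteleyn :: "nat \<Rightarrow> nat \<Rightarrow> complex \<Rightarrow> complex \<Rightarrow> complex mat" where
  "kasteleyn m n x \<phi> = mat (2 * m * n) (2 * m * n)
     (\<lambda>(p, q). \<Sum>t\<in>{Type_I, Type_II, Type_III}. if q = nbr m n t p then edge_weight x \<phi> t else 0)"

lemma nbr_less:
  assumes "m > 0" "n > 0" "p < 2 * m * n"
  shows "nbr m n t p < 2 * m * n"
proof (cases "t = Type_I")
  case False
  have "nat (z mod int n) < n" for z using assms(2) by (simp add: nat_less_iff)
  moreover have "(if p div n = 0 then 2 * m - 1 else p div n - 1) < 2 * m"
    using assms less_mult_imp_div_less[of p "2 * m" n] by auto
  ultimately show ?thesis using False unfolding nbr_def by (simp add: mult_add_less_mult)
qed (use assms in \<open>simp add: nbr_def\<close>)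

lemma nbr_div_mod:
  assumes "n > 0" "t \<noteq> Type_I"
  shows "nbr m n t p div n = (if p div n = 0 then 2 * m - 1 else p div n - 1)"
    "int (nbr m n t p mod n) =
       (int (p mod n) + (if t = Type_II then 1 else 0) - (if p div n = 0 then int m else 0)) mod int n"
proof -
  have "nat (z mod int n) < n" for z using assms(1) by (simp add: nat_less_iff)
  then show "nbr m n t p div n = (if p div n = 0 then 2 * m - 1 else p div n - 1)"
    "int (nbr m n t p mod n) =
       (int (p mod n) + (if t = Type_II then 1 else 0) - (if p div n = 0 then int m else 0)) mod int n"
    using assms by (simp_all add: nbr_def)
qed

text \<open>The matrix commutes with translations of the torus, so plane waves \<open>chi\<close>
  are eigenvectors. For fixed vertical momentum \<open>b\<close> the eigenvalues over all horizontal
  momenta multiply to one factor by \<open>prod_one_plus_roots_unity\<close>.\<close>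

lemma det_kasteleyn:
  assumes m: "m > 0" and n: "n > 0"
  shows "Determinant.det (kasteleyn m n x \<phi>) =
    (\<Prod>b<n. 1 - (x * (2 * cos (\<phi> + of_real (pi * real b / real n)))) ^ (2 * m))"
proof -
  define N where "N = 2 * m * n"
  \<comment> \<open>The middle term compensates the shear: it makes the wave periodic under 2m
    columns combined with -m rows. It also gives edges of types II and III the opposite angles pi
    b/n and -pi b/n, whence the cosine.\<close>
  define th where "th i j a b = 2 * pi * real a * real i / real (2 * m) + pi * real b * real i / real n
      + 2 * pi * real b * j / real n" for i a b :: nat and j :: real
  define chi where "chi p r = cis (th (p div n) (real (p mod n)) (r div n) (r mod n))" for p r
  define F where "F = mat N N (\<lambda>(p, r). chi p r)"
  define G where "G = mat N N (\<lambda>(r, p). cnj (chi p r))"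
  define d where "d r = 1 + x * (2 * cos (\<phi> + of_real (pi * real (r mod n) / real n)))
      * cis (- (2 * pi * real (r div n) / real (2 * m)))" for r
  have sum_split: "(\<Sum>p<N. g (p div n) (p mod n)) = (\<Sum>i<2*m. \<Sum>j<n. g i j)" for g :: "nat \<Rightarrow> nat \<Rightarrow> complex"
    using sum.reindex_bij_betw[OF bij_betw_div_mod[OF n, of "2 * m"], of "\<lambda>(i, j). g i j"]
    by (simp add: N_def sum.cartesian_product)
  have prod_split: "(\<Prod>p<N. g (p div n) (p mod n)) = (\<Prod>i<2*m. \<Prod>j<n. g i j)" for g :: "nat \<Rightarrow> nat \<Rightarrow> complex"
    using prod.reindex_bij_betw[OF bij_betw_div_mod[OF n, of "2 * m"], of "\<lambda>(i, j). g i j"]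
    by (simp add: N_def prod.cartesian_product)
  have cis_cong: "cis s = cis t" if "s - t = 2 * pi * of_int k" for s t k
  proof -
    have "cis s = cis t * cis (2 * pi * of_int k)" using that by (simp add: cis_mult flip: that)
    then show ?thesis by simp
  qed
  have shift: "chi (nbr m n t p) r = chi p r * cis (- (2 * pi * real (r div n) / real (2 * m))
      + (if t = Type_II then pi * real (r mod n) / real n else - (pi * real (r mod n) / real n)))"
    if t: "t \<noteq> Type_I" for t p r
  proof -
    define a where "a = r div n"
    define b where "b = r mod n"
    define z where "z = int (p mod n) + (if t = Type_II then 1 else 0) - (if p div n = 0 then int m else 0)"
    have "real (nbr m n t p mod n) = of_int (int (nbr m n t p mod n))" by simp
    also have "\<dots> = of_int z - of_int (z div int n) * real n"
      unfolding nbr_div_mod(2)[OF n t] z_def[symmetric] by (simp add: minus_div_mult_eq_mod[symmetric])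
    finally have j: "real (nbr m n t p mod n) = of_int z - of_int (z div int n) * real n" .
    \<comment> \<open>Wrapping changes the angle by a multiple of 2 pi only; at the seam the
      contributions of 2m columns and m rows to the \<open>b\<close> part cancel.\<close>
    have "th (nbr m n t p div n) (real (nbr m n t p mod n)) a b -
       (th (p div n) (real (p mod n)) a b + (- (2 * pi * real a / real (2 * m))
          + (if t = Type_II then pi * real b / real n else - (pi * real b / real n))))
       = 2 * pi * of_int ((if p div n = 0 then int a else 0) - int b * (z div int n))"
    proof (cases "p div n = 0")
      case True
      then show ?thesis using m n
        unfolding th_def j nbr_div_mod(1)[OF n t]
        by (simp add: z_def field_simps of_nat_diff)
    next
      case False
      then have "real (p div n - 1) = real (p div n) - 1" by (simp add: of_nat_diff)
      then show ?thesis using m n False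
        unfolding th_def j nbr_div_mod(1)[OF n t]
        by (simp add: z_def field_simps)
    qed
    from cis_cong[OF this] show ?thesis unfolding chi_def a_def b_def by (simp add: cis_mult)
  qed
  have K: "kasteleyn m n x \<phi> $$ (p, q) =
     (\<Sum>t\<in>{Type_I, Type_II, Type_III}. if q = nbr m n t p then edge_weight x \<phi> t else 0)"
    if "p < N" "q < N" for p q using that by (simp add: kasteleyn_def N_def)
  have "Determinant.det (kasteleyn m n x \<phi>) = (\<Prod>r<N. d r)"
  proof (rule det_eigenbasis[where F = F and G = G and s = "of_nat N"])
    show "kasteleyn m n x \<phi> \<in> carrier_mat N N" by (simp add: kasteleyn_def N_def)
    show "F \<in> carrier_mat N N" "G \<in> carrier_mat N N" by (simp_all add: F_def G_def)
    show "of_nat N \<noteq> (0::complex)" using m n by (simp add: N_def)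
    fix p r assume pr: "p < N" "r < N"
    have "(\<Sum>q<N. kasteleyn m n x \<phi> $$ (p, q) * F $$ (q, r))
      = (\<Sum>q<N. \<Sum>t\<in>{Type_I, Type_II, Type_III}. if q = nbr m n t p then edge_weight x \<phi> t * chi q r else 0)"
      using pr by (intro sum.cong refl) (simp add: K F_def distrib_right)
    also have "\<dots> = (\<Sum>t\<in>{Type_I, Type_II, Type_III}. \<Sum>q<N. if q = nbr m n t p then edge_weight x \<phi> t * chi q r else 0)"
      by (rule sum.swap)
    also have "\<dots> = (\<Sum>t\<in>{Type_I, Type_II, Type_III}. edge_weight x \<phi> t * chi (nbr m n t p) r)"
      using nbr_less[OF m n] pr(1) by (intro sum.cong refl) (simp add: N_def)
    also have "\<dots> = chi p r * (1 + (x * exp (\<i> * \<phi>)) * cis (- (2 * pi * real (r div n) / real (2 * m)) + pi * real (r mod n) / real n)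
        + (x * exp (- (\<i> * \<phi>))) * cis (- (2 * pi * real (r div n) / real (2 * m)) - pi * real (r mod n) / real n))"
      using shift[of Type_II p r] shift[of Type_III p r]
      by (simp add: edge_weight_def nbr_def[of m n Type_I] distrib_left)
    also have "\<dots> = d r * chi p r"
    proof -
      have E: "1 + (x * exp (\<i> * \<phi>)) * cis (u + v) + (x * exp (- (\<i> * \<phi>))) * cis (u - v)
          = 1 + x * (2 * cos (\<phi> + of_real v)) * cis u" for u v
      proof -
        have "exp (\<i> * \<phi>) * cis (u + v) + exp (- (\<i> * \<phi>)) * cis (u - v) = (2 * cos (\<phi> + of_real v)) * cis u"
          by (simp add: cos_exp_eq cis_conv_exp exp_add[symmetric] algebra_simps)
        then have "x * (exp (\<i> * \<phi>) * cis (u + v) + exp (- (\<i> * \<phi>)) * cis (u - v))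
            = x * ((2 * cos (\<phi> + of_real v)) * cis u)" by simp
        then show ?thesis by (simp add: algebra_simps)
      qed
      show ?thesis unfolding d_def by (subst E) (rule mult.commute)
    qed
    finally show "(\<Sum>q<N. kasteleyn m n x \<phi> $$ (p, q) * F $$ (q, r)) = d r * F $$ (p, r)"
      using pr by (simp add: F_def)
  next
    fix r r' assume r: "r < N" "r' < N"
    define a where "a = int (r' div n) - int (r div n)"
    define b where "b = int (r' mod n) - int (r mod n)"
    have "(\<Sum>q<N. G $$ (r, q) * F $$ (q, r'))
      = (\<Sum>q<N. cis (th (q div n) (real (q mod n)) (r' div n) (r' mod n) - th (q div n) (real (q mod n)) (r div n) (r mod n)))"
      using r by (intro sum.cong refl) (simp add: F_def G_def chi_def cis_cnj cis_mult)
    also have "\<dots> = (\<Sum>i<2*m. \<Sum>j<n. cis (th i (real j) (r' div n) (r' mod n) - th i (real j) (r div n) (r mod n)))"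
      by (rule sum_split)
    also have "\<dots> = (\<Sum>i<2*m. \<Sum>j<n. cis (2 * pi * of_int a * real i / real (2 * m) + pi * of_int b * real i / real n) *
         cis (2 * pi * of_int b * real j / real n))"
    proof (intro sum.cong refl, unfold cis_mult, rule arg_cong[of _ _ cis])
      fix i j :: nat
      show "th i (real j) (r' div n) (r' mod n) - th i (real j) (r div n) (r mod n)
        = 2 * pi * of_int a * real i / real (2 * m) + pi * of_int b * real i / real n
          + 2 * pi * of_int b * real j / real n"
        unfolding th_def a_def b_def
        by (simp add: algebra_simps add_divide_distrib diff_divide_distrib del: of_nat_mult)
    qed
    \<comment> \<open>Summing over rows first forces equal vertical momenta; the mixed term in
      \<open>b\<close> and \<open>i\<close> then disappears and the sum over columns is again one
      over roots of unity.\<close>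
    also have "\<dots> = (\<Sum>i<2*m. cis (2 * pi * of_int a * real i / real (2 * m) + pi * of_int b * real i / real n)) *
         (if int n dvd b then of_nat n else 0)"
      by (simp add: sum_distrib_left[symmetric] sum_distrib_right[symmetric] sum_roots_unity_power[OF n])
    also have "\<dots> = (if r = r' then of_nat N else 0)"
    proof (cases "b = 0")
      case False
      moreover have "\<bar>b\<bar> < int n"
      proof -
        have "r mod n < n" "r' mod n < n" using n by simp_all
        then show ?thesis unfolding b_def by linarith
      qed
      ultimately have "\<not> int n dvd b" using dvd_imp_le_int[of b "int n"] by linarith
      moreover have "r \<noteq> r'" using False by (auto simp: b_def)
      ultimately show ?thesis by simp
    next
      case True
      have "(\<Sum>i<2*m. cis (2 * pi * of_int a * real i / real (2 * m))) = (if int (2 * m) dvd a then of_nat (2 * m) else 0)"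
        using sum_roots_unity_power[of "2 * m" a] m by simp
      moreover have "int (2 * m) dvd a \<longleftrightarrow> r = r'"
      proof
        assume "int (2 * m) dvd a"
        moreover have "r div n < 2 * m" "r' div n < 2 * m"
          using r by (auto simp: N_def less_mult_imp_div_less)
        then have "\<bar>a\<bar> < int (2 * m)" by (auto simp: a_def)
        ultimately have "a = 0" using dvd_imp_le_int[of a "int (2 * m)"] by linarith
        then show "r = r'" using True unfolding a_def b_def by (metis div_mult_mod_eq eq_iff_diff_eq_0 of_nat_eq_iff)
      qed (simp add: a_def)
      ultimately show ?thesis using True by (simp add: N_def)
    qed
    finally show "(\<Sum>q<N. G $$ (r, q) * F $$ (q, r')) = (if r = r' then of_nat N else 0)" .
  qed
  also have "\<dots> = (\<Prod>a<2*m. \<Prod>b<n. 1 + x * (2 * cos (\<phi> + of_real (pi * real b / real n)))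
      * cis (- (2 * pi * real a / real (2 * m))))"
    unfolding d_def by (rule prod_split)
  also have "\<dots> = (\<Prod>b<n. \<Prod>a<2*m. 1 + x * (2 * cos (\<phi> + of_real (pi * real b / real n)))
      * cis (- (2 * pi * real a / real (2 * m))))"
    by (rule prod.swap)
  also have "\<dots> = (\<Prod>b<n. 1 - (x * (2 * cos (\<phi> + of_real (pi * real b / real n)))) ^ (2 * m))"
    using m by (intro prod.cong refl prod_one_plus_roots_unity) auto
  finally show ?thesis .
qed

section \<open>Dimer configurations as permutations\<close>

definition cell :: "nat \<Rightarrow> nat \<Rightarrow> nat \<Rightarrow> tpoint" where
  "cell m n p = proj m n (latt (int (p div n)) (int (p mod n)))"

lemma proj_translate_eq:
  "proj m n v = proj m n w \<Longrightarrow> proj m n (v + z) = proj m n (w + z)"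
  by (simp add: proj_eq_iff)

lemma proj_latt_cell:
  assumes "m > 0" "n > 0"
  obtains p where "p < 2 * m * n" "proj m n (latt i j) = cell m n p"
proof -
  \<comment> \<open>Reducing the column uses \<open>a\<close> horizontal periods, each of which
    shifts the row by \<open>m\<close>; the corrected row is then reduced modulo
    \<open>n\<close>.\<close>
  define a where "a = i div (2 * int m)"
  define i' where "i' = nat (i mod (2 * int m))"
  define j' where "j' = nat ((j + int m * a) mod int n)"
  have i': "int i' = i - 2 * int m * a" "i' < 2 * m"
    using assms by (auto simp: i'_def a_def minus_mult_div_eq_mod nat_less_iff)
  have j': "int j' = (j + int m * a) - int n * ((j + int m * a) div int n)" "j' < n"
    using assms by (auto simp: j'_def minus_mult_div_eq_mod nat_less_iff)
  have "proj m n (latt (int i') (int j')) = proj m n (latt i j)"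
    unfolding proj_latt_eq
    by (intro exI[of _ "- a"] exI[of _ "- ((j + int m * a) div int n)"]) (simp add: i' j' algebra_simps)
  moreover have "(i' * n + j') div n = i'" "(i' * n + j') mod n = j'" using j' by auto
  ultimately have "proj m n (latt i j) = cell m n (i' * n + j')" by (simp add: cell_def)
  moreover have "i' * n + j' < 2 * m * n" using i' j' by (intro mult_add_less_mult)
  ultimately show ?thesis using that by blast
qed

lemma bij_betw_cell:
  assumes "m > 0" "n > 0"
  shows "bij_betw (cell m n) {..<2 * m * n} (white m n)"
  unfolding bij_betw_def
proof
  show "inj_on (cell m n) {..<2 * m * n}"
  proof (rule inj_onI)
    fix p q assume pq: "p \<in> {..<2 * m * n}" "q \<in> {..<2 * m * n}" "cell m n p = cell m n q"
    then obtain a b where ab: "int (p div n) = int (q div n) + 2 * int m * a"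
      "int (p mod n) = int (q mod n) + int n * b - int m * a"
      unfolding cell_def proj_latt_eq by blast
    have "p div n < 2 * m" "q div n < 2 * m" using pq by (auto simp: less_mult_imp_div_less)
    then have "\<bar>2 * int m * a\<bar> < 2 * int m" using ab(1) by linarith
    then have "a = 0" using assms by (simp add: abs_mult)
    have "int (p mod n) < int n" "int (q mod n) < int n" using assms by simp_all
    moreover have "int (p mod n) = int (q mod n) + int n * b" using ab(2) \<open>a = 0\<close> by simp
    ultimately have "\<bar>int n * b\<bar> < int n" by linarith
    then have "b = 0" using assms by (simp add: abs_mult)
    with \<open>a = 0\<close> have "p div n = q div n" "p mod n = q mod n" using ab by simp_all
    then show "p = q" by (metis div_mult_mod_eq)
  qed
  show "cell m n ` {..<2 * m * n} = white m n"
  proof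
    show "cell m n ` {..<2 * m * n} \<subseteq> white m n" by (auto simp: cell_def white_def)
    show "white m n \<subseteq> cell m n ` {..<2 * m * n}"
    proof
      fix P assume "P \<in> white m n"
      then obtain i j where "P = proj m n (latt i j)" by (auto simp: white_def Lambda_iff)
      then show "P \<in> cell m n ` {..<2 * m * n}" using proj_latt_cell[OF assms, of i j] by (metis image_eqI lessThan_iff)
    qed
  qed
qed

text \<open>Links the arithmetic of \<open>nbr\<close> to the geometry: the seam correction by
  \<open>m\<close> and the reduction modulo \<open>n\<close> are witnessed by explicit
  periods.\<close>

lemma cell_nbr:
  assumes "m > 0" "n > 0"
  shows "cell m n (nbr m n t p) = proj m n (latt (int (p div n)) (int (p mod n)) + dv t)"
proof (cases "t = Type_I")
  case True
  then show ?thesis by (simp add: cell_def nbr_def dv_latt latt_add del: of_nat_mod of_nat_div)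
next
  case False
  define z where "z = int (p mod n) + (if t = Type_II then 1 else 0)"
  have dv: "latt (int (p div n)) (int (p mod n)) + dv t = latt (int (p div n) - 1) z"
    using False by (cases t) (simp_all only: dv_latt latt_add z_def if_True if_False edge_type.distinct, simp_all)
  note dm = nbr_div_mod[OF assms(2) False, of m p]
  show ?thesis
  proof (cases "p div n = 0")
    case True
    have "int (nbr m n t p div n) = int (p div n) - 1 + 2 * int m * 1"
      using True assms by (simp add: dm(1) of_nat_diff)
    moreover have "int (nbr m n t p mod n) = z + int n * (- ((z - int m) div int n)) - int m * 1"
      unfolding dm(2) using True by (simp add: z_def minus_mult_div_eq_mod[symmetric] algebra_simps)
    ultimately show ?thesis unfolding dv cell_def proj_latt_eq by blast
  next
    case False
    have "int (nbr m n t p div n) = int (p div n) - 1 + 2 * int m * 0"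
      using False by (simp add: dm(1) of_nat_diff)
    moreover have "int (nbr m n t p mod n) = z + int n * (- (z div int n)) - int m * 0"
      unfolding dm(2) using False by (simp add: z_def minus_mult_div_eq_mod[symmetric] algebra_simps)
    ultimately show ?thesis unfolding dv cell_def proj_latt_eq by blast
  qed
qed

text \<open>Type I stays in its column and the others leave it; types II and III differ by one row,
  which is visible modulo \<open>n\<close> once n is at least 2. Hence there are no parallel
  edges.\<close>

lemma nbr_inject:
  assumes "m > 0" "n \<ge> 2" "p < 2 * m * n" "nbr m n t p = nbr m n t' p"
  shows "t = t'"
proof (rule ccontr)
  assume neq: "t \<noteq> t'"
  have n: "n > 0" using assms by simp
  have col: "nbr m n s p div n \<noteq> p div n" if "s \<noteq> Type_I" for s
    unfolding nbr_div_mod(1)[OF n that] using assms(1) by auto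
  have "t = Type_I \<longleftrightarrow> t' = Type_I"
    using col[of t] col[of t'] assms(4) by (cases "t = Type_I"; cases "t' = Type_I") (auto simp: nbr_def[of m n Type_I])
  moreover have "t \<noteq> Type_I" using neq calculation by auto
  ultimately have ne: "t \<noteq> Type_I" "t' \<noteq> Type_I" by auto
  define z where "z = int (p mod n) - (if p div n = 0 then int m else 0)"
  have "(z + (if t = Type_II then 1 else 0)) mod int n = (z + (if t' = Type_II then 1 else 0)) mod int n"
    using nbr_div_mod(2)[OF n ne(1), of m p] nbr_div_mod(2)[OF n ne(2), of m p] assms(4)
    by (simp add: z_def algebra_simps)
  then have "int n dvd (if t = Type_II then 1 else 0) - (if t' = Type_II then 1 else 0)"
    by (simp add: mod_eq_dvd_iff)
  moreover have "(if t = Type_II then 1 else 0) - (if t' = Type_II then 1 else (0::int)) \<in> {1, -1}"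
    using neq ne by (cases t; cases t') auto
  ultimately show False using assms(2) by auto
qed

text \<open>White vertices are sent to the numbers of their black partners; horizontal edges are the
  fixed points.\<close>

definition dimer_perms :: "nat \<Rightarrow> nat \<Rightarrow> (nat \<Rightarrow> nat) set" where
  "dimer_perms m n = {f. f permutes {0..<2 * m * n} \<and> (\<forall>p<2 * m * n. \<exists>t. f p = nbr m n t p)}"

definition perm_edges :: "nat \<Rightarrow> nat \<Rightarrow> (nat \<Rightarrow> nat) \<Rightarrow> edge set" where
  "perm_edges m n f = {(cell m n p, t) | p t. p < 2 * m * n \<and> f p = nbr m n t p}"

text \<open>A perfect matching is a bijection between white and black vertices along edges, and in
  the absence of parallel edges the two ends determine the edge.\<close>

lemma bij_betw_perm_edges:
  assumes m: "m > 0" and n: "n \<ge> 2"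
  shows "bij_betw (perm_edges m n) (dimer_perms m n) (dimers m n)"
proof -
  let ?N = "2 * m * n"
  have n0: "n > 0" using n by simp
  note bij = bij_betw_cell[OF m n0]
  have cinj: "cell m n p = cell m n q \<longleftrightarrow> p = q" if "p < ?N" "q < ?N" for p q
    using bij that by (auto simp: bij_betw_def inj_on_eq_iff)
  have lift: "\<exists>p<?N. proj m n v = cell m n p" if "v \<in> Lambda" for v
    using that proj_latt_cell[OF m n0] unfolding Lambda_iff by metis
  have mem: "(cell m n p, t) \<in> perm_edges m n f \<longleftrightarrow> f p = nbr m n t p" if "p < ?N" for p t f
    using that cinj by (auto simp: perm_edges_def)
  \<comment> \<open>The black vertex with number \<open>q\<close> is the end of the type
    \<open>t\<close> edge from \<open>p\<close>, expressed once with lifts and once with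
    \<open>nbr\<close>.\<close>
  have bk: "cell m n p = proj m n (v - dv t) \<longleftrightarrow> nbr m n t p = q"
    if "p < ?N" "q < ?N" "proj m n v = cell m n q" for p q t v
  proof -
    let ?w = "latt (int (p div n)) (int (p mod n))"
    have "cell m n p = proj m n (v - dv t) \<longleftrightarrow> proj m n ?w = proj m n (v - dv t)" by (simp add: cell_def)
    also have "\<dots> \<longleftrightarrow> proj m n (?w + dv t) = proj m n v"
      using proj_translate_eq[of m n ?w "v - dv t" "dv t"] proj_translate_eq[of m n "?w + dv t" v "- dv t"]
      by auto
    also have "\<dots> \<longleftrightarrow> cell m n (nbr m n t p) = cell m n q" unfolding cell_nbr[OF m n0] that(3) ..
    also have "\<dots> \<longleftrightarrow> nbr m n t p = q" using that nbr_less[OF m n0] by (intro cinj) auto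
    finally show ?thesis .
  qed
  have into: "perm_edges m n f \<in> dimers m n" if f: "f \<in> dimer_perms m n" for f
    unfolding dimers_iff
  proof (intro conjI ballI)
    show "perm_edges m n f \<subseteq> edges m n" by (auto simp: perm_edges_def edges_def white_def cell_def)
  next
    fix v assume "v \<in> Lambda"
    then obtain p where p: "p < ?N" "proj m n v = cell m n p" using lift by blast
    show "\<exists>!t. (proj m n v, t) \<in> perm_edges m n f"
      unfolding p(2) mem[OF p(1)] using f p(1) nbr_inject[OF m n p(1)] by (auto simp: dimer_perms_def)
  next
    fix v assume v: "v \<in> Lambda"
    then obtain q where q: "q < ?N" "proj m n v = cell m n q" using lift by blast
    have perm: "f permutes {0..<?N}" using f by (simp add: dimer_perms_def)
    have mem': "(proj m n (v - dv t), t) \<in> perm_edges m n f \<longleftrightarrow> (\<exists>p<?N. nbr m n t p = q \<and> f p = q)" for t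
    proof -
      obtain p where p: "p < ?N" "proj m n (v - dv t) = cell m n p"
        using lift Lambda_diff[OF v dv_in_Lambda] by blast
      then have "nbr m n t p = q" using bk[OF p(1) q(1,2)] by metis
      moreover have "p' = p" if "p' < ?N" "nbr m n t p' = q" for p'
        using bk[OF that(1) q(1,2)] that p cinj by metis
      ultimately show ?thesis unfolding p(2) mem[OF p(1)] using p(1) by metis
    qed
    have "q \<in> f ` {0..<?N}" using permutes_image[OF perm] q(1) by simp
    then obtain p where p: "p < ?N" "f p = q" by auto
    obtain t where t: "f p = nbr m n t p" using f p by (auto simp: dimer_perms_def)
    show "\<exists>!t. (proj m n (v - dv t), t) \<in> perm_edges m n f"
      unfolding mem'
    proof (rule ex1I[of _ t])
      show "\<exists>p<?N. nbr m n t p = q \<and> f p = q" using p t by auto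
      fix t' assume "\<exists>p<?N. nbr m n t' p = q \<and> f p = q"
      then obtain p' where p': "p' < ?N" "nbr m n t' p' = q" "f p' = q" by blast
      then have "p' = p" using p permutes_inj[OF perm] by (metis injD)
      then show "t' = t" using nbr_inject[OF m n p(1), of t' t] p' p t by simp
    qed
  qed
  have inj: "inj_on (perm_edges m n) (dimer_perms m n)"
  proof (rule inj_onI, rule ext)
    fix f g p
    assume f: "f \<in> dimer_perms m n" and g: "g \<in> dimer_perms m n" and eq: "perm_edges m n f = perm_edges m n g"
    show "f p = g p"
    proof (cases "p < ?N")
      case True
      then obtain t where "f p = nbr m n t p" using f by (auto simp: dimer_perms_def)
      then show ?thesis using mem[OF True, of t f] mem[OF True, of t g] eq by auto
    next
      case False
      then have "f p = p" "g p = p"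
        using f g unfolding dimer_perms_def by (auto intro!: permutes_not_in)
      then show ?thesis by simp
    qed
  qed
  have "M \<in> perm_edges m n ` dimer_perms m n" if M: "M \<in> dimers m n" for M
  proof -
    have "\<exists>!t. (cell m n p, t) \<in> M" for p
      using M latt_in_Lambda unfolding dimers_iff cell_def by blast
    then obtain ty where ty: "\<And>p t. (cell m n p, t) \<in> M \<longleftrightarrow> t = ty p" by metis
    define f where "f p = (if p < ?N then nbr m n (ty p) p else p)" for p
    have "inj_on f {0..<?N}"
    proof (rule inj_onI)
      fix p p' assume "p \<in> {0..<?N}" "p' \<in> {0..<?N}" and eq: "f p = f p'"
      then have p: "p < ?N" "p' < ?N" by auto
      let ?v = "latt (int (f p div n)) (int (f p mod n))"
      have fp: "f p < ?N" using p nbr_less[OF m n0] by (simp add: f_def)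
      have v: "proj m n ?v = cell m n (f p)" by (simp add: cell_def)
      have 1: "cell m n p = proj m n (?v - dv (ty p))" "cell m n p' = proj m n (?v - dv (ty p'))"
        using bk[OF p(1) fp v] bk[OF p(2) fp v] eq p by (auto simp: f_def)
      have "(proj m n (?v - dv (ty p)), ty p) \<in> M" "(proj m n (?v - dv (ty p')), ty p') \<in> M"
        using ty 1 by metis+
      then have "ty p = ty p'" using M latt_in_Lambda unfolding dimers_iff by blast
      then have "cell m n p = cell m n p'" using 1 by simp
      then show "p = p'" using cinj p by blast
    qed
    moreover have "f ` {0..<?N} \<subseteq> {0..<?N}" using nbr_less[OF m n0] by (auto simp: f_def)
    ultimately have "bij_betw f {0..<?N} {0..<?N}" by (simp add: bij_betw_def endo_inj_surj)
    then have "f permutes {0..<?N}" by (rule bij_imp_permutes) (simp add: f_def)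
    then have f: "f \<in> dimer_perms m n" by (auto simp: dimer_perms_def f_def)
    have "perm_edges m n f = M"
    proof (intro Set.set_eqI)
      fix e :: edge
      obtain P t where e: "e = (P, t)" by (cases e)
      show "e \<in> perm_edges m n f \<longleftrightarrow> e \<in> M"
      proof (cases "P \<in> white m n")
        case True
        then obtain p where p: "p < ?N" "P = cell m n p" using bij by (auto simp: bij_betw_def)
        have "f p = nbr m n t p \<longleftrightarrow> t = ty p" using p nbr_inject[OF m n p(1)] by (auto simp: f_def)
        then show ?thesis unfolding e p(2) mem[OF p(1)] ty .
      next
        case False
        moreover have "M \<subseteq> edges m n" using M by (rule dimers_subset)
        moreover have "perm_edges m n f \<subseteq> edges m n" using into[OF f] by (rule dimers_subset)
        ultimately show ?thesis by (auto simp: e edges_def)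
      qed
    qed
    then show ?thesis using f by auto
  qed
  with inj into show ?thesis by (auto simp: bij_betw_def)
qed

section \<open>Edge counts, paths and the signed partition function\<close>

definition type_count :: "edge set \<Rightarrow> edge_type \<Rightarrow> nat" where
  "type_count M t = card {e \<in> M. snd e = t}"

lemma type_count_perm:
  assumes "m > 0" "n > 0"
  shows "type_count (perm_edges m n f) t = card {p. p < 2 * m * n \<and> f p = nbr m n t p}"
proof -
  have "inj_on (\<lambda>p. (cell m n p, t)) {p. p < 2 * m * n \<and> f p = nbr m n t p}"
    using bij_betw_cell[OF assms] by (auto simp: bij_betw_def inj_on_def)
  moreover have "{e \<in> perm_edges m n f. snd e = t} = (\<lambda>p. (cell m n p, t)) ` {p. p < 2 * m * n \<and> f p = nbr m n t p}"
    by (auto simp: perm_edges_def)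
  ultimately show ?thesis by (simp add: type_count_def card_image)
qed

lemma finite_dimers:
  assumes "m > 0" "n \<ge> 2"
  shows "finite (dimers m n)" "M \<in> dimers m n \<Longrightarrow> finite M"
proof -
  have "finite (dimer_perms m n)"
    by (rule finite_subset[OF _ finite_permutations[of "{0..<2 * m * n}"]]) (auto simp: dimer_perms_def)
  then show "finite (dimers m n)" using bij_betw_perm_edges[OF assms] bij_betw_finite by blast
  have "finite (white m n)"
    using bij_betw_finite[OF bij_betw_cell[of m n]] assms by simp
  moreover have "finite (UNIV :: edge_type set)"
  proof -
    have "(UNIV :: edge_type set) = {Type_I, Type_II, Type_III}" using edge_type.exhaust by auto
    show ?thesis unfolding \<open>UNIV = {Type_I, Type_II, Type_III}\<close> by simp
  qed
  ultimately have "finite (edges m n)" by (simp add: edges_def)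
  then show "finite M" if "M \<in> dimers m n" by (rule finite_subset[OF dimers_subset[OF that]])
qed

text \<open>Non-horizontal edges move one column to the left, so \<open>sign_column_shift\<close>
  applies. There are 2mk moved points, m k of the row shifts come from the seam, and the row balance
  therefore makes the number of type II edges equal to mk + nl.\<close>

lemma dimer_perm_counts:
  assumes m: "m > 0" and n: "n \<ge> 2" and f: "f \<in> dimer_perms m n"
  obtains k l where "k \<le> n" "type_count (perm_edges m n f) Type_I = 2 * m * (n - k)"
    "int (type_count (perm_edges m n f) Type_II) = int m * int k + int n * l"
    "int (type_count (perm_edges m n f) Type_III) = int m * int k - int n * l"
    "sign f = (if even (int k + (int k - 1) * l) then 1 else -1)"
proof -
  let ?N = "2 * m * n"
  have n0: "n > 0" using n by simp
  define S where "S = {p. p < 2 * m * n \<and> f p \<noteq> p}"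
  define T where "T t = {p. p < ?N \<and> f p = nbr m n t p}" for t
  have TI: "nbr m n Type_I p = p" for p by (simp add: nbr_def)
  have ex: "\<exists>t. f p = nbr m n t p" if "p < ?N" for p using f that by (auto simp: dimer_perms_def)
  have S_type: "f p = nbr m n Type_II p \<or> f p = nbr m n Type_III p" if p: "p \<in> S" for p
  proof -
    obtain t where "f p = nbr m n t p" using ex[of p] p by (auto simp: S_def)
    moreover have "t \<noteq> Type_I" using p calculation TI by (auto simp: S_def)
    ultimately show ?thesis by (cases t) auto
  qed
  have disj: "\<not> (f p = nbr m n t p \<and> f p = nbr m n t' p)" if "p < ?N" "t \<noteq> t'" for p t t'
    using nbr_inject[OF m n that(1), of t t'] that(2) by metis
  have ne: "nbr m n Type_II p \<noteq> p" "nbr m n Type_III p \<noteq> p" "nbr m n Type_II p \<noteq> nbr m n Type_III p"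
    if "p < ?N" for p
    using nbr_inject[OF m n that, of Type_II Type_I] nbr_inject[OF m n that, of Type_III Type_I]
      nbr_inject[OF m n that, of Type_II Type_III] by (auto simp: TI)
  have ST: "S = T Type_II \<union> T Type_III" "T Type_II \<inter> T Type_III = {}"
  proof -
    have False if "p \<in> T Type_II" "p \<in> T Type_III" for p
      using that ne(3)[of p] by (auto simp: T_def)
    then show "T Type_II \<inter> T Type_III = {}" by blast
    show "S = T Type_II \<union> T Type_III"
    proof (intro equalityI subsetI)
      fix p assume "p \<in> S"
      then show "p \<in> T Type_II \<union> T Type_III" using S_type[of p] by (auto simp: S_def T_def)
    next
      fix p assume "p \<in> T Type_II \<union> T Type_III"
      then have "p < ?N" "f p = nbr m n Type_II p \<or> f p = nbr m n Type_III p" by (auto simp: T_def)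
      then show "p \<in> S" using ne(1,2)[of p] by (auto simp: S_def)
    qed
  qed
  have SI: "T Type_I = {..<?N} - S" by (auto simp: T_def S_def TI)
  have finT: "finite (T t)" for t by (simp add: T_def)
  \<comment> \<open>\<open>d\<close> is the row increment of a type II edge, and \<open>s\<close>
    the drop by \<open>m\<close> that occurs only when leaving column 0.\<close>
  define d where "d p = (if f p = nbr m n Type_II p then 1 else 0 :: int)" for p
  define s where "s i = (if i = 0 then int m else 0)" for i :: nat
  have perm: "f permutes {0..<2 * m * n}" using f by (simp add: dimer_perms_def)
  have Sn: "\<exists>t. t \<noteq> Type_I \<and> f p = nbr m n t p \<and> (if t = Type_II then 1 else 0) = d p" if "p \<in> S" for p
    using S_type[OF that] disj[of p Type_II Type_III] that by (auto simp: d_def S_def)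
  obtain k l where kl: "\<And>i. i < 2 * m \<Longrightarrow> card {p \<in> S. p div n = i} = k"
    "(\<Sum>p\<in>S. d p - s (p div n)) = int n * l"
    "sign f = (if even (int k + (int k - 1) * l) then 1 else -1)"
  proof (rule sign_column_shift[OF perm, of d s, folded S_def])
    show "even (2 * m)" "0 < 2 * m" "0 < n" using m n0 by auto
    fix p assume p: "p \<in> S"
    obtain t where t: "t \<noteq> Type_I" "f p = nbr m n t p" "(if t = Type_II then 1 else 0) = d p" using Sn[OF p] by blast
    show "f p div n = (if p div n = 0 then 2 * m - 1 else p div n - 1)"
      unfolding t(2) by (rule nbr_div_mod[OF n0 t(1)])
    show "int (f p mod n) = (int (p mod n) + d p - s (p div n)) mod int n"
      using nbr_div_mod(2)[OF n0 t(1), of m p] t(2,3) by (simp add: s_def)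
    show "d p = 0 \<or> d p = 1" by (simp add: d_def)
  qed blast
  have finS: "finite S" by (simp add: S_def)
  have cardS: "card S = 2 * m * k"
  proof -
    have "S = (\<Union>i<2*m. {p \<in> S. p div n = i})" by (auto simp: S_def less_mult_imp_div_less)
    then have "card S = card (\<Union>i<2*m. {p \<in> S. p div n = i})" by simp
    also have "\<dots> = (\<Sum>i<2*m. card {p \<in> S. p div n = i})"
      by (rule card_UN_disjoint) (use finS in auto)
    finally show ?thesis using kl(1) by simp
  qed
  have "card S \<le> ?N"
    using card_mono[of "{..<?N}" S] by (auto simp: S_def)
  then have kn: "k \<le> n" using m unfolding cardS by simp
  have "card (T Type_I) = ?N - card S"
    unfolding SI using finS by (subst card_Diff_subset) (auto simp: S_def)
  then have cI: "card (T Type_I) = 2 * m * (n - k)" unfolding cardS by (simp add: diff_mult_distrib2)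
  have "(\<Sum>p\<in>S. d p) = int (card (T Type_II))"
  proof -
    have "(\<Sum>p\<in>S. d p) = (\<Sum>p\<in>T Type_II. d p) + (\<Sum>p\<in>T Type_III. d p)"
      unfolding ST(1) by (rule sum.union_disjoint) (use finT ST(2) in auto)
    moreover have "(\<Sum>p\<in>T Type_III. d p) = 0"
    proof (intro sum.neutral ballI)
      fix p assume "p \<in> T Type_III"
      then show "d p = 0" using ne(3)[of p] by (auto simp: d_def T_def)
    qed
    moreover have "(\<Sum>p\<in>T Type_II. d p) = int (card (T Type_II))" by (simp add: d_def T_def)
    ultimately show ?thesis by simp
  qed
  moreover have "(\<Sum>p\<in>S. s (p div n)) = int m * int k"
  proof -
    have "(\<Sum>p\<in>S. s (p div n)) = (\<Sum>p\<in>{p \<in> S. p div n = 0}. int m)"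
      unfolding s_def using finS by (simp add: sum.If_cases Int_def)
    then show ?thesis using kl(1)[of 0] m by (simp add: mult.commute)
  qed
  ultimately have cII: "int (card (T Type_II)) = int m * int k + int n * l"
    using kl(2) by (simp add: sum_subtractf)
  have "card S = card (T Type_II) + card (T Type_III)"
    unfolding ST(1) by (rule card_Un_disjoint) (use finT ST(2) in auto)
  then have "int (card S) = int (card (T Type_II)) + int (card (T Type_III))" by simp
  moreover have "int (card S) = 2 * (int m * int k)" unfolding cardS by simp
  ultimately have "int (card (T Type_III)) = int m * int k - int n * l" using cII by linarith
  then show ?thesis
    using that[OF kn, of l] cI cII kl(3) unfolding type_count_perm[OF m n0] T_def by blast
qed

text \<open>The number of paths \<open>k\<close> (non-horizontal edges in each column) and their total number of
  turns \<open>l\<close> around the vertical direction.\<close>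

definition path_count :: "nat \<Rightarrow> edge set \<Rightarrow> nat" where
  "path_count m M = (type_count M Type_II + type_count M Type_III) div (2 * m)"

definition path_turns :: "nat \<Rightarrow> edge set \<Rightarrow> int" where
  "path_turns n M = (int (type_count M Type_II) - int (type_count M Type_III)) div (2 * int n)"

lemma path_statistics:
  assumes m: "m > 0" and n: "n \<ge> 2" and f: "f \<in> dimer_perms m n"
  defines "M \<equiv> perm_edges m n f"
  shows "path_count m M \<le> n" "type_count M Type_I = 2 * m * (n - path_count m M)"
    "int (type_count M Type_II) = int m * int (path_count m M) + int n * path_turns n M"
    "int (type_count M Type_III) = int m * int (path_count m M) - int n * path_turns n M"
    "sign f = (if even (int (path_count m M) + (int (path_count m M) - 1) * path_turns n M) then 1 else -1)"
proof -
  obtain k l where kl: "k \<le> n" "type_count M Type_I = 2 * m * (n - k)"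
    "int (type_count M Type_II) = int m * int k + int n * l"
    "int (type_count M Type_III) = int m * int k - int n * l"
    "sign f = (if even (int k + (int k - 1) * l) then 1 else -1)"
    using dimer_perm_counts[OF m n f] unfolding M_def by metis
  have "int (type_count M Type_II + type_count M Type_III) = int (2 * m * k)" using kl(3,4) by simp
  then have "type_count M Type_II + type_count M Type_III = 2 * m * k" by (simp only: of_nat_eq_iff)
  then have k: "path_count m M = k" using m by (simp add: path_count_def)
  have l: "path_turns n M = l" unfolding path_turns_def kl(3,4) using n by simp
  show "path_count m M \<le> n" "type_count M Type_I = 2 * m * (n - path_count m M)"
    "int (type_count M Type_II) = int m * int (path_count m M) + int n * path_turns n M"
    "int (type_count M Type_III) = int m * int (path_count m M) - int n * path_turns n M"
    "sign f = (if even (int (path_count m M) + (int (path_count m M) - 1) * path_turns n M) then 1 else -1)"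
    unfolding k l using kl by auto
qed

lemma dimers_path_statistics:
  assumes m: "m > 0" and n: "n \<ge> 2" and M: "M \<in> dimers m n"
  shows "path_count m M \<le> n" "type_count M Type_I = 2 * m * (n - path_count m M)"
    "int (type_count M Type_II) = int m * int (path_count m M) + int n * path_turns n M"
    "int (type_count M Type_III) = int m * int (path_count m M) - int n * path_turns n M"
proof -
  obtain f where "f \<in> dimer_perms m n" "M = perm_edges m n f"
    using bij_betw_perm_edges[OF m n] M by (auto simp: bij_betw_def)
  then show "path_count m M \<le> n" "type_count M Type_I = 2 * m * (n - path_count m M)"
    "int (type_count M Type_II) = int m * int (path_count m M) + int n * path_turns n M"
    "int (type_count M Type_III) = int m * int (path_count m M) - int n * path_turns n M"
    using path_statistics[OF m n] by metis+
qed

text \<open>Leibniz expansion of \<open>kasteleyn\<close>: a permutation contributes only if every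
  step is an edge, and its product of weights is determined by the path statistics. The other side
  is \<open>det_kasteleyn\<close>.\<close>

lemma signed_partition_function:
  assumes m: "m > 0" and n: "n \<ge> 2"
  shows "(\<Sum>M\<in>dimers m n. (if even (int (path_count m M) + (int (path_count m M) - 1) * path_turns n M) then 1 else -1)
       * X ^ path_count m M * exp (2 * of_nat n * of_int (path_turns n M) * \<i> * \<phi>))
    = (\<Prod>b<n. 1 - X * (2 * cos (\<phi> + of_real (pi * real b / real n))) ^ (2 * m))"
proof -
  let ?N = "2 * m * n"
  have n0: "n > 0" using n by simp
  \<comment> \<open>A 2m-th root of \<open>X\<close>, because the determinant depends on the edge
    weight through x^(2m) only.\<close>
  define x where "x = (if X = 0 then 0 else exp (Ln X / of_nat (2 * m)))"
  have x: "x ^ (2 * m) = X"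
  proof (cases "X = 0")
    case False
    have "x ^ (2 * m) = exp (of_nat (2 * m) * (Ln X / of_nat (2 * m)))"
      using False by (simp only: x_def if_False exp_of_nat_mult)
    also have "\<dots> = X" using False m by simp
    finally show ?thesis .
  qed (use m in \<open>simp add: x_def\<close>)
  let ?T = "{Type_I, Type_II, Type_III}"
  have T: "t \<in> ?T" for t by (cases t) auto
  define g where "g M = (if even (int (path_count m M) + (int (path_count m M) - 1) * path_turns n M) then 1 else -1)
       * X ^ path_count m M * exp (2 * of_nat n * of_int (path_turns n M) * \<i> * \<phi>)" for M
  have "Determinant.det (kasteleyn m n x \<phi>) = (\<Sum>f | f permutes {0..<?N}.
      of_int (sign f) * (\<Prod>p = 0..<?N. kasteleyn m n x \<phi> $$ (p, f p)))"
    by (simp add: Determinant.det_def kasteleyn_def)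
  also have "\<dots> = (\<Sum>f\<in>dimer_perms m n. of_int (sign f) * (\<Prod>p = 0..<?N. kasteleyn m n x \<phi> $$ (p, f p)))"
  proof (rule sum.mono_neutral_right)
    show "finite {f. f permutes {0..<?N}}" by (simp add: finite_permutations)
    show "dimer_perms m n \<subseteq> {f. f permutes {0..<?N}}" by (auto simp: dimer_perms_def)
    show "\<forall>f\<in>{f. f permutes {0..<?N}} - dimer_perms m n.
       of_int (sign f) * (\<Prod>p = 0..<?N. kasteleyn m n x \<phi> $$ (p, f p)) = 0"
    proof
      fix f assume f: "f \<in> {f. f permutes {0..<?N}} - dimer_perms m n"
      then obtain p where p: "p < ?N" "\<And>t. f p \<noteq> nbr m n t p" by (auto simp: dimer_perms_def)
      have "f p \<in> {0..<?N}" using f p(1) by (simp add: permutes_in_image)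
      then have "kasteleyn m n x \<phi> $$ (p, f p) = 0" using p by (simp add: kasteleyn_def)
      then have "(\<Prod>p = 0..<?N. kasteleyn m n x \<phi> $$ (p, f p)) = 0"
        using p(1) by (intro prod_zero) auto
      then show "of_int (sign f) * (\<Prod>p = 0..<?N. kasteleyn m n x \<phi> $$ (p, f p)) = 0" by simp
    qed
  qed
  also have "\<dots> = (\<Sum>f\<in>dimer_perms m n. g (perm_edges m n f))"
  proof (rule sum.cong[OF refl])
    fix f assume f: "f \<in> dimer_perms m n"
    define M where "M = perm_edges m n f"
    note st = path_statistics[OF m n f, folded M_def]
    have perm: "f permutes {0..<?N}" using f by (simp add: dimer_perms_def)
    have "\<forall>p\<in>{0..<?N}. \<exists>t. f p = nbr m n t p" using f by (auto simp: dimer_perms_def)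
    then obtain ty where ty: "\<And>p. p < ?N \<Longrightarrow> f p = nbr m n (ty p) p" by (metis atLeastLessThan_iff zero_le)
    have iff: "f p = nbr m n t p \<longleftrightarrow> t = ty p" if "p < ?N" for p t
      using ty[OF that] nbr_inject[OF m n that] by metis
    have K: "kasteleyn m n x \<phi> $$ (p, f p) = edge_weight x \<phi> (ty p)" if p: "p < ?N" for p
    proof -
      have "f p < ?N" using perm p permutes_in_image by fastforce
      then have "kasteleyn m n x \<phi> $$ (p, f p) = (\<Sum>t\<in>?T. if f p = nbr m n t p then edge_weight x \<phi> t else 0)"
        using p by (simp add: kasteleyn_def)
      also have "\<dots> = (\<Sum>t\<in>?T. if t = ty p then edge_weight x \<phi> t else 0)" using iff[OF p] by simp
      also have "\<dots> = edge_weight x \<phi> (ty p)" using T[of "ty p"] by (subst sum.delta) auto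
      finally show ?thesis .
    qed
    have "(\<Prod>p = 0..<?N. kasteleyn m n x \<phi> $$ (p, f p)) = (\<Prod>p\<in>{0..<?N}. edge_weight x \<phi> (ty p))"
      using K by (intro prod.cong) auto
    also have "\<dots> = (\<Prod>t\<in>?T. \<Prod>p\<in>{p \<in> {0..<?N}. ty p = t}. edge_weight x \<phi> (ty p))"
      by (rule prod.group[symmetric]) (use T in auto)
    also have "\<dots> = (\<Prod>t\<in>?T. edge_weight x \<phi> t ^ type_count M t)"
    proof (rule prod.cong[OF refl])
      fix t
      have "{p \<in> {0..<?N}. ty p = t} = {p. p < ?N \<and> f p = nbr m n t p}" using iff by auto
      then have "type_count M t = card {p \<in> {0..<?N}. ty p = t}"
        unfolding M_def type_count_perm[OF m n0] by simp
      then show "(\<Prod>p\<in>{p \<in> {0..<?N}. ty p = t}. edge_weight x \<phi> (ty p)) = edge_weight x \<phi> t ^ type_count M t"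
        by simp
    qed
    also have "\<dots> = (x * exp (\<i> * \<phi>)) ^ type_count M Type_II * (x * exp (- (\<i> * \<phi>))) ^ type_count M Type_III"
      by (simp add: edge_weight_def)
    also have "\<dots> = x ^ (type_count M Type_II + type_count M Type_III) *
        (exp (\<i> * \<phi>) ^ type_count M Type_II * exp (- (\<i> * \<phi>)) ^ type_count M Type_III)"
      by (simp add: power_mult_distrib power_add)
    also have "type_count M Type_II + type_count M Type_III = 2 * m * path_count m M"
    proof -
      have "int (type_count M Type_II + type_count M Type_III) = int (2 * m * path_count m M)"
        using st(3,4) by simp
      then show ?thesis by (simp only: of_nat_eq_iff)
    qed
    also have "x ^ (2 * m * path_count m M) = X ^ path_count m M" by (simp only: power_mult[of x "2 * m"] x)
    also have "exp (\<i> * \<phi>) ^ type_count M Type_II * exp (- (\<i> * \<phi>)) ^ type_count M Type_III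
       = exp (of_int (int (type_count M Type_II) - int (type_count M Type_III)) * (\<i> * \<phi>))"
      by (simp add: exp_of_nat_mult[symmetric] exp_add[symmetric] algebra_simps)
    also have "int (type_count M Type_II) - int (type_count M Type_III) = 2 * int n * path_turns n M"
      using st(3,4) by simp
    also have "of_int (2 * int n * path_turns n M) * (\<i> * \<phi>) = 2 * of_nat n * of_int (path_turns n M) * \<i> * \<phi>"
      by simp
    finally have P: "(\<Prod>p = 0..<?N. kasteleyn m n x \<phi> $$ (p, f p)) =
        X ^ path_count m M * exp (2 * of_nat n * of_int (path_turns n M) * \<i> * \<phi>)" .
    have "(of_int (sign f) :: complex) = (if even (int (path_count m M) + (int (path_count m M) - 1) * path_turns n M) then 1 else -1)"
      by (subst st(5)) (simp only: of_int_1 of_int_minus if_distrib[of of_int])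
    then show "of_int (sign f) * (\<Prod>p = 0..<?N. kasteleyn m n x \<phi> $$ (p, f p)) = g (perm_edges m n f)"
      unfolding g_def M_def[symmetric] P by (simp only: mult.assoc)
  qed
  also have "\<dots> = (\<Sum>M\<in>dimers m n. g M)"
    by (rule sum.reindex_bij_betw[OF bij_betw_perm_edges[OF m n]])
  finally have "(\<Sum>M\<in>dimers m n. g M) = Determinant.det (kasteleyn m n x \<phi>)" by simp
  also have "\<dots> = (\<Prod>b<n. 1 - (x * (2 * cos (\<phi> + of_real (pi * real b / real n)))) ^ (2 * m))"
    by (rule det_kasteleyn[OF m n0])
  also have "\<dots> = (\<Prod>b<n. 1 - X * (2 * cos (\<phi> + of_real (pi * real b / real n))) ^ (2 * m))"
    by (simp only: power_mult_distrib x)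
  finally show ?thesis unfolding g_def .
qed

lemma edge_type_cases: "t \<in> {Type_I, Type_II, Type_III}"
  by (cases t) auto

lemma sum_step_type_count:
  assumes "finite M"
  shows "(\<Sum>e\<in>M. step (snd e)) = (\<Sum>t\<in>{Type_I, Type_II, Type_III}. real (type_count M t) *\<^sub>R step t)"
proof -
  have "(\<Sum>e\<in>M. step (snd e)) = (\<Sum>t\<in>{Type_I, Type_II, Type_III}. \<Sum>e\<in>{e \<in> M. snd e = t}. step (snd e))"
    by (rule sum.group[symmetric]) (use assms edge_type_cases in auto)
  also have "\<dots> = (\<Sum>t\<in>{Type_I, Type_II, Type_III}. real (type_count M t) *\<^sub>R step t)"
  proof (rule sum.cong[OF refl])
    fix t
    have "(\<Sum>e\<in>{e \<in> M. snd e = t}. step (snd e)) = (\<Sum>e\<in>{e \<in> M. snd e = t}. step t)"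
      by (rule sum.cong) auto
    then show "(\<Sum>e\<in>{e \<in> M. snd e = t}. step (snd e)) = real (type_count M t) *\<^sub>R step t"
      by (simp only: sum_constant_scaleR type_count_def)
  qed
  finally show ?thesis .
qed

section \<open>The reference configuration\<close>

lemma periods_subset:
  assumes "3 dvd n" "z \<in> periods m n"
  shows "z \<in> periods 1 3"
proof -
  obtain a b where z: "z = latt (2 * int m * a) (int n * b - int m * a)" using assms(2) by (auto simp: periods_latt)
  obtain c where n: "n = 3 * c" using assms(1) by blast
  show ?thesis unfolding z periods_latt
    by (intro exI[of _ "int m * a"] exI[of _ "int c * b"]) (simp add: n)
qed

lemma reference_mem:
  assumes "3 dvd n" "v \<in> Lambda"
  shows "(proj m n v, t) \<in> reference R m n \<longleftrightarrow> (proj 1 3 v, t) \<in> R"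
proof
  assume "(proj m n v, t) \<in> reference R m n"
  then obtain w where "w \<in> Lambda" "proj m n v = proj m n w" "(proj 1 3 w, t) \<in> R" unfolding reference_def by blast
  moreover from this have "proj 1 3 v = proj 1 3 w" unfolding proj_eq_iff using periods_subset[OF assms(1)] by blast
  ultimately show "(proj 1 3 v, t) \<in> R" by simp
next
  show "(proj 1 3 v, t) \<in> R \<Longrightarrow> (proj m n v, t) \<in> reference R m n"
    unfolding reference_def using assms(2) by blast
qed

lemma reference_dimers:
  assumes R: "R \<in> dimers 1 3" and n: "3 dvd n"
  shows "reference R m n \<in> dimers m n"
proof -
  have "(\<exists>!t. (proj m n (v - dv t), t) \<in> reference R m n) \<longleftrightarrow> (\<exists>!t. (proj 1 3 (v - dv t), t) \<in> R)"
    if "v \<in> Lambda" for v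
    using reference_mem[OF n Lambda_diff[OF that dv_in_Lambda]] by simp
  then show ?thesis using R reference_mem[OF n] unfolding dimers_iff
    by (auto simp: reference_def edges_def white_def)
qed

text \<open>Translations act transitively on the cells of the small torus, so all fibres of the
  covering have the same size \<open>c\<close>. Its value is not computed: equality of the three
  counts is what makes the total displacement vanish.\<close>

lemma reference_type_count:
  assumes R: "\<And>t. card {e \<in> R. snd e = t} = 2" "R \<in> dimers 1 3" and m: "m > 0" and n: "n \<ge> 2" "3 dvd n"
  obtains c where "\<And>t. type_count (reference R m n) t = 2 * c"
proof -
  define fib where "fib Q = {proj m n v | v. v \<in> Lambda \<and> proj 1 3 v = Q}" for Q
  have fib_eq: "card (fib (proj 1 3 w)) = card (fib (proj 1 3 0))" if w: "w \<in> Lambda" for w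
  proof -
    have "fib (proj 1 3 w) = (\<lambda>P. (+) w ` P) ` fib (proj 1 3 0)"
    proof (intro equalityI subsetI)
      fix P assume "P \<in> fib (proj 1 3 w)"
      then obtain v where v: "v \<in> Lambda" "P = proj m n v" "proj 1 3 v = proj 1 3 w" by (auto simp: fib_def)
      have "proj 1 3 (v - w) = proj 1 3 0" using v(3) by (simp add: proj_eq_iff)
      moreover have "P = (+) w ` proj m n (v - w)" by (simp add: translate_proj v(2))
      ultimately show "P \<in> (\<lambda>P. (+) w ` P) ` fib (proj 1 3 0)"
        using Lambda_diff[OF v(1) w] unfolding fib_def by blast
    next
      fix P assume "P \<in> (\<lambda>P. (+) w ` P) ` fib (proj 1 3 0)"
      then obtain v where v: "v \<in> Lambda" "P = (+) w ` proj m n v" "proj 1 3 v = proj 1 3 0" by (auto simp: fib_def)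
      have "proj 1 3 (w + v) = proj 1 3 w" using v(3) by (simp add: proj_eq_iff)
      then show "P \<in> fib (proj 1 3 w)"
        unfolding v(2) translate_proj fib_def using Lambda_add[OF w v(1)] by blast
    qed
    moreover have "inj (\<lambda>P. (+) w ` P)"
      by (rule injI) (simp add: inj_image_eq_iff)
    ultimately show ?thesis by (simp add: card_image inj_on_subset)
  qed
  have fin_white: "finite (white m n)"
    using bij_betw_finite[OF bij_betw_cell[of m n]] m n by simp
  have fin_fib: "finite (fib Q)" for Q
    by (rule finite_subset[OF _ fin_white]) (auto simp: fib_def white_def)
  define c where "c = card (fib (proj 1 3 0))"
  have "type_count (reference R m n) t = 2 * c" for t
  proof -
    define T where "T = {Q. (Q, t) \<in> R}"
    have "{e \<in> R. snd e = t} = (\<lambda>Q. (Q, t)) ` T" by (auto simp: T_def)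
    then have cT: "card T = 2" using R(1)[of t] by (simp add: card_image inj_on_def)
    have TQ: "card (fib Q) = c" if "Q \<in> T" for Q
    proof -
      have "Q \<in> white 1 3" using that dimers_subset[OF R(2)] by (auto simp: T_def edges_def)
      then show ?thesis using fib_eq by (auto simp: white_def c_def)
    qed
    have "{e \<in> reference R m n. snd e = t} = (\<lambda>P. (P, t)) ` (\<Union>Q\<in>T. fib Q)"
    proof (intro equalityI subsetI)
      fix e assume "e \<in> {e \<in> reference R m n. snd e = t}"
      then obtain v where v: "e = (proj m n v, t)" "v \<in> Lambda" "(proj 1 3 v, t) \<in> R"
        unfolding reference_def by auto
      then have "proj m n v \<in> fib (proj 1 3 v)" "proj 1 3 v \<in> T" unfolding fib_def T_def by blast+
      then show "e \<in> (\<lambda>P. (P, t)) ` (\<Union>Q\<in>T. fib Q)" using v(1) by blast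
    next
      fix e assume "e \<in> (\<lambda>P. (P, t)) ` (\<Union>Q\<in>T. fib Q)"
      then obtain v where "e = (proj m n v, t)" "v \<in> Lambda" "(proj 1 3 v, t) \<in> R"
        unfolding T_def fib_def by blast
      moreover from this have "(proj m n v, t) \<in> reference R m n" unfolding reference_def by blast
      ultimately show "e \<in> {e \<in> reference R m n. snd e = t}" by simp
    qed
    then have "type_count (reference R m n) t = card (\<Union>Q\<in>T. fib Q)"
      by (simp add: type_count_def card_image inj_on_def)
    also have "\<dots> = (\<Sum>Q\<in>T. card (fib Q))"
    proof (rule card_UN_disjoint)
      show "finite T" using cT card.infinite by fastforce
      show "\<forall>Q\<in>T. \<forall>Q'\<in>T. Q \<noteq> Q' \<longrightarrow> fib Q \<inter> fib Q' = {}"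
      proof (intro ballI impI)
        fix Q Q' :: tpoint assume "Q \<noteq> Q'"
        have False if P: "P \<in> fib Q" "P \<in> fib Q'" for P
        proof -
          obtain v where v: "P = proj m n v" "proj 1 3 v = Q" using P(1) unfolding fib_def by blast
          obtain v' where v': "P = proj m n v'" "proj 1 3 v' = Q'" using P(2) unfolding fib_def by blast
          have "proj m n v = proj m n v'" using v v' by simp
          then have "v - v' \<in> periods 1 3" using periods_subset[OF n(2)] proj_eq_iff by blast
          then have "proj 1 3 v = proj 1 3 v'" by (subst proj_eq_iff)
          then show False using \<open>Q \<noteq> Q'\<close> v v' by simp
        qed
        then show "fib Q \<inter> fib Q' = {}" by blast
      qed
    qed (use fin_fib in auto)
    finally show ?thesis using TQ cT by simp
  qed
  then show ?thesis using that by blast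
qed

text \<open>The three steps sum to zero, so the reference has no displacement. A configuration with
  k paths has horizontal displacement 2m(n - k) - mk = 2mn - 3mk, to be divided by the period 3m;
  the vertical one is sqrt 3 n l, l times the vertical period.\<close>

lemma wind_reference:
  assumes m: "m > 0" and n: "n > 0" "3 dvd n"
    and R: "R \<in> dimers 1 3" "\<And>t. card {e \<in> R. snd e = t} = 2" and M: "M \<in> dimers m n"
  shows "wind m n (reference R m n) M = (2 * int (n div 3) - int (path_count m M), path_turns n M)"
proof -
  have n2: "n \<ge> 2" using n by (auto elim: dvdE)
  obtain c where c: "\<And>t. type_count (reference R m n) t = 2 * c"
    using reference_type_count[OF R(2,1) m n2 n(2)] by metis
  have ref: "reference R m n \<in> dimers m n" using reference_dimers[OF R(1) n(2)] .
  note fin = finite_dimers(2)[OF m n2 M] finite_dimers(2)[OF m n2 ref]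
  have "(\<Sum>e\<in>reference R m n. step (snd e)) = 0"
    unfolding sum_step_type_count[OF fin(2)] c by (simp add: zero_prod_def algebra_simps)
  moreover have "(\<Sum>e\<in>M. step (snd e)) = (real (type_count M Type_I) - (real (type_count M Type_II) + real (type_count M Type_III)) / 2,
      sqrt 3 / 2 * (real (type_count M Type_II) - real (type_count M Type_III)))"
    unfolding sum_step_type_count[OF fin(1)] by (simp add: algebra_simps add_divide_distrib)
  moreover note st = dimers_path_statistics[OF m n2 M]
  have "real (type_count M Type_I) = 2 * real m * (real n - real (path_count m M))"
    unfolding st(2) using st(1) by (simp add: of_nat_diff)
  moreover have "real (type_count M Type_II) = real m * real (path_count m M) + real n * of_int (path_turns n M)"
    using arg_cong[OF st(3), of real_of_int] by simp
  moreover have "real (type_count M Type_III) = real m * real (path_count m M) - real n * of_int (path_turns n M)"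
    using arg_cong[OF st(4), of real_of_int] by simp
  ultimately have tot: "(\<Sum>e\<in>M. step (snd e)) - (\<Sum>e\<in>reference R m n. step (snd e))
     = (2 * real m * real n - 3 * real m * real (path_count m M), sqrt 3 * real n * of_int (path_turns n M))"
    by (simp add: algebra_simps)
  obtain q where q: "n = 3 * q" using n(2) by blast
  note w = wind_displacement[OF m n(1) M fin(1) ref fin(2), unfolded tot]
  have "real_of_int (fst (wind m n (reference R m n) M)) = of_int (2 * int (n div 3) - int (path_count m M))"
    unfolding w(1) coord_h_def using m by (simp add: q field_simps)
  moreover have "real_of_int (snd (wind m n (reference R m n) M)) = of_int (path_turns n M)"
    unfolding w(2) coord_v_def using n(1) by simp
  ultimately show ?thesis unfolding of_int_eq_iff by (metis prod.collapse)
qed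

section \<open>Limits of products and series\<close>

text \<open>Tannery's theorem for products with a growing number of factors: truncation at a fixed N
  costs little uniformly, and the truncated product converges factor by factor.\<close>

lemma prod_tendsto_dominated:
  fixes f :: "nat \<Rightarrow> nat \<Rightarrow> complex" and M :: "nat \<Rightarrow> real"
  assumes M: "summable M" "\<And>i. M i \<ge> 0"
    and f: "\<And>i. (\<lambda>n. f n i) \<longlonglongrightarrow> g i" "\<forall>\<^sub>F n in sequentially. \<forall>i<K n. norm (f n i) \<le> M i"
    and K: "filterlim K at_top sequentially"
    and P: "(\<lambda>N. \<Prod>i<N. 1 + g i) \<longlonglongrightarrow> P"
  shows "(\<lambda>n. \<Prod>i<K n. 1 + f n i) \<longlonglongrightarrow> P"
proof -
  define S where "S = suminf M"
  \<comment> \<open>\<open>B N\<close> bounds the truncation error: exp S bounds the head, and exp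
    of the tail sum minus 1 bounds the deviation of the tail from 1.\<close>
  define B where "B N = exp S * (exp (S - (\<Sum>i<N. M i)) - 1)" for N
  have le: "(\<Sum>i\<in>I. M i) \<le> S" if "finite I" for I
    unfolding S_def by (rule sum_le_suminf[OF M(1) that]) (use M in auto)
  have diff: "norm ((\<Prod>i<k. 1 + x i) - (\<Prod>i<N. 1 + x i)) \<le> B N"
    if x: "\<forall>i<k. norm (x i) \<le> M i" and "N \<le> k" for x :: "nat \<Rightarrow> complex" and N k
  proof -
    have e1: "(\<Prod>i\<in>I. 1 + norm (x i)) \<le> exp (\<Sum>i\<in>I. M i)" if "I \<subseteq> {..<k}" for I
    proof -
      have fin: "finite I" using that finite_subset by blast
      have "(\<Prod>i\<in>I. 1 + norm (x i)) \<le> (\<Prod>i\<in>I. exp (M i))"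
      proof (rule prod_mono)
        fix i assume "i \<in> I"
        then have "norm (x i) \<le> M i" using x that by auto
        then show "0 \<le> 1 + norm (x i) \<and> 1 + norm (x i) \<le> exp (M i)"
          using exp_ge_add_one_self[of "M i"] by (smt (verit) norm_ge_zero)
      qed
      then show ?thesis by (simp add: exp_sum[OF fin])
    qed
    have "(\<Sum>i\<in>{..<N} \<union> {N..<k}. M i) = (\<Sum>i<N. M i) + (\<Sum>i\<in>{N..<k}. M i)"
      by (rule sum.union_disjoint) auto
    then have tail: "(\<Sum>i\<in>{N..<k}. M i) \<le> S - (\<Sum>i<N. M i)"
      using le[of "{..<N} \<union> {N..<k}"] by simp
    have ivl_subset': "{N..<k} \<subseteq> {..<k}" by auto
    have "{..<k} = {..<N} \<union> {N..<k}" using \<open>N \<le> k\<close> by auto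
    then have "(\<Prod>i<k. 1 + x i) = (\<Prod>i<N. 1 + x i) * (\<Prod>i\<in>{N..<k}. 1 + x i)"
      by (metis (no_types, lifting) finite_atLeastLessThan finite_lessThan ivl_disj_int_one(2) prod.union_disjoint)
    then have "(\<Prod>i<k. 1 + x i) - (\<Prod>i<N. 1 + x i) = (\<Prod>i<N. 1 + x i) * ((\<Prod>i\<in>{N..<k}. 1 + x i) - 1)"
      by (simp add: algebra_simps)
    then have "norm ((\<Prod>i<k. 1 + x i) - (\<Prod>i<N. 1 + x i)) = norm (\<Prod>i<N. 1 + x i) * norm ((\<Prod>i\<in>{N..<k}. 1 + x i) - 1)"
      by (simp add: norm_mult)
    also have "\<dots> \<le> exp S * (exp (S - (\<Sum>i<N. M i)) - 1)"
    proof (rule mult_mono)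
      have "norm (\<Prod>i<N. 1 + x i) = (\<Prod>i<N. norm (1 + x i))" by (simp add: prod_norm)
      also have "\<dots> \<le> (\<Prod>i<N. 1 + norm (x i))"
        by (rule prod_mono) (use norm_triangle_ineq[of "1::complex"] in simp)
      also have "\<dots> \<le> exp (\<Sum>i<N. M i)" using e1[of "{..<N}"] \<open>N \<le> k\<close> by auto
      also have "\<dots> \<le> exp S" using le by simp
      finally show "norm (\<Prod>i<N. 1 + x i) \<le> exp S" .
      have "norm ((\<Prod>i\<in>{N..<k}. 1 + x i) - 1) \<le> (\<Prod>i\<in>{N..<k}. 1 + norm (x i)) - 1"
        by (rule norm_prod_minus1_le_prod_minus1)
      also have "\<dots> \<le> exp (\<Sum>i\<in>{N..<k}. M i) - 1" using e1[OF ivl_subset'] by simp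
      also have "\<dots> \<le> exp (S - (\<Sum>i<N. M i)) - 1" using tail by simp
      finally show "norm ((\<Prod>i\<in>{N..<k}. 1 + x i) - 1) \<le> exp (S - (\<Sum>i<N. M i)) - 1" .
    qed auto
    finally show ?thesis unfolding B_def .
  qed
  have "(\<lambda>N. exp S * (exp (S - (\<Sum>i<N. M i)) - 1)) \<longlonglongrightarrow> exp S * (exp (S - S) - 1)"
    unfolding S_def by (intro tendsto_intros summable_LIMSEQ M)
  then have B: "B \<longlonglongrightarrow> 0" unfolding B_def by simp
  show ?thesis
  proof (rule tendstoI)
    fix e :: real assume "e > 0"
    then have e: "e / 3 > 0" by simp
    have "\<forall>\<^sub>F N in sequentially. dist (B N) 0 < e / 3 \<and> dist (\<Prod>i<N. 1 + g i) P < e / 3"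
      using tendstoD[OF B e] tendstoD[OF P e] by eventually_elim auto
    then obtain N where N: "dist (B N) 0 < e / 3" "dist (\<Prod>i<N. 1 + g i) P < e / 3"
      unfolding eventually_sequentially by blast
    have "(\<lambda>n. \<Prod>i<N. 1 + f n i) \<longlonglongrightarrow> (\<Prod>i<N. 1 + g i)" by (intro tendsto_intros f)
    then have "\<forall>\<^sub>F n in sequentially. dist (\<Prod>i<N. 1 + f n i) (\<Prod>i<N. 1 + g i) < e / 3" using e tendstoD by blast
    moreover have "\<forall>\<^sub>F n in sequentially. K n \<ge> N" using K by (simp add: filterlim_at_top)
    ultimately show "\<forall>\<^sub>F n in sequentially. dist (\<Prod>i<K n. 1 + f n i) P < e"
      using f(2)
    proof eventually_elim
      case (elim n)
      have "dist (\<Prod>i<K n. 1 + f n i) (\<Prod>i<N. 1 + f n i) < e / 3"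
        using diff[OF elim(3,2)] N(1) by (simp add: dist_norm)
      then show ?case using elim(1) N(2)
        using dist_triangle[of "\<Prod>i<K n. 1 + f n i" "\<Prod>i<N. 1 + g i" "\<Prod>i<N. 1 + f n i"]
          dist_triangle[of "\<Prod>i<K n. 1 + f n i" P "\<Prod>i<N. 1 + g i"] by linarith
    qed
  qed
qed

text \<open>The M-test gives convergence of the partial sums uniformly in the index
  \<open>n\<close>, which permits exchanging the two limits.\<close>

lemma has_sum_tendsto_dominated:
  fixes f :: "nat \<Rightarrow> 'a \<Rightarrow> complex" and M :: "'a \<Rightarrow> real"
  assumes M: "M summable_on A" and le: "\<And>n x. x \<in> A \<Longrightarrow> norm (f n x) \<le> M x"
    and f: "\<And>x. x \<in> A \<Longrightarrow> (\<lambda>n. f n x) \<longlonglongrightarrow> g x"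
    and T: "\<And>n. (f n has_sum T n) A"
  shows "(g has_sum infsum g A) A" "T \<longlonglongrightarrow> infsum g A"
proof -
  have leg: "norm (g x) \<le> M x" if "x \<in> A" for x
    by (rule tendsto_upperbound[OF tendsto_norm[OF f[OF that]]]) (use le[OF that] in auto)
  have "(\<lambda>x. norm (g x)) summable_on A" by (rule summable_on_comparison_test[OF M]) (use leg in auto)
  then show g: "(g has_sum infsum g A) A"
    using abs_summable_summable has_sum_infsum by blast
  have u: "uniform_limit UNIV (\<lambda>X n. \<Sum>x\<in>X. f n x) T (finite_subsets_at_top A)"
    by (rule Weierstrass_m_test_general'[OF _ _ M]) (use le T in auto)
  show "T \<longlonglongrightarrow> infsum g A"
  proof (rule swap_uniform_limit'[where f = "\<lambda>X n. \<Sum>x\<in>X. f n x" and g = "\<lambda>X. \<Sum>x\<in>X. g x" and S = UNIV])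
    show "\<forall>\<^sub>F X in finite_subsets_at_top A. ((\<lambda>n. \<Sum>x\<in>X. f n x) \<longlongrightarrow> (\<Sum>x\<in>X. g x)) sequentially"
      by (rule eventually_finite_subsets_at_top_weakI) (auto intro!: tendsto_sum f)
    show "((\<lambda>X. \<Sum>x\<in>X. g x) \<longlongrightarrow> infsum g A) (finite_subsets_at_top A)" using g by (simp add: has_sum_def)
    show "\<forall>\<^sub>F i in sequentially. i \<in> UNIV" by simp
  qed (use u in auto)
qed

section \<open>The Jacobi triple product\<close>

text \<open>The q-Pochhammer symbol (q; q)_n.\<close>

definition qfact :: "real \<Rightarrow> nat \<Rightarrow> real" where
  "qfact q n = (\<Prod>i<n. 1 - q ^ Suc i)"

lemma qfact_Suc: "qfact q (Suc n) = (1 - q ^ Suc n) * qfact q n"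
  by (simp add: qfact_def)

lemma qfact_pos: "0 < q \<Longrightarrow> q < 1 \<Longrightarrow> qfact q n > 0"
  unfolding qfact_def by (intro prod_pos) (simp add: power_Suc_less_one del: power_Suc)

definition qbinomial :: "real \<Rightarrow> nat \<Rightarrow> nat \<Rightarrow> real" where
  "qbinomial q n k = (if k \<le> n then qfact q n / (qfact q k * qfact q (n - k)) else 0)"

lemma qbinomial_0: "0 < q \<Longrightarrow> q < 1 \<Longrightarrow> qbinomial q n 0 = 1"
  using qfact_pos[of q n] by (simp add: qbinomial_def qfact_def[of q 0])

text \<open>The q-Pascal rule; over the common denominator it is the identity 1 - q^(d + k + 2) = (1
  - q^(d + 1)) + q^(d + 1) (1 - q^(k + 1)), where n = k + d + 1.\<close>

lemma qbinomial_Suc: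
  assumes q: "0 < q" "q < 1" and k: "k \<le> n"
  shows "qbinomial q (Suc n) (Suc k) = qbinomial q n (Suc k) + q ^ (n - k) * qbinomial q n k"
proof (cases "k = n")
  case True
  then show ?thesis using qfact_pos[OF q] by (simp add: qbinomial_def less_imp_neq[symmetric] qfact_def[of q 0])
next
  case False
  then obtain d where d: "n = k + Suc d" using k less_imp_Suc_add[of k n] by auto
  have nz: "qfact q j \<noteq> 0" "1 - q ^ Suc j \<noteq> 0" for j
    using qfact_pos[OF q, of j] qfact_pos[OF q, of "Suc j"] unfolding qfact_Suc[of q j] by auto
  have e: "qfact q (Suc n) = (1 - q ^ (Suc d + Suc k)) * qfact q n"
    by (simp add: qfact_Suc d add_ac)
  have "qbinomial q (Suc n) (Suc k) = qfact q (Suc n) / (qfact q (Suc k) * qfact q (Suc d))"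
    using d by (simp add: qbinomial_def)
  moreover have "qbinomial q n (Suc k) = qfact q n * (1 - q ^ Suc d) / (qfact q (Suc k) * qfact q (Suc d))"
    using d nz[of d] by (simp add: qbinomial_def qfact_Suc[of q d])
  moreover have "qbinomial q n k = qfact q n * (1 - q ^ Suc k) / (qfact q (Suc k) * qfact q (Suc d))"
    using d nz[of k] by (simp add: qbinomial_def qfact_Suc[of q k])
  moreover have "q ^ (n - k) = q ^ Suc d" using d by simp
  ultimately show ?thesis
    unfolding e by (simp only: times_divide_eq_right add_divide_distrib[symmetric])
      (rule arg_cong2[where f = "(/)"], simp_all add: power_add algebra_simps)
qed

text \<open>Induction with the q-Pascal rule; the exponents match because (k + 1 choose 2) + (n - k)
  = n + (k choose 2).\<close>

lemma qbinomial_theorem: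
  fixes x :: complex
  assumes q: "0 < q" "q < 1"
  shows "(\<Prod>i<n. 1 + x * of_real q ^ i) = (\<Sum>k\<le>n. of_real (q ^ (k choose 2) * qbinomial q n k) * x ^ k)"
proof (induction n)
  case 0
  show ?case using qbinomial_0[OF q] by (simp add: numeral_2_eq_2)
next
  case (Suc n)
  define a where "a n k = of_real (q ^ (k choose 2) * qbinomial q n k) * x ^ k" for n k
  have step: "a (Suc n) (Suc k) = a n (Suc k) + x * of_real q ^ n * a n k" if "k \<le> n" for k
  proof -
    have "q ^ (Suc k choose 2) * q ^ (n - k) = q ^ n * q ^ (k choose 2)"
      using that by (simp add: power_add[symmetric] numeral_2_eq_2 add.commute)
    then have "of_real (q ^ (Suc k choose 2)) * of_real (q ^ (n - k)) = (of_real q ^ n * of_real (q ^ (k choose 2)) :: complex)"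
      by (metis of_real_mult of_real_power)
    then show ?thesis unfolding a_def qbinomial_Suc[OF q that]
      by (simp add: algebra_simps)
  qed
  have "a n (Suc n) = 0" by (simp add: a_def qbinomial_def)
  have a0: "a (Suc n) 0 = a n 0" by (simp add: a_def qbinomial_0[OF q])
  have "(\<Sum>k\<le>Suc n. a (Suc n) k) = a (Suc n) 0 + (\<Sum>k\<le>n. a (Suc n) (Suc k))" by (rule sum.atMost_Suc_shift)
  also have "\<dots> = a n 0 + (\<Sum>k\<le>n. a n (Suc k) + x * of_real q ^ n * a n k)" using step a0 by simp
  also have "\<dots> = (a n 0 + (\<Sum>k\<le>n. a n (Suc k))) + x * of_real q ^ n * (\<Sum>k\<le>n. a n k)"
    by (simp add: sum.distrib sum_distrib_left)
  also have "a n 0 + (\<Sum>k\<le>n. a n (Suc k)) = (\<Sum>k\<le>Suc n. a n k)" by (rule sum.atMost_Suc_shift[symmetric])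
  also have "\<dots> = (\<Sum>k\<le>n. a n k)" using \<open>a n (Suc n) = 0\<close> by simp
  finally have "(\<Sum>k\<le>Suc n. a (Suc n) k) = (1 + x * of_real q ^ n) * (\<Sum>k\<le>n. a n k)" by (simp add: algebra_simps)
  then show ?case using Suc.IH unfolding a_def by simp
qed

text \<open>The q-binomial theorem with q = r^2 and 2N factors, centred by the choice of
  \<open>x\<close>: the upper N factors are those with w, and the lower N become those with 1/w
  after their leading terms are pulled out.\<close>

lemma finite_triple_product:
  fixes w :: complex
  assumes r: "0 < r" "r < 1" and w: "w \<noteq> 0"
  shows "(\<Prod>i<N. (1 + w * of_real (r ^ (2 * i + 1))) * (1 + of_real (r ^ (2 * i + 1)) / w))
    = (\<Sum>c\<in>{- int N..int N}. of_real (qbinomial (r\<^sup>2) (2 * N) (nat (int N + c)) * r ^ (nat \<bar>c\<bar>)\<^sup>2) * w powi c)"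
proof -
  have q: "0 < r\<^sup>2" "r\<^sup>2 < 1" using r by (auto simp: power_less_one_iff)
  have rC: "of_real r \<noteq> (0::complex)" using r by simp
  define R where "R = (of_real r :: complex)"
  have R0: "R \<noteq> 0" using rC by (simp add: R_def)
  \<comment> \<open>This starts the 2N odd exponents at 1 - 2N, so that they lie symmetrically
    around 0.\<close>
  define x where "x = w * R powi (1 - 2 * int N)"
  have low: "(\<Prod>i<N. 1 + x * (R\<^sup>2) ^ i) = w ^ N * R powi (- (int N)\<^sup>2) * (\<Prod>i<N. 1 + R ^ (2 * i + 1) / w)"
  proof -
    have "(\<Prod>i<N. 1 + x * (R\<^sup>2) ^ i) = (\<Prod>i<N. 1 + x * (R\<^sup>2) ^ (N - Suc i))"
      by (rule prod.nat_diff_reindex[symmetric])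
    also have "\<dots> = (\<Prod>i<N. (w * R powi (- (2 * int i + 1))) * (1 + R ^ (2 * i + 1) / w))"
    proof (rule prod.cong[OF refl])
      fix i assume "i \<in> {..<N}"
      then have i: "int (N - Suc i) = int N - int i - 1" by auto
      have "(R\<^sup>2) ^ (N - Suc i) = R powi (2 * int (N - Suc i))"
        by (simp add: power_mult[symmetric] power_int_def nat_mult_distrib)
      then have "x * (R\<^sup>2) ^ (N - Suc i) = w * (R powi (1 - 2 * int N) * R powi (2 * int (N - Suc i)))"
        by (simp add: x_def)
      also have "\<dots> = w * R powi (1 - 2 * int N + 2 * int (N - Suc i))"
        using R0 by (subst power_int_add) (auto simp: mult_ac)
      also have "1 - 2 * int N + 2 * int (N - Suc i) = - (2 * int i + 1)" using i by simp
      finally have A: "x * (R\<^sup>2) ^ (N - Suc i) = w * R powi (- (2 * int i + 1))" .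
      have "R powi (- (2 * int i + 1)) = inverse (R ^ (2 * i + 1))"
        unfolding power_int_minus by (simp add: power_int_def nat_add_distrib nat_mult_distrib)
      then show "1 + x * (R\<^sup>2) ^ (N - Suc i) = (w * R powi (- (2 * int i + 1))) * (1 + R ^ (2 * i + 1) / w)"
        unfolding A using w R0 by (simp add: field_simps)
    qed
    also have "\<dots> = w ^ N * (\<Prod>i<N. R powi (- (2 * int i + 1))) * (\<Prod>i<N. 1 + R ^ (2 * i + 1) / w)"
      by (simp add: prod.distrib)
    also have "(\<Prod>i<N. R powi (- (2 * int i + 1))) = R powi (- (int N)\<^sup>2)"
    proof (induction N)
      case (Suc N)
      have "- (int (Suc N))\<^sup>2 = - (int N)\<^sup>2 + - (2 * int N + 1)" by (simp add: power2_eq_square algebra_simps)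
      then have "R powi (- (int (Suc N))\<^sup>2) = R powi (- (int N)\<^sup>2) * R powi (- (2 * int N + 1))"
        using R0 by (metis power_int_add)
      then show ?case using Suc by simp
    qed simp
    finally show ?thesis .
  qed
  have high: "(\<Prod>i<N. 1 + x * (R\<^sup>2) ^ (N + i)) = (\<Prod>i<N. 1 + w * R ^ (2 * i + 1))"
  proof (rule prod.cong[OF refl])
    fix i
    have "(R\<^sup>2) ^ (N + i) = R powi (2 * int (N + i))"
      by (simp add: power_mult[symmetric] power_int_def nat_mult_distrib nat_add_distrib)
    then have "x * (R\<^sup>2) ^ (N + i) = w * (R powi (1 - 2 * int N) * R powi (2 * int (N + i)))"
      by (simp add: x_def)
    also have "\<dots> = w * R powi (1 - 2 * int N + 2 * int (N + i))"
      using R0 by (subst power_int_add) (auto simp: mult_ac)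
    also have "1 - 2 * int N + 2 * int (N + i) = int (2 * i + 1)" by simp
    finally show "1 + x * (R\<^sup>2) ^ (N + i) = 1 + w * R ^ (2 * i + 1)" by (simp only: power_int_of_nat)
  qed
  have cancel: "X * Y = (inverse a * b) * ((a * inverse b * Y) * X)" if "a \<noteq> 0" "b \<noteq> 0" for X Y a b :: complex
    using that by (simp add: field_simps)
  have split: "(\<Prod>i<N + k. f i) = (\<Prod>i<N. f i) * (\<Prod>i<k. f (N + i))" for f :: "nat \<Rightarrow> complex" and k
    by (induction k) (simp_all add: mult_ac)
  have "(\<Prod>i<N. (1 + w * R ^ (2 * i + 1)) * (1 + R ^ (2 * i + 1) / w))
     = (\<Prod>i<N. 1 + w * R ^ (2 * i + 1)) * (\<Prod>i<N. 1 + R ^ (2 * i + 1) / w)" by (rule prod.distrib)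
  also have "\<dots> = (inverse (w ^ N) * R powi (int N)\<^sup>2) * ((\<Prod>i<N. 1 + x * (R\<^sup>2) ^ i) * (\<Prod>i<N. 1 + x * (R\<^sup>2) ^ (N + i)))"
    unfolding low high power_int_minus
    by (rule cancel) (use w R0 in auto)
  also have "(\<Prod>i<N. 1 + x * (R\<^sup>2) ^ i) * (\<Prod>i<N. 1 + x * (R\<^sup>2) ^ (N + i)) = (\<Prod>i<2 * N. 1 + x * (R\<^sup>2) ^ i)"
    using split[of "\<lambda>i. 1 + x * (R\<^sup>2) ^ i" N] by (simp add: mult_2)
  also have "\<dots> = (\<Sum>k\<le>2 * N. of_real ((r\<^sup>2) ^ (k choose 2) * qbinomial (r\<^sup>2) (2 * N) k) * x ^ k)"
    using qbinomial_theorem[OF q, of x "2 * N"] by (simp add: R_def)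
  also have "(inverse (w ^ N) * R powi (int N)\<^sup>2) * \<dots>
     = (\<Sum>k\<le>2 * N. of_real (qbinomial (r\<^sup>2) (2 * N) k) * (R powi (int k - int N)\<^sup>2 * w powi (int k - int N)))"
    unfolding sum_distrib_left
  proof (rule sum.cong[OF refl])
    fix k :: nat
    have "even (k * (k - 1))" by (cases k) auto
    then have "2 * (k choose 2) = k * (k - 1)" unfolding choose_two by (rule dvd_mult_div_cancel)
    then have "(R\<^sup>2) ^ (k choose 2) = R ^ (k * (k - 1))" by (simp add: power_mult[symmetric])
    also have "\<dots> = R powi (int k * (int k - 1))"
    proof -
      have "int k * (int k - 1) = int (k * (k - 1))" by (cases k) (simp_all add: algebra_simps)
      then show ?thesis by (simp only: power_int_of_nat)
    qed
    finally have c2: "(R\<^sup>2) ^ (k choose 2) = R powi (int k * (int k - 1))" .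
    have xk: "x ^ k = w ^ k * R powi ((1 - 2 * int N) * int k)"
      unfolding x_def power_mult_distrib by (simp add: power_int_mult)
    have "R powi (int N)\<^sup>2 * R powi (int k * (int k - 1)) * R powi ((1 - 2 * int N) * int k)
       = R powi ((int N)\<^sup>2 + int k * (int k - 1) + (1 - 2 * int N) * int k)"
      using R0 by (simp only: power_int_add simp_thms)
    \<comment> \<open>The exponents from the prefactor, from \<open>k choose 2\<close> and from
      \<open>x ^ k\<close> complete to a square, the source of the theta series.\<close>
    also have "(int N)\<^sup>2 + int k * (int k - 1) + (1 - 2 * int N) * int k = (int k - int N)\<^sup>2"
      by (simp add: power2_eq_square algebra_simps)
    finally have RR: "R powi (int N)\<^sup>2 * R powi (int k * (int k - 1)) * R powi ((1 - 2 * int N) * int k) = R powi (int k - int N)\<^sup>2" .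
    have ww: "inverse (w ^ N) * w ^ k = w powi (int k - int N)"
      using w by (simp add: power_int_diff divide_inverse mult.commute)
    have "inverse (w ^ N) * R powi (int N)\<^sup>2 * (of_real ((r\<^sup>2) ^ (k choose 2) * qbinomial (r\<^sup>2) (2 * N) k) * x ^ k)
       = of_real (qbinomial (r\<^sup>2) (2 * N) k) * ((R powi (int N)\<^sup>2 * (R\<^sup>2) ^ (k choose 2) * R powi ((1 - 2 * int N) * int k)) * (inverse (w ^ N) * w ^ k))"
      unfolding xk R_def of_real_mult of_real_power by (simp only: mult_ac)
    then show "inverse (w ^ N) * R powi (int N)\<^sup>2 * (of_real ((r\<^sup>2) ^ (k choose 2) * qbinomial (r\<^sup>2) (2 * N) k) * x ^ k)
       = of_real (qbinomial (r\<^sup>2) (2 * N) k) * (R powi (int k - int N)\<^sup>2 * w powi (int k - int N))"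
      unfolding c2 RR ww .
  qed
  also have "\<dots> = (\<Sum>c\<in>{- int N..int N}. of_real (qbinomial (r\<^sup>2) (2 * N) (nat (int N + c)) * r ^ (nat \<bar>c\<bar>)\<^sup>2) * w powi c)"
  proof (rule sum.reindex_bij_witness[of _ "\<lambda>c. nat (int N + c)" "\<lambda>k. int k - int N"])
    fix k assume "k \<in> {..2 * N}"
    have "(int k - int N)\<^sup>2 = int ((nat \<bar>int k - int N\<bar>)\<^sup>2)" by simp
    then have "R powi (int k - int N)\<^sup>2 = of_real (r ^ (nat \<bar>int k - int N\<bar>)\<^sup>2)"
      unfolding R_def by (simp only: power_int_of_nat of_real_power)
    then show "of_real (qbinomial (r\<^sup>2) (2 * N) (nat (int N + (int k - int N))) * r ^ (nat \<bar>int k - int N\<bar>)\<^sup>2) * w powi (int k - int N)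
      = of_real (qbinomial (r\<^sup>2) (2 * N) k) * (R powi (int k - int N)\<^sup>2 * w powi (int k - int N))"
      by simp
  qed auto
  finally show ?thesis by (simp only: R_def of_real_power)
qed

lemma summable_on_int_abs:
  fixes g :: "nat \<Rightarrow> real"
  assumes g: "summable g" "\<And>n. g n \<ge> 0"
  shows "(\<lambda>c::int. g (nat \<bar>c\<bar>)) summable_on UNIV"
proof -
  have "g summable_on UNIV" using g by (simp add: summable_on_UNIV_nonneg_real_iff)
  then have "(\<lambda>c. g (nat \<bar>c\<bar>)) summable_on range int" "(\<lambda>c. g (nat \<bar>c\<bar>)) summable_on range (\<lambda>n. - int n)"
    by (subst summable_on_reindex; simp add: o_def inj_def)+
  then have "(\<lambda>c. g (nat \<bar>c\<bar>)) summable_on (range int \<union> range (\<lambda>n. - int n))" by (rule summable_on_union)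
  moreover have "range int \<union> range (\<lambda>n. - int n) = UNIV" by (auto simp: image_iff) (metis int_cases2)
  ultimately show ?thesis by simp
qed

text \<open>The term is (r^n A)^n, eventually below 2^(-n). It is the common majorant for theta
  series and for translates of Gaussians.\<close>

lemma theta_majorant_summable:
  fixes r A :: real
  assumes r: "0 < r" "r < 1" and A: "A \<ge> 0"
  shows "(\<lambda>c::int. r ^ (nat \<bar>c\<bar>)\<^sup>2 * A ^ nat \<bar>c\<bar>) summable_on UNIV"
proof (rule summable_on_int_abs)
  have "(\<lambda>n. r ^ n * A) \<longlonglongrightarrow> 0 * A" by (intro tendsto_intros LIMSEQ_power_zero) (use r in auto)
  then have "\<forall>\<^sub>F n in sequentially. r ^ n * A < 1 / 2" by (rule order_tendstoD) simp
  then have "\<forall>\<^sub>F n in sequentially. norm (r ^ n\<^sup>2 * A ^ n) \<le> (1 / 2) ^ n"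
  proof eventually_elim
    case (elim n)
    have "r ^ n\<^sup>2 * A ^ n = (r ^ n * A) ^ n" by (simp add: power_mult_distrib power2_eq_square power_mult)
    also have "\<dots> \<le> (1 / 2) ^ n" using elim r A by (intro power_mono) auto
    finally show ?case using r A by simp
  qed
  then show "summable (\<lambda>n. r ^ n\<^sup>2 * A ^ n)"
    by (rule summable_comparison_test_ev) (simp add: summable_geometric)
qed (use r A in auto)

lemma norm_power_int_le:
  fixes w :: complex
  shows "norm (w powi c) \<le> max (norm w) (1 / norm w) ^ nat \<bar>c\<bar>"
proof (cases "c \<ge> 0")
  case True
  then have "norm (w powi c) = norm w ^ nat \<bar>c\<bar>" by (simp add: power_int_def norm_power)
  then show ?thesis by (simp add: power_mono)
next
  case False
  then have "norm (w powi c) = (1 / norm w) ^ nat \<bar>c\<bar>"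
    by (simp add: power_int_def norm_power norm_inverse norm_divide inverse_eq_divide power_one_over)
  then show ?thesis by (simp add: power_mono)
qed

text \<open>The Jacobi theta function with nome \<open>r\<close> in its multiplicative
  variable.\<close>

definition theta :: "real \<Rightarrow> complex \<Rightarrow> complex" where
  "theta r w = (\<Sum>\<^sub>\<infinity>c. of_real (r ^ (nat \<bar>c\<bar>)\<^sup>2) * w powi c)"

lemma theta_abs_summable:
  fixes w :: complex
  assumes r: "0 < r" "r < 1"
  shows "(\<lambda>c. norm (of_real (r ^ (nat \<bar>c\<bar>)\<^sup>2) * w powi c)) summable_on UNIV"
proof (rule summable_on_comparison_test[OF theta_majorant_summable[OF r]])
  show "norm (of_real (r ^ (nat \<bar>c\<bar>)\<^sup>2) * w powi c) \<le> r ^ (nat \<bar>c\<bar>)\<^sup>2 * max (norm w) (1 / norm w) ^ nat \<bar>c\<bar>" for c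
    unfolding norm_mult using r norm_power_int_le[of w c] by (intro mult_mono) (auto simp: norm_power)
qed (auto simp: max_def)

text \<open>The positive lower bound \<open>Q\<close> holds for all n because the sequence
  decreases; it bounds all q-binomials at once by 1/Q^2.\<close>

lemma qfact_limit:
  assumes q: "0 < q" "q < 1"
  obtains Q where "Q > 0" "qfact q \<longlonglongrightarrow> Q" "\<And>n. Q \<le> qfact q n"
proof -
  define f where "f i = 1 - q ^ Suc i" for i
  have "summable (\<lambda>i. norm (f i - 1))"
    using q summable_mult[OF summable_geometric[of q], of q] by (simp add: f_def)
  then have cp: "convergent_prod f"
    by (intro abs_convergent_prod_imp_convergent_prod summable_imp_abs_convergent_prod)
  have fpos: "f i > 0" for i using q by (simp add: f_def power_Suc_less_one del: power_Suc)
  define Q where "Q = prodinf f"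
  have lim: "qfact q \<longlonglongrightarrow> Q"
    using convergent_prod_LIMSEQ[OF cp] unfolding Q_def LIMSEQ_lessThan_iff_atMost[symmetric] qfact_def f_def .
  have "Q \<noteq> 0" unfolding Q_def by (rule prodinf_nonzero[OF cp]) (use fpos in \<open>simp add: less_imp_neq[symmetric]\<close>)
  moreover have "Q \<ge> 0" by (rule LIMSEQ_le_const[OF lim]) (use qfact_pos[OF q] less_imp_le in blast)
  moreover have "decseq (qfact q)"
  proof (rule decseq_SucI)
    show "qfact q (Suc n) \<le> qfact q n" for n
      unfolding qfact_Suc using qfact_pos[OF q, of n] q by (intro mult_left_le_one_le) (auto simp: power_le_one simp del: power_Suc)
  qed
  ultimately show ?thesis using that[of Q] lim decseq_ge[OF _ lim] by force
qed

text \<open>Passing to the limit in the finite identity: each central q-binomial tends to Q/(Q Q).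
  The factor is only recorded as positive, since it cancels against the normalization.\<close>

lemma triple_product:
  assumes r: "0 < r" "r < 1"
  obtains Q :: real where "Q > 0" "\<And>w. w \<noteq> 0 \<Longrightarrow>
    (\<lambda>N. \<Prod>i<N. (1 + w * of_real (r ^ (2 * i + 1))) * (1 + of_real (r ^ (2 * i + 1)) / w)) \<longlonglongrightarrow> of_real Q * theta r w"
proof -
  have q: "0 < r\<^sup>2" "r\<^sup>2 < 1" using r by (auto simp: power_less_one_iff)
  obtain Q where Q: "Q > 0" "qfact (r\<^sup>2) \<longlonglongrightarrow> Q" "\<And>n. Q \<le> qfact (r\<^sup>2) n" using qfact_limit[OF q] by blast
  have le1: "qfact (r\<^sup>2) n \<le> 1" for n
    unfolding qfact_def using q by (intro prod_le_1) (auto simp: power_le_one simp del: power_Suc)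
  have "(\<lambda>N. \<Prod>i<N. (1 + w * of_real (r ^ (2 * i + 1))) * (1 + of_real (r ^ (2 * i + 1)) / w)) \<longlonglongrightarrow> of_real (1 / Q) * theta r w"
    if w: "w \<noteq> 0" for w :: complex
  proof -
    define e where "e c = of_real (r ^ (nat \<bar>c\<bar>)\<^sup>2) * w powi c" for c
    define f where "f N c = (if c \<in> {- int N..int N} then of_real (qbinomial (r\<^sup>2) (2 * N) (nat (int N + c))) else 0) * e c" for N c
    define M where "M c = 1 / Q\<^sup>2 * norm (e c)" for c
    have T: "(f N has_sum (\<Sum>c\<in>{- int N..int N}. f N c)) UNIV" for N
      by (rule has_sum_finite_neutralI[of "{- int N..int N}"]) (auto simp: f_def)
    have eq: "(\<Prod>i<N. (1 + w * of_real (r ^ (2 * i + 1))) * (1 + of_real (r ^ (2 * i + 1)) / w)) = (\<Sum>c\<in>{- int N..int N}. f N c)" for N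
      unfolding finite_triple_product[OF r w] by (rule sum.cong) (auto simp: f_def e_def)
    have "(\<lambda>c. norm (e c)) summable_on UNIV" using theta_abs_summable[OF r, of w] by (simp only: e_def)
    then have Ms: "M summable_on UNIV" unfolding M_def by (rule summable_on_cmult_right)
    have bin: "\<bar>qbinomial (r\<^sup>2) n k\<bar> \<le> 1 / Q\<^sup>2" for n k
    proof (cases "k \<le> n")
      case True
      have "qfact (r\<^sup>2) n / (qfact (r\<^sup>2) k * qfact (r\<^sup>2) (n - k)) \<le> 1 / (Q * Q)"
        using Q le1 qfact_pos[OF q] by (intro frac_le mult_mono) (auto intro: less_imp_le order_trans[OF less_imp_le])
      then show ?thesis using True qfact_pos[OF q] by (simp add: qbinomial_def power2_eq_square abs_of_pos)
    qed (simp add: qbinomial_def)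
    have le: "norm (f N c) \<le> M c" for N c
      unfolding f_def M_def norm_mult by (intro mult_right_mono) (use bin Q in auto)
    have lim: "(\<lambda>N. f N c) \<longlonglongrightarrow> of_real (1 / Q) * e c" for c
    proof -
      have fl: "filterlim (\<lambda>N. nat (int N + d)) at_top sequentially" for d
        unfolding filterlim_at_top
      proof
        fix Z show "\<forall>\<^sub>F N in sequentially. Z \<le> nat (int N + d)"
          using eventually_ge_at_top[of "nat (int Z - d)"] by eventually_elim linarith
      qed
      have "filterlim (\<lambda>N. 2 * N) at_top sequentially"
        by (intro filterlim_subseq strict_monoI) auto
      then have "(\<lambda>N. qfact (r\<^sup>2) (2 * N) / (qfact (r\<^sup>2) (nat (int N + c)) * qfact (r\<^sup>2) (nat (int N + (- c))))) \<longlonglongrightarrow> Q / (Q * Q)"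
        using Q(1) by (intro tendsto_intros filterlim_compose[OF Q(2)] fl) auto
      moreover have "\<forall>\<^sub>F N in sequentially. qfact (r\<^sup>2) (2 * N) / (qfact (r\<^sup>2) (nat (int N + c)) * qfact (r\<^sup>2) (nat (int N + (- c))))
         = (if c \<in> {- int N..int N} then qbinomial (r\<^sup>2) (2 * N) (nat (int N + c)) else 0)"
        using eventually_ge_at_top[of "nat \<bar>c\<bar>"]
      proof eventually_elim
        case (elim N)
        then have "nat (int N + c) \<le> 2 * N" "2 * N - nat (int N + c) = nat (int N + (- c))" "c \<in> {- int N..int N}" by auto
        then show ?case by (simp add: qbinomial_def)
      qed
      ultimately have "(\<lambda>N. if c \<in> {- int N..int N} then qbinomial (r\<^sup>2) (2 * N) (nat (int N + c)) else 0) \<longlonglongrightarrow> Q / (Q * Q)"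
        by (rule Lim_transform_eventually)
      then have "(\<lambda>N. of_real (if c \<in> {- int N..int N} then qbinomial (r\<^sup>2) (2 * N) (nat (int N + c)) else 0) * e c) \<longlonglongrightarrow> of_real (Q / (Q * Q)) * e c"
        by (intro tendsto_intros)
      then show ?thesis using Q(1) unfolding f_def by (simp add: if_distrib[of of_real] cong: if_cong)
    qed
    have "(\<lambda>N. \<Sum>c\<in>{- int N..int N}. f N c) \<longlonglongrightarrow> (\<Sum>\<^sub>\<infinity>c. of_real (1 / Q) * e c)"
      by (rule has_sum_tendsto_dominated(2)[OF Ms le lim T])
    also have "(\<Sum>\<^sub>\<infinity>c. of_real (1 / Q) * e c) = of_real (1 / Q) * theta r w"
      unfolding theta_def e_def by (rule infsum_cmult_right')
    finally show ?thesis unfolding eq .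
  qed
  then show ?thesis using that[of "1 / Q"] Q(1) by simp
qed

lemma infsum_mult_Times:
  fixes a :: "'a \<Rightarrow> complex" and b :: "'b \<Rightarrow> complex"
  assumes a: "(\<lambda>x. norm (a x)) summable_on A" and b: "(\<lambda>y. norm (b y)) summable_on B"
  shows "(\<lambda>p. norm (case p of (x, y) \<Rightarrow> a x * b y)) summable_on A \<times> B"
    "(\<Sum>\<^sub>\<infinity>(x, y)\<in>A \<times> B. a x * b y) = infsum a A * infsum b B"
proof -
  show "(\<lambda>p. norm (case p of (x, y) \<Rightarrow> a x * b y)) summable_on A \<times> B"
  proof (rule iffD2[OF Infinite_Sum.abs_summable_on_Sigma_iff], intro conjI ballI)
    show "(\<lambda>y. norm (case (x, y) of (x, y) \<Rightarrow> a x * b y)) summable_on B" for x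
      using summable_on_cmult_right[OF b, of "norm (a x)"] by (simp add: norm_mult)
    have "0 \<le> (\<Sum>\<^sub>\<infinity>y\<in>B. norm (b y))" by (rule infsum_nonneg) simp
    then show "(\<lambda>x. norm (\<Sum>\<^sub>\<infinity>y\<in>B. norm (case (x, y) of (x, y) \<Rightarrow> a x * b y))) summable_on A"
      using summable_on_cmult_left[OF a, of "\<Sum>\<^sub>\<infinity>y\<in>B. norm (b y)"]
      by (simp add: norm_mult infsum_cmult_right' abs_mult)
  qed
  then have S': "(\<lambda>(x, y). a x * b y) summable_on A \<times> B" by (rule abs_summable_summable)
  show "(\<Sum>\<^sub>\<infinity>(x, y)\<in>A \<times> B. a x * b y) = infsum a A * infsum b B"
    unfolding infsum_Sigma'_banach[OF S', symmetric]
    by (simp add: infsum_cmult_right' infsum_cmult_left')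
qed

section \<open>Fourier coefficients\<close>

lemma has_integral_cis_int:
  "((\<lambda>t. cis (of_int k * t)) has_integral (if k = 0 then 2 * of_real pi else 0)) {-pi..pi}"
proof (cases "k = 0")
  case True
  then show ?thesis using has_integral_const_real[of "1::complex" "-pi" pi] by (simp add: scaleR_conv_of_real)
next
  case False
  define F where "F z = exp (\<i> * of_int k * z) / (\<i> * of_int k)" for z :: complex
  have D: "(F has_field_derivative exp (\<i> * of_int k * z)) (at z)" for z
    unfolding F_def using False by (auto intro!: derivative_eq_intros)
  have "((\<lambda>t. exp (\<i> * of_int k * of_real t)) has_integral (F (of_real pi) - F (of_real (- pi)))) {-pi..pi}"
    by (intro fundamental_theorem_of_calculus has_vector_derivative_real_field D) simp
  moreover have "cis (of_int k * pi) = cis (- (of_int k * pi))"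
    by (simp add: complex_eq_iff sin_npi_int[of k, simplified mult.commute] mult.commute)
  then have "F (of_real pi) = F (of_real (- pi))"
    by (simp add: F_def cis_conv_exp mult_ac)
  moreover have "(\<lambda>t. exp (\<i> * of_int k * of_real t)) = (\<lambda>t. cis (of_int k * t))"
    by (simp add: cis_conv_exp mult_ac)
  ultimately show ?thesis using False by simp
qed

lemma cis_int_mult: "cis (of_int k * t) * cis (- of_int j * t) = cis (of_int (k - j) * t)"
  by (simp add: cis_mult algebra_simps)

text \<open>Pointwise convergence of trigonometric polynomials with a uniform bound carries over to
  each coefficient, by dominated convergence in the integral that extracts it.\<close>

lemma Fourier_coefficients_tendsto:
  fixes w :: "nat \<Rightarrow> 'm \<Rightarrow> complex" and deg :: "nat \<Rightarrow> 'm \<Rightarrow> int"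
  assumes fin: "\<And>n. finite (D n)"
    and bound: "\<And>n t. norm (\<Sum>M\<in>D n. w n M * cis (of_int (deg n M) * t)) \<le> B"
    and conv: "\<And>t. t \<in> {-pi..pi} \<Longrightarrow> (\<lambda>n. \<Sum>M\<in>D n. w n M * cis (of_int (deg n M) * t)) \<longlonglongrightarrow> g t"
  shows "(\<lambda>n. \<Sum>M | M \<in> D n \<and> deg n M = j. w n M) \<longlonglongrightarrow> integral {-pi..pi} (\<lambda>t. g t * cis (- of_int j * t)) / (2 * pi)"
proof -
  define F where "F n t = (\<Sum>M\<in>D n. w n M * cis (of_int (deg n M) * t)) * cis (- of_int j * t)" for n t
  have I: "(F n has_integral (2 * pi) * (\<Sum>M | M \<in> D n \<and> deg n M = j. w n M)) {-pi..pi}" for n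
  proof -
    have "F n = (\<lambda>t. \<Sum>M\<in>D n. w n M * cis (of_int (deg n M - j) * t))"
      unfolding F_def sum_distrib_right mult.assoc cis_int_mult ..
    moreover have "((\<lambda>t. \<Sum>M\<in>D n. w n M * cis (of_int (deg n M - j) * t)) has_integral
        (\<Sum>M\<in>D n. w n M * (if deg n M - j = 0 then 2 * of_real pi else 0))) {-pi..pi}"
      by (intro has_integral_sum fin has_integral_mult_right has_integral_cis_int)
    moreover have "(\<Sum>M\<in>D n. w n M * (if deg n M - j = 0 then 2 * of_real pi else 0)) = (\<Sum>M\<in>D n. if deg n M = j then 2 * of_real pi * w n M else 0)"
      by (intro sum.cong) auto
    moreover have "\<dots> = (2 * pi) * (\<Sum>M | M \<in> D n \<and> deg n M = j. w n M)"
      using fin[of n] by (subst sum.inter_filter[symmetric]) (simp_all add: sum_distrib_left)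
    ultimately show ?thesis by simp
  qed
  have "(\<lambda>n. integral {-pi..pi} (F n)) \<longlonglongrightarrow> integral {-pi..pi} (\<lambda>t. g t * cis (- of_int j * t))"
  proof (rule dominated_convergence(2))
    show "F n integrable_on {-pi..pi}" for n using I by blast
    show "norm (F n t) \<le> B" for n t unfolding F_def norm_mult using bound by simp
    show "(\<lambda>n. F n t) \<longlonglongrightarrow> g t * cis (- of_int j * t)" if "t \<in> {-pi..pi}" for t
      unfolding F_def by (intro tendsto_intros conv that)
  qed auto
  then have "(\<lambda>n. (2 * pi) * (\<Sum>M | M \<in> D n \<and> deg n M = j. w n M)) \<longlonglongrightarrow> integral {-pi..pi} (\<lambda>t. g t * cis (- of_int j * t))"
    using integral_unique[OF I] by simp
  then have "(\<lambda>n. (2 * pi) * (\<Sum>M | M \<in> D n \<and> deg n M = j. w n M) / (2 * pi)) \<longlonglongrightarrow> integral {-pi..pi} (\<lambda>t. g t * cis (- of_int j * t)) / (2 * pi)"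
    by (intro tendsto_intros) auto
  then show ?thesis by simp
qed

lemma has_sum_integral:
  fixes f :: "'x \<Rightarrow> real \<Rightarrow> complex" and M :: "'x \<Rightarrow> real"
  assumes c: "\<And>x. continuous_on {a..b} (f x)" and le: "\<And>x t. x \<in> X \<Longrightarrow> t \<in> {a..b} \<Longrightarrow> norm (f x t) \<le> M x"
    and M: "M summable_on X"
  shows "((\<lambda>x. integral {a..b} (f x)) has_sum integral {a..b} (\<lambda>t. \<Sum>\<^sub>\<infinity>x\<in>X. f x t)) X"
proof -
  have u: "uniform_limit {a..b} (\<lambda>X t. \<Sum>x\<in>X. f x t) (\<lambda>t. \<Sum>\<^sub>\<infinity>x\<in>X. f x t) (finite_subsets_at_top X)"
    using le M by (rule Weierstrass_m_test_general)
  obtain I J where IJ: "\<And>F. ((\<lambda>t. \<Sum>x\<in>F. f x t) has_integral I F) {a..b}"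
      "((\<lambda>t. \<Sum>\<^sub>\<infinity>x\<in>X. f x t) has_integral J) {a..b}" "(I \<longlongrightarrow> J) (finite_subsets_at_top X)"
    by (rule uniform_limit_integral[OF u]) (auto intro!: continuous_intros c)
  have "I F = (\<Sum>x\<in>F. integral {a..b} (f x))" if "finite F" for F
    using integral_unique[OF IJ(1)[of F]] that c
    by (subst (asm) integral_sum) (auto intro: integrable_continuous_real)
  then have "\<forall>\<^sub>F F in finite_subsets_at_top X. I F = (\<Sum>x\<in>F. integral {a..b} (f x))"
    by (intro eventually_finite_subsets_at_top_weakI) auto
  then have "((\<lambda>F. \<Sum>x\<in>F. integral {a..b} (f x)) \<longlongrightarrow> J) (finite_subsets_at_top X)"
    using IJ(3) by (rule Lim_transform_eventually[rotated])
  then show ?thesis using integral_unique[OF IJ(2)] by (simp add: has_sum_def)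
qed

text \<open>Absolute summability allows termwise integration, and orthogonality keeps the terms of
  degree \<open>j\<close>.\<close>

lemma Fourier_coefficient_series:
  fixes a :: "'x \<Rightarrow> complex" and deg :: "'x \<Rightarrow> int"
  assumes a: "(\<lambda>x. norm (a x)) summable_on X"
  shows "integral {-pi..pi} (\<lambda>t. (\<Sum>\<^sub>\<infinity>x\<in>X. a x * cis (of_int (deg x) * t)) * cis (- of_int j * t)) / (2 * pi)
    = (\<Sum>\<^sub>\<infinity>x | x \<in> X \<and> deg x = j. a x)"
proof -
  have "((\<lambda>x. integral {-pi..pi} (\<lambda>t. a x * cis (of_int (deg x - j) * t))) has_sum
      integral {-pi..pi} (\<lambda>t. \<Sum>\<^sub>\<infinity>x\<in>X. a x * cis (of_int (deg x - j) * t))) X"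
    by (rule has_sum_integral[OF _ _ a]) (auto intro!: continuous_intros simp: norm_mult)
  moreover have "integral {-pi..pi} (\<lambda>t. a x * cis (of_int (deg x - j) * t)) = (if deg x = j then a x * (2 * pi) else 0)" for x
    using integral_unique[OF has_integral_mult_right[OF has_integral_cis_int[of "deg x - j"], of "a x"]]
    unfolding right_minus_eq
    by (cases "deg x = j") (simp_all only: if_True if_False mult_zero_right of_real_mult of_real_numeral refl)
  moreover have "(\<lambda>t. \<Sum>\<^sub>\<infinity>x\<in>X. a x * cis (of_int (deg x - j) * t)) = (\<lambda>t. (\<Sum>\<^sub>\<infinity>x\<in>X. a x * cis (of_int (deg x) * t)) * cis (- of_int j * t))"
    unfolding infsum_cmult_left'[symmetric] mult.assoc cis_int_mult ..
  ultimately have "integral {-pi..pi} (\<lambda>t. (\<Sum>\<^sub>\<infinity>x\<in>X. a x * cis (of_int (deg x) * t)) * cis (- of_int j * t))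
      = (\<Sum>\<^sub>\<infinity>x\<in>X. if deg x = j then a x * (2 * pi) else 0)"
    by (simp add: has_sum_iff)
  also have "\<dots> = (\<Sum>\<^sub>\<infinity>x | x \<in> X \<and> deg x = j. a x * (2 * pi))"
    by (rule infsum_cong_neutral) auto
  also have "\<dots> = (\<Sum>\<^sub>\<infinity>x | x \<in> X \<and> deg x = j. a x) * (2 * pi)" by (rule infsum_cmult_left')
  finally show ?thesis by simp
qed

text \<open>After rescaling by \<open>\<sigma>\<close> this is the characteristic function of the
  standard normal law.\<close>

lemma gaussian_Fourier:
  fixes \<sigma> l :: real
  assumes s: "\<sigma> > 0"
  shows "((\<lambda>x. of_real (exp (- x\<^sup>2 / (2 * \<sigma>\<^sup>2))) * cis (- l * x)) has_integral
    of_real (\<sigma> * sqrt (2 * pi) * exp (- \<sigma>\<^sup>2 * l\<^sup>2 / 2))) UNIV"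
proof -
  define f where "f x = of_real (exp (- x\<^sup>2 / (2 * \<sigma>\<^sup>2))) * cis (- l * x)" for x
  have f_measurable: "f \<in> borel_measurable lborel"
  proof -
    have "continuous_on UNIV f" unfolding f_def using s by (intro continuous_intros) auto
    then show ?thesis by (simp add: borel_measurable_continuous_onI)
  qed
  have int: "integrable lborel f"
  proof (rule Bochner_Integration.integrable_bound[OF _ f_measurable])
    show "integrable lborel (\<lambda>x. sqrt (2 * pi * \<sigma>\<^sup>2) * normal_density 0 \<sigma> x)" using s by auto
    show "AE x in lborel. norm (f x) \<le> norm (sqrt (2 * pi * \<sigma>\<^sup>2) * normal_density 0 \<sigma> x)"
      using s by (auto simp: f_def norm_mult normal_density_def)
  qed
  have "integral\<^sup>L lborel f = \<sigma> *\<^sub>R (\<integral>x. f (0 + \<sigma> * x) \<partial>lborel)"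
    using lborel_integral_real_affine[of \<sigma> f 0] s by simp
  also have "(\<lambda>x. f (0 + \<sigma> * x)) = (\<lambda>x. of_real (sqrt (2 * pi)) * (std_normal_density x *\<^sub>R iexp (- (l * \<sigma>) * x)))"
    using s by (auto simp: f_def std_normal_density_def cis_conv_exp power_mult_distrib scaleR_conv_of_real mult_ac)
  also have "(\<integral>x. of_real (sqrt (2 * pi)) * (std_normal_density x *\<^sub>R iexp (- (l * \<sigma>) * x)) \<partial>lborel)
     = of_real (sqrt (2 * pi)) * (\<integral>x. std_normal_density x *\<^sub>R iexp (- (l * \<sigma>) * x) \<partial>lborel)"
    by (rule integral_mult_right_zero)
  also have "(\<integral>x. std_normal_density x *\<^sub>R iexp (- (l * \<sigma>) * x) \<partial>lborel) = char std_normal_distribution (- (l * \<sigma>))"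
    unfolding char_def by (rule integral_density[symmetric]) auto
  also have "\<dots> = of_real (exp (- \<sigma>\<^sup>2 * l\<^sup>2 / 2))"
    by (simp add: char_std_normal_distribution power_mult_distrib mult.commute)
  finally have "integral\<^sup>L lborel f = of_real (\<sigma> * sqrt (2 * pi) * exp (- \<sigma>\<^sup>2 * l\<^sup>2 / 2))"
    by (simp add: scaleR_conv_of_real)
  then show ?thesis using has_integral_integral_lborel[OF int] unfolding f_def by simp
qed

lemma integral_symmetric_limit:
  fixes f :: "real \<Rightarrow> complex"
  assumes c: "continuous_on UNIV f" and g: "g integrable_on UNIV" "\<And>x. norm (f x) \<le> g x"
    and a: "filterlim a at_bot sequentially" and b: "filterlim b at_top sequentially"
  shows "(\<lambda>N. integral {a N..b N} f) \<longlonglongrightarrow> integral UNIV f"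
proof -
  have "(\<lambda>N. integral UNIV (\<lambda>x. if x \<in> {a N..b N} then f x else 0)) \<longlonglongrightarrow> integral UNIV f"
  proof (rule dominated_convergence(2)[OF _ g(1)])
    show "(\<lambda>x. if x \<in> {a N..b N} then f x else 0) integrable_on UNIV" for N
      unfolding integrable_restrict_UNIV
      by (rule integrable_continuous_real) (use c continuous_on_subset in blast)
    show "norm (if x \<in> {a N..b N} then f x else 0) \<le> g x" for N x
      using g(2)[of x] by (auto intro: order_trans[OF norm_ge_zero])
    show "(\<lambda>N. if x \<in> {a N..b N} then f x else 0) \<longlonglongrightarrow> f x" for x
    proof (rule tendsto_eventually)
      show "\<forall>\<^sub>F N in sequentially. (if x \<in> {a N..b N} then f x else 0) = f x"
        using filterlim_at_bot[THEN iffD1, OF a, rule_format, of x] filterlim_at_top[THEN iffD1, OF b, rule_format, of x]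
        by eventually_elim auto
    qed
  qed
  then show ?thesis by (simp only: integral_restrict_UNIV)
qed

lemma sum_adjacent_integrals:
  fixes h :: "real \<Rightarrow> complex"
  assumes c: "continuous_on UNIV h" and p: "p \<ge> 0"
  shows "(\<Sum>c\<in>{- int N..int N}. integral {x + of_int c * p..x + of_int c * p + p} h)
    = integral {x - real N * p..x + real N * p + p} h"
proof (induction N)
  case (Suc N)
  have i: "h integrable_on {a..b}" for a b
    by (rule integrable_continuous_real) (use c continuous_on_subset in blast)
  have eq: "{- int (Suc N)..int (Suc N)} = insert (- int (Suc N)) (insert (int (Suc N)) {- int N..int N})" by auto
  have "(\<Sum>c\<in>{- int (Suc N)..int (Suc N)}. integral {x + of_int c * p..x + of_int c * p + p} h)
     = integral {x - real (Suc N) * p..x - real N * p} h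
       + (integral {x + real N * p + p..x + real (Suc N) * p + p} h + integral {x - real N * p..x + real N * p + p} h)"
    unfolding eq by (subst sum.insert, simp, simp, subst sum.insert, simp, simp, simp only: Suc) (simp add: algebra_simps)
  also have "\<dots> = integral {x - real (Suc N) * p..x - real N * p} h + integral {x - real N * p..x + real (Suc N) * p + p} h"
    using Henstock_Kurzweil_Integration.integral_combine[OF _ _ i, of "x - real N * p" "x + real N * p + p" "x + real (Suc N) * p + p"] p
    by (simp add: algebra_simps)
  also have "\<dots> = integral {x - real (Suc N) * p..x + real (Suc N) * p + p} h"
    using p by (intro Henstock_Kurzweil_Integration.integral_combine i) (auto simp: algebra_simps)
  finally show ?case .
qed simp

text \<open>Expand the square, drop x^2 and bound the cross term by \<open>B\<close>; what remains
  has the shape of the theta majorant.\<close>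

lemma gaussian_translates_le:
  fixes \<sigma> :: real
  assumes "\<bar>x\<bar> \<le> B"
  shows "exp (- (x + of_int c * (2 * pi))\<^sup>2 / (2 * \<sigma>\<^sup>2))
    \<le> exp (- (2 * pi\<^sup>2 / \<sigma>\<^sup>2)) ^ (nat \<bar>c\<bar>)\<^sup>2 * exp (2 * pi * B / \<sigma>\<^sup>2) ^ nat \<bar>c\<bar>"
proof -
  have n: "real (nat \<bar>c\<bar>) = \<bar>of_int c\<bar>" "real ((nat \<bar>c\<bar>)\<^sup>2) = (of_int c)\<^sup>2" by auto
  have "- (x * of_int c) \<le> \<bar>x\<bar> * \<bar>of_int c\<bar>" unfolding abs_mult[symmetric] by (rule abs_ge_minus_self)
  also have "\<dots> \<le> B * \<bar>of_int c\<bar>" using assms by (intro mult_right_mono) auto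
  finally have "- (x * of_int c) \<le> B * \<bar>of_int c\<bar>" .
  then have "- (x * of_int c) * (4 * pi) \<le> B * \<bar>of_int c\<bar> * (4 * pi)" by (intro mult_right_mono) auto
  then have "- (x * of_int c * (4 * pi)) \<le> B * \<bar>of_int c\<bar> * (4 * pi)" by (simp only: minus_mult_left)
  moreover have "(x + of_int c * (2 * pi))\<^sup>2 = x\<^sup>2 + x * of_int c * (4 * pi) + 4 * pi\<^sup>2 * (of_int c)\<^sup>2"
    by (simp add: power2_eq_square algebra_simps)
  ultimately have "- (x + of_int c * (2 * pi))\<^sup>2 \<le> - (4 * pi\<^sup>2 * (of_int c)\<^sup>2) + B * \<bar>of_int c\<bar> * (4 * pi)"
    using zero_le_power2[of x] by linarith
  then have "- (x + of_int c * (2 * pi))\<^sup>2 / (2 * \<sigma>\<^sup>2) \<le> (- (4 * pi\<^sup>2 * (of_int c)\<^sup>2) + B * \<bar>of_int c\<bar> * (4 * pi)) / (2 * \<sigma>\<^sup>2)"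
    by (rule divide_right_mono) simp
  also have "\<dots> = (of_int c)\<^sup>2 * - (2 * pi\<^sup>2 / \<sigma>\<^sup>2) + \<bar>of_int c\<bar> * (2 * pi * B / \<sigma>\<^sup>2)"
    by (simp add: diff_divide_distrib add_divide_distrib mult_ac)
  finally show ?thesis
    unfolding exp_of_nat_mult[symmetric] n exp_add[symmetric] by simp
qed

lemma gaussian_majorant_summable:
  assumes "\<sigma> > 0"
  shows "(\<lambda>c::int. exp (- (2 * pi\<^sup>2 / \<sigma>\<^sup>2)) ^ (nat \<bar>c\<bar>)\<^sup>2 * exp (2 * pi * B / \<sigma>\<^sup>2) ^ nat \<bar>c\<bar>) summable_on UNIV"
  by (rule theta_majorant_summable) (use assms in auto)

text \<open>The mechanism of Poisson summation: integrating the translates over one period is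
  integrating the Gaussian over the whole line. The centre \<open>\<delta>\<close> appears only as a
  phase.\<close>

lemma periodized_gaussian_Fourier:
  fixes \<sigma> \<delta> :: real and l :: int
  assumes s: "\<sigma> > 0"
  shows "integral {-pi..pi} (\<lambda>t. (\<Sum>\<^sub>\<infinity>c. of_real (exp (- (t - \<delta> + of_int c * (2 * pi))\<^sup>2 / (2 * \<sigma>\<^sup>2)))) * cis (- of_int l * t))
    = cis (- of_int l * \<delta>) * of_real (\<sigma> * sqrt (2 * pi) * exp (- \<sigma>\<^sup>2 * (of_int l)\<^sup>2 / 2))"
proof -
  define g where "g x = exp (- x\<^sup>2 / (2 * \<sigma>\<^sup>2))" for x
  define h where "h x = of_real (g x) * cis (- of_int l * x)" for x
  have hc: "continuous_on A h" for A unfolding h_def g_def using s by (intro continuous_intros) auto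
  define H where "H c = integral {(- pi - \<delta>) + of_int c * (2 * pi)..(- pi - \<delta>) + of_int c * (2 * pi) + 2 * pi} h" for c
  have H: "integral {-pi..pi} (\<lambda>t. of_real (g (t - \<delta> + of_int c * (2 * pi))) * cis (- of_int l * t)) = cis (- of_int l * \<delta>) * H c" for c :: int
  proof -
    have "of_real (g (t - \<delta> + of_int c * (2 * pi))) * cis (- of_int l * t) = cis (- of_int l * \<delta>) * h (t + (of_int c * (2 * pi) - \<delta>))" for t
    proof -
      have "cis (- of_int l * (t + (of_int c * (2 * pi) - \<delta>))) = cis (- of_int l * t) * cis (of_int l * \<delta>) * cis (2 * pi * of_int (- l * c))"
        by (simp add: cis_mult algebra_simps)
      \<comment> \<open>Integrality of \<open>l\<close> makes the character invariant under
        translation by 2 pi, so that all pieces are integrals of the same function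
        \<open>h\<close>.\<close>
      also have "cis (2 * pi * of_int (- l * c)) = 1" by (rule cis_multiple_2pi) simp
      finally have "cis (- of_int l * \<delta>) * cis (- of_int l * (t + (of_int c * (2 * pi) - \<delta>))) = cis (- of_int l * t)"
        by (simp add: cis_mult)
      then show ?thesis by (simp add: h_def algebra_simps)
    qed
    then have "integral {-pi..pi} (\<lambda>t. of_real (g (t - \<delta> + of_int c * (2 * pi))) * cis (- of_int l * t))
       = cis (- of_int l * \<delta>) * integral {-pi..pi} (\<lambda>t. h (t + (of_int c * (2 * pi) - \<delta>)))"
      by (simp add: integral_mult_right)
    also have "integral {-pi..pi} (\<lambda>t. h (t + (of_int c * (2 * pi) - \<delta>))) = H c"
      using integral_shift_real_ivl[of "- pi + (of_int c * (2 * pi) - \<delta>)" "of_int c * (2 * pi) - \<delta>" "pi + (of_int c * (2 * pi) - \<delta>)" h]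
      by (simp add: H_def algebra_simps)
    finally show ?thesis .
  qed
  have "((\<lambda>c. integral {-pi..pi} (\<lambda>t. of_real (g (t - \<delta> + of_int c * (2 * pi))) * cis (- of_int l * t))) has_sum
      integral {-pi..pi} (\<lambda>t. \<Sum>\<^sub>\<infinity>c. of_real (g (t - \<delta> + of_int c * (2 * pi))) * cis (- of_int l * t))) UNIV"
  proof (rule has_sum_integral[OF _ _ gaussian_majorant_summable[OF s, of "pi + \<bar>\<delta>\<bar>"]])
    show "continuous_on {-pi..pi} (\<lambda>t. of_real (g (t - \<delta> + of_int c * (2 * pi))) * cis (- of_int l * t))" for c
      unfolding g_def using s by (intro continuous_intros) auto
    fix c :: int and t assume "t \<in> {-pi..pi}"
    then have "\<bar>t - \<delta>\<bar> \<le> pi + \<bar>\<delta>\<bar>" by auto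
    then show "norm (of_real (g (t - \<delta> + of_int c * (2 * pi))) * cis (- of_int l * t))
      \<le> exp (- (2 * pi\<^sup>2 / \<sigma>\<^sup>2)) ^ (nat \<bar>c\<bar>)\<^sup>2 * exp (2 * pi * (pi + \<bar>\<delta>\<bar>) / \<sigma>\<^sup>2) ^ nat \<bar>c\<bar>"
      unfolding g_def norm_mult norm_of_real norm_cis abs_exp_cancel mult_1_right by (rule gaussian_translates_le)
  qed
  then have S: "((\<lambda>c. cis (- of_int l * \<delta>) * H c) has_sum
      integral {-pi..pi} (\<lambda>t. (\<Sum>\<^sub>\<infinity>c. of_real (g (t - \<delta> + of_int c * (2 * pi)))) * cis (- of_int l * t))) UNIV"
    by (simp only: H infsum_cmult_left')
  \<comment> \<open>The unordered sum is evaluated along symmetric intervals of integers, for which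
    the windows of length 2 pi join into one growing interval.\<close>
  have "filterlim (\<lambda>N. {- int N..int N}) (finite_subsets_at_top UNIV) sequentially"
    unfolding filterlim_finite_subsets_at_top
  proof (intro allI impI)
    fix X :: "int set" assume "finite X \<and> X \<subseteq> UNIV"
    then obtain K where K: "\<And>x. x \<in> X \<Longrightarrow> \<bar>x\<bar> \<le> K" using finite_abs_int_segment
      by (metis Max_ge finite_imageI imageI)
    show "\<forall>\<^sub>F N in sequentially. finite {- int N..int N} \<and> X \<subseteq> {- int N..int N} \<and> {- int N..int N} \<subseteq> UNIV"
      using eventually_ge_at_top[of "nat K"] by eventually_elim (use K in force)
  qed
  then have "(\<lambda>N. \<Sum>c\<in>{- int N..int N}. cis (- of_int l * \<delta>) * H c) \<longlonglongrightarrow>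
      integral {-pi..pi} (\<lambda>t. (\<Sum>\<^sub>\<infinity>c. of_real (g (t - \<delta> + of_int c * (2 * pi)))) * cis (- of_int l * t))"
    using S unfolding has_sum_def by (rule filterlim_compose[rotated])
  moreover have "(\<lambda>N. cis (- of_int l * \<delta>) * integral {(- pi - \<delta>) - real N * (2 * pi)..(- pi - \<delta>) + real N * (2 * pi) + 2 * pi} h)
     \<longlonglongrightarrow> cis (- of_int l * \<delta>) * integral UNIV h"
  proof (intro tendsto_mult tendsto_const integral_symmetric_limit hc)
    show "g integrable_on UNIV"
      using has_integral_Re[OF gaussian_Fourier[OF s, of 0]] unfolding g_def by (auto simp: integrable_on_def)
    show "norm (h x) \<le> g x" for x by (simp add: h_def norm_mult g_def)
  qed (real_asymp+)
  ultimately have "integral {-pi..pi} (\<lambda>t. (\<Sum>\<^sub>\<infinity>c. of_real (g (t - \<delta> + of_int c * (2 * pi)))) * cis (- of_int l * t))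
    = cis (- of_int l * \<delta>) * integral UNIV h"
    unfolding sum_distrib_left[symmetric] H_def using sum_adjacent_integrals[OF hc, where p = "2 * pi" and x = "- pi - \<delta>"]
    by (auto intro: LIMSEQ_unique)
  moreover have "integral UNIV h = of_real (\<sigma> * sqrt (2 * pi) * exp (- \<sigma>\<^sup>2 * (of_int l)\<^sup>2 / 2))"
    using integral_unique[OF gaussian_Fourier[OF s, of "of_int l"]] unfolding h_def g_def .
  ultimately show ?thesis unfolding g_def by simp
qed

section \<open>Modes near the Fermi points\<close>

text \<open>\<open>mode s\<close> is \<open>(2 * cos (\<theta> / 2))\<^sup>2\<close> at \<open>\<theta> = 2 * pi / 3 + s\<close>; at the Fermi point \<open>s = 0\<close> it equals 1.\<close>

definition mode :: "real \<Rightarrow> real" where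
  "mode s = 2 - cos s - sqrt 3 * sin s"

lemma mode_eq: "mode s = (2 * cos ((2 * pi / 3 + s) / 2))\<^sup>2"
proof -
  have "(2 * cos ((2 * pi / 3 + s) / 2))\<^sup>2 = 2 + 2 * cos (2 * ((2 * pi / 3 + s) / 2))"
    unfolding cos_double_cos by (simp add: power2_eq_square)
  also have "2 * ((2 * pi / 3 + s) / 2) = 2 * pi / 3 + s" by simp
  also have "2 + 2 * cos (2 * pi / 3 + s) = mode s"
    unfolding mode_def cos_add by (simp add: cos_120 cos_120' sin_120' algebra_simps)
  finally show ?thesis by simp
qed

lemma mode_nonneg: "mode s \<ge> 0"
  unfolding mode_eq by simp

text \<open>On this range \<open>mode\<close> is convex and lies below its chord from 1 to 2 - sqrt
  3. The chord has slope -2(sqrt 3 - 1)/pi, which is below -1/4.\<close>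

lemma mode_le_exp:
  assumes "0 \<le> s" "s \<le> pi / 2"
  shows "mode s \<le> exp (- s / 4)"
proof -
  have cv: "convex_on {0..pi/2} mode"
  proof (rule f''_ge0_imp_convex[where f' = "\<lambda>s. sin s - sqrt 3 * cos s" and f'' = "\<lambda>s. cos s + sqrt 3 * sin s"])
    show "(mode has_real_derivative sin s - sqrt 3 * cos s) (at s)" for s
      unfolding mode_def by (auto intro!: derivative_eq_intros)
    show "((\<lambda>s. sin s - sqrt 3 * cos s) has_real_derivative cos s + sqrt 3 * sin s) (at s)" for s
      by (auto intro!: derivative_eq_intros)
    show "0 \<le> cos s + sqrt 3 * sin s" if "s \<in> {0..pi/2}" for s
      using that by (intro add_nonneg_nonneg mult_nonneg_nonneg cos_ge_zero sin_ge_zero) auto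
  qed auto
  define x where "x = 2 * s / pi"
  have x: "0 \<le> x" "x \<le> 1" "s = (1 - x) * 0 + x * (pi / 2)" using assms by (auto simp: x_def field_simps)
  have "mode s \<le> (1 - x) * mode 0 + x * mode (pi / 2)"
    unfolding x(3) using convex_onD[OF cv x(1,2), of 0 "pi/2"] by simp
  also have "\<dots> = 1 - (sqrt 3 - 1) * x" by (simp add: mode_def algebra_simps)
  also have "\<dots> \<le> 1 - s / 4"
  proof -
    have "(1/2) * (2 * s / 4) \<le> (sqrt 3 - 1) * (2 * s / pi)"
    proof (rule mult_mono)
      show "1 / 2 \<le> sqrt 3 - 1" using real_le_rsqrt[of "3/2" 3] by (simp add: power2_eq_square)
      show "2 * s / 4 \<le> 2 * s / pi" using assms pi_less_4 by (intro divide_left_mono) auto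
    qed (use assms in auto)
    then show ?thesis by (simp add: x_def)
  qed
  also have "\<dots> \<le> exp (- s / 4)" using exp_ge_add_one_self[of "- s / 4"] by simp
  finally show ?thesis .
qed

text \<open>By concavity of the sine, the square root of \<open>mode (- s)\<close> is at least 1 + x
  with x = 3s/(2 pi); its square dominates exp x, and x is at least s/4.\<close>

lemma inverse_mode_le_exp:
  assumes "0 \<le> s" "s \<le> 2 * pi / 3"
  shows "mode (- s) > 0" "1 / mode (- s) \<le> exp (- s / 4)"
proof -
  have cv: "convex_on {pi/6..pi/2} (\<lambda>s. - sin s)"
  proof (rule f''_ge0_imp_convex[where f' = "\<lambda>s. - cos s" and f'' = "\<lambda>s. sin s"])
    show "0 \<le> sin s" if "s \<in> {pi/6..pi/2}" for s using that by (intro sin_ge_zero) auto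
  qed (auto intro!: derivative_eq_intros)
  define x where "x = 3 * s / (2 * pi)"
  have x: "0 \<le> x" "x \<le> 1" "s / 2 + pi / 6 = (1 - x) * (pi / 6) + x * (pi / 2)" using assms by (auto simp: x_def field_simps)
  have "sin ((1 - x) * (pi / 6) + x * (pi / 2)) \<ge> (1 - x) * sin (pi / 6) + x * sin (pi / 2)"
    using convex_onD[OF cv x(1,2), of "pi/6" "pi/2"] by simp
  then have "sin (s / 2 + pi / 6) \<ge> (1 + x) / 2"
    unfolding x(3) by (simp add: sin_30 field_simps)
  moreover have "cos ((2 * pi / 3 + (- s)) / 2) = sin (s / 2 + pi / 6)"
    unfolding cos_sin_eq by (rule arg_cong[where f = sin]) (simp add: field_simps)
  ultimately have "2 * cos ((2 * pi / 3 + (- s)) / 2) \<ge> 1 + x" by simp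
  then have "(1 + x)\<^sup>2 \<le> mode (- s)" unfolding mode_eq using x(1) by (intro power_mono) auto
  moreover have "exp (x / 2) \<le> 1 + x"
  proof -
    have "exp (x / 2) \<le> 1 + x / 2 + (x / 2)\<^sup>2" using x by (intro exp_bound) auto
    also have "(x / 2)\<^sup>2 \<le> x / 2" using x mult_left_mono[of x 2 x] by (simp add: power2_eq_square)
    finally show ?thesis by simp
  qed
  then have "exp (x / 2) ^ 2 \<le> (1 + x)\<^sup>2" by (intro power_mono) auto
  ultimately have *: "exp x \<le> mode (- s)" by (simp add: exp_double[symmetric])
  then show pos: "mode (- s) > 0" using exp_gt_zero[of x] by linarith
  have "s / 4 \<le> x" using assms pi_less_4 mult_mono[of s s pi 6] by (simp add: x_def field_simps)
  then have "exp (s / 4) \<le> mode (- s)" using * by (meson exp_le_cancel_iff order_trans)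
  then have "1 / mode (- s) \<le> 1 / exp (s / 4)" using pos by (intro divide_left_mono) auto
  then show "1 / mode (- s) \<le> exp (- s / 4)" by (simp add: exp_minus inverse_eq_divide)
qed

text \<open>The logarithm of \<open>mode\<close> has slope -sqrt 3 at 0; together with m/n tending
  to 1/(sqrt 3 \<open>\<rho>\<close>) the exponent tends to
  -\<open>\<sigma>\<close>/\<open>\<rho>\<close>.\<close>

lemma mode_power_tendsto:
  fixes m n :: "nat \<Rightarrow> nat" and \<rho> \<sigma> :: real
  assumes \<rho>: "\<rho> > 0" and n: "filterlim n at_top sequentially"
    and mn: "(\<lambda>i. real (m i) / real (n i)) \<longlonglongrightarrow> 1 / (sqrt 3 * \<rho>)"
  shows "(\<lambda>i. mode (\<sigma> / real (n i)) ^ m i) \<longlonglongrightarrow> exp (- \<sigma> / \<rho>)"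
proof -
  have N: "filterlim (\<lambda>i. real (n i)) at_top sequentially"
    using n by (rule filterlim_compose[OF filterlim_real_sequentially])
  have "((\<lambda>x. x * ln (mode (\<sigma> / x))) \<longlongrightarrow> - (sqrt 3 * \<sigma>)) at_top"
    unfolding mode_def by real_asymp (simp add: sqrt_def)
  then have "(\<lambda>i. real (n i) * ln (mode (\<sigma> / real (n i)))) \<longlonglongrightarrow> - (sqrt 3 * \<sigma>)"
    using N by (rule filterlim_compose)
  then have "(\<lambda>i. (real (m i) / real (n i)) * (real (n i) * ln (mode (\<sigma> / real (n i))))) \<longlonglongrightarrow> (1 / (sqrt 3 * \<rho>)) * - (sqrt 3 * \<sigma>)"
    by (intro tendsto_mult mn)
  then have "(\<lambda>i. exp ((real (m i) / real (n i)) * (real (n i) * ln (mode (\<sigma> / real (n i)))))) \<longlonglongrightarrow> exp ((1 / (sqrt 3 * \<rho>)) * - (sqrt 3 * \<sigma>))"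
    by (rule tendsto_exp)
  moreover have "(1 / (sqrt 3 * \<rho>)) * - (sqrt 3 * \<sigma>) = - \<sigma> / \<rho>" using \<rho> by (simp add: field_simps)
  ultimately have L: "(\<lambda>i. exp ((real (m i) / real (n i)) * (real (n i) * ln (mode (\<sigma> / real (n i)))))) \<longlonglongrightarrow> exp (- \<sigma> / \<rho>)" by simp
  have "((\<lambda>x. mode (\<sigma> / x)) \<longlongrightarrow> 1) at_top" unfolding mode_def by real_asymp
  then have "(\<lambda>i. mode (\<sigma> / real (n i))) \<longlonglongrightarrow> 1" using N by (rule filterlim_compose)
  then have "\<forall>\<^sub>F i in sequentially. mode (\<sigma> / real (n i)) > 0" by (rule order_tendstoD) simp
  moreover have "\<forall>\<^sub>F i in sequentially. n i \<ge> 1" using n by (simp add: filterlim_at_top)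
  ultimately have "\<forall>\<^sub>F i in sequentially. mode (\<sigma> / real (n i)) > 0 \<and> n i > 0" by eventually_elim simp
  then have "\<forall>\<^sub>F i in sequentially. exp ((real (m i) / real (n i)) * (real (n i) * ln (mode (\<sigma> / real (n i))))) = mode (\<sigma> / real (n i)) ^ m i"
    by eventually_elim (simp add: exp_of_nat_mult)
  then show ?thesis using L by (rule Lim_transform_eventually[rotated])
qed

text \<open>Distance of the i-th mode from its Fermi point: the spacing is 2 pi/(3p), the summand
  1/2 stems from the shift by pi in the angles, and \<open>\<tau>\<close> is the Fourier
  variable.\<close>

definition offset :: "nat \<Rightarrow> real \<Rightarrow> nat \<Rightarrow> real" where
  "offset p \<tau> i = (2 * pi * (real i + 1/2) + \<tau>) / (3 * real p)"

text \<open>The product of the modes on the inner side of both Fermi points, p for each of them;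
  they carry the growth of the partition function.\<close>

definition sea :: "nat \<Rightarrow> nat \<Rightarrow> real \<Rightarrow> real" where
  "sea m p \<tau> = (\<Prod>i<p. (mode (- offset p \<tau> i) * mode (- offset p (- \<tau>) i)) ^ m)"

text \<open>Multiplying the two modes displaced by opposite \<open>\<tau>\<close> turns a product of
  cosines into a sum, so that \<open>\<tau>\<close> enters only through one number cos d.\<close>

lemma sea_eq:
  assumes p: "p > 0"
  shows "sea m p \<tau> = (\<Prod>a<p. (2 * (cos ((2 * real a + 1) * pi / (3 * real p)) + cos (\<tau> / (3 * real p)))) ^ (2 * m))"
proof -
  define \<theta> where "\<theta> a = (2 * real a + 1) * pi / (3 * real p)" for a
  define d where "d = \<tau> / (3 * real p)"
  have "(mode (- offset p \<tau> i) * mode (- offset p (- \<tau>) i)) ^ m = (2 * (cos (\<theta> (p - Suc i)) + cos d)) ^ (2 * m)" if i: "i < p" for i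
  proof -
    have r: "real (p - Suc i) = real p - real i - 1" using i by simp
    have "2 * pi / 3 + (- offset p \<tau> i) = \<theta> (p - Suc i) - d" "2 * pi / 3 + (- offset p (- \<tau>) i) = \<theta> (p - Suc i) + d"
      unfolding \<theta>_def d_def offset_def r using p by (simp_all add: field_simps)
    then have "mode (- offset p \<tau> i) * mode (- offset p (- \<tau>) i)
       = (2 * (2 * cos ((\<theta> (p - Suc i) + d) / 2) * cos ((\<theta> (p - Suc i) - d) / 2)))\<^sup>2"
      unfolding mode_eq by (simp add: power2_eq_square)
    also have "2 * cos ((\<theta> (p - Suc i) + d) / 2) * cos ((\<theta> (p - Suc i) - d) / 2) = cos (\<theta> (p - Suc i)) + cos d"
      by (rule cos_plus_cos[symmetric])
    finally show ?thesis by (simp add: power_mult)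
  qed
  then have "sea m p \<tau> = (\<Prod>i<p. (2 * (cos (\<theta> (p - Suc i)) + cos d)) ^ (2 * m))"
    unfolding sea_def by (intro prod.cong) auto
  also have "\<dots> = (\<Prod>a<p. (2 * (cos (\<theta> a) + cos d)) ^ (2 * m))"
    by (rule prod.nat_diff_reindex)
  finally show ?thesis unfolding \<theta>_def d_def .
qed

text \<open>The sum is a midpoint rule for the integral of \<open>1 / (1 + cos \<theta>)\<close> up to the Fermi point,
  corrected so that it telescopes exactly.\<close>

lemma sum_inverse_cos:
  assumes p: "p > 0"
  shows "(\<Sum>a<p. 1 / (cos ((2 * real a + 1) * pi / (3 * real p)) + cos (pi / (3 * real p)))) = sqrt 3 / (2 * sin (pi / (3 * real p)))"
proof -
  define t where "t a = pi * real a / (3 * real p)" for a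
  have pos: "cos (t a) > 0" if "a \<le> p" for a
  proof (rule cos_gt_zero_pi)
    have "t a \<le> pi / 3" using that p by (simp add: t_def field_simps)
    then show "t a < pi / 2" using pi_gt_zero by linarith
    have "- (pi / 2) < 0" by simp
    also have "0 \<le> t a" by (simp add: t_def)
    finally show "- (pi / 2) < t a" .
  qed
  have s: "sin (pi / (3 * real p)) > 0"
    by (rule sin_gt_zero) (use p in \<open>auto simp: field_simps\<close>)
  have "2 * sin (pi / (3 * real p)) * (1 / (cos ((2 * real a + 1) * pi / (3 * real p)) + cos (pi / (3 * real p)))) = tan (t (Suc a)) - tan (t a)"
    if a: "a < p" for a
  proof -
    have "((2 * real a + 1) * pi / (3 * real p) + pi / (3 * real p)) / 2 = t (Suc a)" "((2 * real a + 1) * pi / (3 * real p) - pi / (3 * real p)) / 2 = t a"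
      unfolding t_def using p by (simp_all add: field_simps)
    then have "cos ((2 * real a + 1) * pi / (3 * real p)) + cos (pi / (3 * real p)) = 2 * cos (t (Suc a)) * cos (t a)"
      by (simp add: cos_plus_cos)
    moreover have "t (Suc a) + - t a = pi / (3 * real p)" using p by (simp add: t_def field_simps)
    then have "tan (t (Suc a)) + tan (- t a) = sin (pi / (3 * real p)) / (cos (t (Suc a)) * cos (- t a))"
      using add_tan_eq[of "t (Suc a)" "- t a"] pos[of a] pos[of "Suc a"] a by simp
    ultimately show ?thesis by simp
  qed
  then have "2 * sin (pi / (3 * real p)) * (\<Sum>a<p. 1 / (cos ((2 * real a + 1) * pi / (3 * real p)) + cos (pi / (3 * real p)))) = (\<Sum>a<p. tan (t (Suc a)) - tan (t a))"
    unfolding sum_distrib_left by (intro sum.cong) auto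
  also have "\<dots> = tan (t p) - tan (t 0)" by (rule sum_lessThan_telescope)
  also have "\<dots> = sqrt 3" using p by (simp add: t_def tan_60)
  finally show ?thesis using s by (simp add: field_simps)
qed

text \<open>The ratio is the product of (1 - x_a)^(2m) with x_a = (1 - cos d)/(1 + cos
  \<open>\<theta>\<close>_a). Both exponential estimates are compared with the sum over 1/(cos
  \<open>\<theta>\<close>_a + cos e), which \<open>sum_inverse_cos\<close> evaluates exactly; this
  is where \<open>U\<close> comes from.\<close>

lemma sea_ratio_bounds:
  fixes m p :: nat and \<tau> :: real
  assumes p: "p > 0" and \<tau>: "\<bar>\<tau>\<bar> \<le> pi"
  defines "U \<equiv> real m * ((1 - cos (\<tau> / (3 * real p))) * sqrt 3 / sin (pi / (3 * real p)))"
  shows "sea m p 0 > 0" "exp (- U) \<le> sea m p \<tau> / sea m p 0"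
    "sea m p \<tau> / sea m p 0 \<le> exp (- ((1 - 2 * (1 - cos (pi / (3 * real p)))) * U))"
proof -
  define \<theta> where "\<theta> a = (2 * real a + 1) * pi / (3 * real p)" for a
  define d where "d = \<tau> / (3 * real p)"
  define e where "e = pi / (3 * real p)"
  define x where "x a = (1 - cos d) / (1 + cos (\<theta> a))" for a
  have e: "0 < e" "e \<le> pi / 3" "\<bar>d\<bar> \<le> e" using p \<tau> by (auto simp: e_def d_def field_simps abs_mult)
  have ce: "cos e \<le> cos d" using cos_monotone_0_pi_le[of "\<bar>d\<bar>" e] e pi_gt_zero by simp
  have th: "1 + cos (\<theta> a) \<ge> 1 / 2" "cos (\<theta> a) + cos e > 0" if "a < p" for a
  proof -
    have "(real a + 1) * pi \<le> real p * pi" using that by (intro mult_right_mono) auto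
    then have "0 \<le> \<theta> a" "\<theta> a + e \<le> 2 * pi / 3" using p by (auto simp: \<theta>_def e_def field_simps)
    then have t: "0 \<le> \<theta> a" "\<theta> a \<le> 2 * pi / 3" using e by auto
    then have "cos (\<theta> a) \<ge> cos (2 * pi / 3)" by (intro cos_monotone_0_pi_le) auto
    then show "1 + cos (\<theta> a) \<ge> 1 / 2" by (simp add: cos_120 cos_120')
    have "cos (\<theta> a) > cos (pi - e)"
      using t(1) \<open>\<theta> a + e \<le> 2 * pi / 3\<close> e(1) pi_gt_zero by (intro cos_monotone_0_pi) linarith+
    then show "cos (\<theta> a) + cos e > 0" by simp
  qed
  have sum: "(\<Sum>a<p. 1 / (cos (\<theta> a) + cos e)) = sqrt 3 / (2 * sin e)"
    unfolding \<theta>_def e_def by (rule sum_inverse_cos[OF p])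
  have S0: "sea m p 0 = (\<Prod>a<p. (2 * (cos (\<theta> a) + 1)) ^ (2 * m))" unfolding sea_eq[OF p] \<theta>_def by simp
  also have "\<dots> > 0"
  proof (intro prod_pos ballI zero_less_power)
    show "0 < 2 * (cos (\<theta> a) + 1)" if "a \<in> {..<p}" for a using th(1)[of a] that by simp
  qed
  finally show "sea m p 0 > 0" .
  have ratio: "sea m p \<tau> / sea m p 0 = (\<Prod>a<p. (1 - x a) ^ (2 * m))"
  proof -
    have "sea m p \<tau> / sea m p 0 = (\<Prod>a<p. (2 * (cos (\<theta> a) + cos d)) ^ (2 * m) / (2 * (cos (\<theta> a) + 1)) ^ (2 * m))"
      unfolding S0 unfolding sea_eq[OF p] \<theta>_def d_def by (rule prod_dividef[symmetric])
    also have "\<dots> = (\<Prod>a<p. (1 - x a) ^ (2 * m))"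
    proof (rule prod.cong[OF refl])
      fix a assume "a \<in> {..<p}"
      then have "1 - x a = (2 * (cos (\<theta> a) + cos d)) / (2 * (cos (\<theta> a) + 1))"
        using th(1)[of a] by (simp add: x_def field_simps)
      then show "(2 * (cos (\<theta> a) + cos d)) ^ (2 * m) / (2 * (cos (\<theta> a) + 1)) ^ (2 * m) = (1 - x a) ^ (2 * m)"
        by (simp only: power_divide)
    qed
    finally show ?thesis .
  qed
  have U: "U = 2 * real m * ((1 - cos d) * (\<Sum>a<p. 1 / (cos (\<theta> a) + cos e)))"
    unfolding U_def d_def[symmetric] e_def[symmetric] sum by simp
  have d1: "0 \<le> 1 - cos d" by simp
  have ex: "(\<Prod>a<p. exp (- y a) ^ (2 * m)) = exp (- (2 * real m * (\<Sum>a<p. y a)))" for y :: "nat \<Rightarrow> real"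
    by (simp add: exp_of_nat_mult[symmetric] exp_sum[symmetric] sum_negf sum_distrib_left)
  show "exp (- U) \<le> sea m p \<tau> / sea m p 0"
  proof -
    have "exp (- U) = (\<Prod>a<p. exp (- ((1 - cos d) * (1 / (cos (\<theta> a) + cos e)))) ^ (2 * m))"
      unfolding ex U sum_distrib_left ..
    also have "\<dots> \<le> (\<Prod>a<p. (1 - x a) ^ (2 * m))"
    proof (intro prod_mono conjI power_mono)
      fix a assume "a \<in> {..<p}"
      then have t: "1 + cos (\<theta> a) \<ge> 1 / 2" "cos (\<theta> a) + cos e > 0" using th by auto
      have cd: "cos (\<theta> a) + cos d > 0" using t(2) ce by linarith
      have "1 / (1 - x a) = 1 + (1 - cos d) / (cos (\<theta> a) + cos d)"
        using t cd by (simp add: x_def field_simps)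
      also have "\<dots> \<le> exp ((1 - cos d) / (cos (\<theta> a) + cos d))" by (rule exp_ge_add_one_self)
      \<comment> \<open>Here |\<open>\<tau>\<close>| <= pi enters: it gives |d| <= e and hence cos e
        <= cos d.\<close>
      also have "\<dots> \<le> exp ((1 - cos d) * (1 / (cos (\<theta> a) + cos e)))"
        using d1 t(2) cd ce by (auto intro!: divide_left_mono)
      finally have "1 / (1 - x a) \<le> exp ((1 - cos d) * (1 / (cos (\<theta> a) + cos e)))" .
      moreover have "1 - x a = (cos (\<theta> a) + cos d) / (1 + cos (\<theta> a))" using t by (simp add: x_def field_simps)
      then have "1 - x a > 0" using t cd by simp
      ultimately show "exp (- ((1 - cos d) * (1 / (cos (\<theta> a) + cos e)))) \<le> 1 - x a"
        unfolding exp_minus by (simp add: field_simps)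
    qed auto
    finally show ?thesis unfolding ratio .
  qed
  show "sea m p \<tau> / sea m p 0 \<le> exp (- ((1 - 2 * (1 - cos (pi / (3 * real p)))) * U))"
  proof -
    \<comment> \<open>The smallest loss that 1 + cos \<open>\<theta>\<close> >= 1/2 permits:
      replacing 1 by cos e in the denominator costs at most the factor 1 - \<open>\<eta>\<close>,
      and \<open>\<eta>\<close> tends to 0.\<close>
    define \<eta> where "\<eta> = 2 * (1 - cos e)"
    have "(\<Prod>a<p. (1 - x a) ^ (2 * m)) \<le> (\<Prod>a<p. exp (- ((1 - \<eta>) * (1 - cos d) * (1 / (cos (\<theta> a) + cos e)))) ^ (2 * m))"
    proof (intro prod_mono conjI power_mono)
      fix a assume "a \<in> {..<p}"
      then have t: "1 + cos (\<theta> a) \<ge> 1 / 2" "cos (\<theta> a) + cos e > 0" using th by auto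
      have "1 - x a = (cos (\<theta> a) + cos d) / (1 + cos (\<theta> a))" using t by (simp add: x_def field_simps)
      then show "0 \<le> 1 - x a" using t ce by simp
      then show "0 \<le> (1 - x a) ^ (2 * m)" by simp
      have "(1 - \<eta>) * (1 + cos (\<theta> a)) = 1 + cos (\<theta> a) - 2 * (1 - cos e) * (1 + cos (\<theta> a))" by (simp add: \<eta>_def algebra_simps)
      also have "\<dots> \<le> 1 + cos (\<theta> a) - 2 * (1 - cos e) * (1 / 2)" using t(1) by (intro diff_left_mono mult_left_mono) auto
      also have "\<dots> = cos (\<theta> a) + cos e" by (simp add: diff_divide_distrib)
      finally have "(1 - \<eta>) * (1 + cos (\<theta> a)) \<le> cos (\<theta> a) + cos e" .
      then have "(1 - \<eta>) / (cos (\<theta> a) + cos e) \<le> 1 / (1 + cos (\<theta> a))" using t by (simp add: field_simps)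
      then have "(1 - cos d) * ((1 - \<eta>) / (cos (\<theta> a) + cos e)) \<le> x a"
        unfolding x_def using mult_left_mono[OF _ d1] by fastforce
      then have "1 - x a \<le> 1 + (- ((1 - \<eta>) * (1 - cos d) * (1 / (cos (\<theta> a) + cos e))))" by (simp add: mult_ac)
      also have "\<dots> \<le> exp (- ((1 - \<eta>) * (1 - cos d) * (1 / (cos (\<theta> a) + cos e))))" by (rule exp_ge_add_one_self)
      finally show "1 - x a \<le> exp (- ((1 - \<eta>) * (1 - cos d) * (1 / (cos (\<theta> a) + cos e))))" .
    qed
    also have "\<dots> = exp (- ((1 - \<eta>) * U))"
      unfolding ex U sum_distrib_left by (simp add: mult_ac)
    finally show ?thesis unfolding ratio \<eta>_def e_def .
  qed
qed

text \<open>A sandwich: 1 - cos d behaves like \<open>\<tau>\<close>^2/(18 p^2) and sin e like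
  pi/(3p), so \<open>U\<close> tends to \<open>\<tau>\<close>^2/(2 pi
  \<open>\<rho>\<close>).\<close>

lemma sea_ratio_tendsto:
  fixes m p :: "nat \<Rightarrow> nat" and \<rho> \<tau> :: real
  assumes \<rho>: "\<rho> > 0" and p: "filterlim p at_top sequentially" "\<And>i. p i > 0"
    and mn: "(\<lambda>i. real (m i) / real (3 * p i)) \<longlonglongrightarrow> 1 / (sqrt 3 * \<rho>)" and \<tau>: "\<bar>\<tau>\<bar> \<le> pi"
  shows "(\<lambda>i. sea (m i) (p i) \<tau> / sea (m i) (p i) 0) \<longlonglongrightarrow> exp (- \<tau>\<^sup>2 / (2 * pi * \<rho>))"
proof -
  define U where "U i = real (m i) * ((1 - cos (\<tau> / (3 * real (p i)))) * sqrt 3 / sin (pi / (3 * real (p i))))" for i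
  have P: "filterlim (\<lambda>i. real (p i)) at_top sequentially"
    using p(1) by (rule filterlim_compose[OF filterlim_real_sequentially])
  have "((\<lambda>x. 3 * x * ((1 - cos (\<tau> / (3 * x))) / sin (pi / (3 * x)))) \<longlongrightarrow> \<tau>\<^sup>2 / (2 * pi)) at_top"
    by (real_asymp) (simp add: power2_eq_square field_simps)
  then have "(\<lambda>i. 3 * real (p i) * ((1 - cos (\<tau> / (3 * real (p i)))) / sin (pi / (3 * real (p i))))) \<longlonglongrightarrow> \<tau>\<^sup>2 / (2 * pi)"
    using P by (rule filterlim_compose)
  then have "(\<lambda>i. (real (m i) / real (3 * p i)) * (3 * real (p i) * ((1 - cos (\<tau> / (3 * real (p i)))) / sin (pi / (3 * real (p i))))) * sqrt 3)
      \<longlonglongrightarrow> (1 / (sqrt 3 * \<rho>)) * (\<tau>\<^sup>2 / (2 * pi)) * sqrt 3"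
    by (intro tendsto_mult mn tendsto_const)
  moreover have "(real (m i) / real (3 * p i)) * (3 * real (p i) * ((1 - cos (\<tau> / (3 * real (p i)))) / sin (pi / (3 * real (p i))))) * sqrt 3 = U i" for i
    using p(2)[of i] by (simp add: U_def)
  moreover have "(1 / (sqrt 3 * \<rho>)) * (\<tau>\<^sup>2 / (2 * pi)) * sqrt 3 = \<tau>\<^sup>2 / (2 * pi * \<rho>)" using \<rho> by simp
  ultimately have U: "U \<longlonglongrightarrow> \<tau>\<^sup>2 / (2 * pi * \<rho>)" by (simp only:)
  have "((\<lambda>x. 1 - 2 * (1 - cos (pi / (3 * x)))) \<longlongrightarrow> 1) at_top" by real_asymp
  then have "(\<lambda>i. 1 - 2 * (1 - cos (pi / (3 * real (p i))))) \<longlonglongrightarrow> 1" using P by (rule filterlim_compose)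
  then have up: "(\<lambda>i. exp (- ((1 - 2 * (1 - cos (pi / (3 * real (p i))))) * U i))) \<longlonglongrightarrow> exp (- (1 * (\<tau>\<^sup>2 / (2 * pi * \<rho>))))"
    by (intro tendsto_intros U)
  have lo: "(\<lambda>i. exp (- U i)) \<longlonglongrightarrow> exp (- (1 * (\<tau>\<^sup>2 / (2 * pi * \<rho>))))" using U by (auto intro!: tendsto_intros)
  have "(\<lambda>i. sea (m i) (p i) \<tau> / sea (m i) (p i) 0) \<longlonglongrightarrow> exp (- (1 * (\<tau>\<^sup>2 / (2 * pi * \<rho>))))"
    by (rule tendsto_sandwich[OF _ _ lo up]; rule always_eventually; rule allI)
      (use sea_ratio_bounds(2,3)[OF p(2) \<tau>] in \<open>simp_all add: U_def\<close>)
  then show ?thesis by simp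
qed

section \<open>Particles, holes and their limiting products\<close>

definition half_product :: "real \<Rightarrow> complex \<Rightarrow> complex" where
  "half_product r w = prodinf (\<lambda>i. 1 + w * of_real (r ^ (2 * i + 1)))"

lemma half_product_lim:
  assumes r: "0 < r" "r < 1"
  shows "(\<lambda>N. \<Prod>i<N. 1 + w * of_real (r ^ (2 * i + 1))) \<longlonglongrightarrow> half_product r w"
proof -
  have "summable (\<lambda>i. norm w * r * (r\<^sup>2) ^ i)"
    by (intro summable_mult summable_geometric) (use r in \<open>simp add: power_less_one_iff\<close>)
  then have "summable (\<lambda>i. norm (1 + w * of_real (r ^ (2 * i + 1)) - 1))"
    using r by (simp add: norm_mult norm_power power_mult[symmetric] mult_ac)
  then have "convergent_prod (\<lambda>i. 1 + w * of_real (r ^ (2 * i + 1)))"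
    by (intro abs_convergent_prod_imp_convergent_prod summable_imp_abs_convergent_prod)
  then show ?thesis
    using convergent_prod_LIMSEQ unfolding half_product_def LIMSEQ_lessThan_iff_atMost by blast
qed

lemma half_product_theta:
  assumes r: "0 < r" "r < 1"
  obtains Q :: real where "Q > 0" "\<And>w. w \<noteq> 0 \<Longrightarrow> half_product r w * half_product r (1 / w) = of_real Q * theta r w"
proof -
  obtain Q :: real where Q: "Q > 0" "\<And>w. w \<noteq> 0 \<Longrightarrow>
    (\<lambda>N. \<Prod>i<N. (1 + w * of_real (r ^ (2 * i + 1))) * (1 + of_real (r ^ (2 * i + 1)) / w)) \<longlonglongrightarrow> of_real Q * theta r w"
    using triple_product[OF r] by blast
  have "half_product r w * half_product r (1 / w) = of_real Q * theta r w" if w: "w \<noteq> 0" for w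
  proof (rule LIMSEQ_unique[OF _ Q(2)[OF w]])
    show "(\<lambda>N. \<Prod>i<N. (1 + w * of_real (r ^ (2 * i + 1))) * (1 + of_real (r ^ (2 * i + 1)) / w)) \<longlonglongrightarrow> half_product r w * half_product r (1 / w)"
      using tendsto_mult[OF half_product_lim[OF r, of w] half_product_lim[OF r, of "1 / w"]]
      by (simp add: prod.distrib)
  qed
  then show ?thesis using that Q(1) by blast
qed

text \<open>For |\<open>\<tau>\<close>| <= pi no mode leaves its cell of width 2 pi/(3p), so none
  crosses the Fermi point.\<close>

lemma offset_bounds:
  assumes p: "p > 0" and \<tau>: "\<bar>\<tau>\<bar> \<le> pi"
  shows "2 * pi * real i / (3 * real p) \<le> offset p \<tau> i" "offset p \<tau> i \<le> (2 * real i + 2) * pi / (3 * real p)"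
  unfolding offset_def using p \<tau> by (auto intro!: divide_right_mono simp: algebra_simps)

lemma offset_hole:
  assumes i: "i < p" and \<tau>: "\<bar>\<tau>\<bar> \<le> pi"
  shows "0 \<le> offset p \<tau> i" "offset p \<tau> i \<le> 2 * pi / 3"
proof -
  have p: "p > 0" using i by simp
  have "(0::real) \<le> 2 * pi * real i / (3 * real p)" by simp
  then show "0 \<le> offset p \<tau> i" using offset_bounds(1)[OF p \<tau>, of i] by linarith
  have "(2 * real i + 2) * pi / (3 * real p) \<le> (2 * real p) * pi / (3 * real p)"
    using i by (intro divide_right_mono mult_right_mono) auto
  also have "\<dots> = 2 * pi / 3" using p by simp
  finally show "offset p \<tau> i \<le> 2 * pi / 3" using offset_bounds(2)[OF p \<tau>, of i] by linarith
qed

text \<open>Modes of size at least 1 are rewritten as \<open>\<zeta>\<close> X (1 +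
  1/(\<open>\<zeta>\<close> X)), which produces the power of \<open>\<zeta>\<close>, the sea and the
  hole factors. What remains are factors that decay away from the Fermi points.\<close>

lemma mode_product:
  fixes \<zeta> :: complex
  assumes p: "p > 0" and \<tau>: "\<bar>\<tau>\<bar> \<le> pi" and \<zeta>: "\<zeta> \<noteq> 0"
  shows "(\<Prod>b<3 * p. 1 + \<zeta> * of_real ((2 * cos ((2 * pi * real b + pi + \<tau>) / (6 * real p))) ^ (2 * m)))
    = \<zeta> ^ (2 * p) * of_real (sea m p \<tau>)
      * ((\<Prod>i<p - p div 2. 1 + \<zeta> * of_real (mode (offset p \<tau> i) ^ m)) * (\<Prod>i<p div 2. 1 + \<zeta> * of_real (mode (offset p (- \<tau>) i) ^ m)))
      * ((\<Prod>i<p. 1 + (1 / \<zeta>) * of_real ((1 / mode (- offset p (- \<tau>) i)) ^ m)) * (\<Prod>i<p. 1 + (1 / \<zeta>) * of_real ((1 / mode (- offset p \<tau> i)) ^ m)))"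
proof -
  define A where "A b = (2 * pi * real b + pi + \<tau>) / (6 * real p)" for b
  define f where "f b = 1 + \<zeta> * of_real ((2 * cos (A b)) ^ (2 * m))" for b
  have sq: "(2 * cos x) ^ (2 * m) = mode s ^ m" if "x = (2 * pi / 3 + s) / 2 \<or> pi - x = (2 * pi / 3 + s) / 2" for x s
  proof -
    have "(2 * cos x)\<^sup>2 = (2 * cos (pi - x))\<^sup>2" by simp
    then have "(2 * cos x)\<^sup>2 = mode s" unfolding mode_eq using that by metis
    then show ?thesis by (simp add: power_mult)
  qed
  have split: "(\<Prod>i<a + k. g i) = (\<Prod>i<a. g i) * (\<Prod>i<k. g (a + i))" for g :: "nat \<Rightarrow> complex" and a k
    by (induction k) (simp_all add: mult_ac)
  define q1 where "q1 = p - p div 2"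
  define q2 where "q2 = p div 2"
  have q: "q1 + q2 = p" by (simp add: q1_def q2_def)
  \<comment> \<open>Four blocks: the holes at the first Fermi point, the particles split in the
    middle so that each is measured from the nearer Fermi point, and the holes at the second one.
    The last two blocks use the reflection x to pi - x.\<close>
  have "3 * p = p + (q1 + (q2 + p))" using q by simp
  then have "(\<Prod>b<3 * p. f b) = (\<Prod>b<p. f b) * ((\<Prod>i<q1. f (p + i)) * ((\<Prod>i<q2. f (p + (q1 + i))) * (\<Prod>i<p. f (p + (q1 + (q2 + i))))))"
    by (simp only: split)
  also have "(\<Prod>b<p. f b) = (\<Prod>i<p. f (p - Suc i))" by (rule prod.nat_diff_reindex[symmetric])
  also have "\<dots> = (\<Prod>i<p. 1 + \<zeta> * of_real (mode (- offset p (- \<tau>) i) ^ m))"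
  proof (rule prod.cong[OF refl])
    fix i assume "i \<in> {..<p}"
    then have "real (p - Suc i) = real p - real i - 1" by simp
    then have "A (p - Suc i) = (2 * pi / 3 + (- offset p (- \<tau>) i)) / 2"
      unfolding A_def offset_def using p by (simp add: field_simps)
    then show "f (p - Suc i) = 1 + \<zeta> * of_real (mode (- offset p (- \<tau>) i) ^ m)" unfolding f_def by (subst sq) auto
  qed
  also have "(\<Prod>i<q1. f (p + i)) = (\<Prod>i<q1. 1 + \<zeta> * of_real (mode (offset p \<tau> i) ^ m))"
  proof (rule prod.cong[OF refl])
    fix i
    have "A (p + i) = (2 * pi / 3 + offset p \<tau> i) / 2"
      unfolding A_def offset_def using p by (simp add: field_simps)
    then show "f (p + i) = 1 + \<zeta> * of_real (mode (offset p \<tau> i) ^ m)" unfolding f_def by (subst sq) auto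
  qed
  also have "(\<Prod>i<q2. f (p + (q1 + i))) = (\<Prod>i<q2. f (p + (q1 + (q2 - Suc i))))" by (rule prod.nat_diff_reindex[symmetric])
  also have "\<dots> = (\<Prod>i<q2. 1 + \<zeta> * of_real (mode (offset p (- \<tau>) i) ^ m))"
  proof (rule prod.cong[OF refl])
    fix i assume "i \<in> {..<q2}"
    then have r: "real (p + (q1 + (q2 - Suc i))) = 2 * real p - real i - 1" using q by auto
    have "pi - A (p + (q1 + (q2 - Suc i))) = (2 * pi / 3 + offset p (- \<tau>) i) / 2"
      unfolding A_def offset_def r using p by (simp add: field_simps)
    then show "f (p + (q1 + (q2 - Suc i))) = 1 + \<zeta> * of_real (mode (offset p (- \<tau>) i) ^ m)" unfolding f_def by (subst sq) auto
  qed
  also have "(\<Prod>i<p. f (p + (q1 + (q2 + i)))) = (\<Prod>i<p. 1 + \<zeta> * of_real (mode (- offset p \<tau> i) ^ m))"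
  proof (rule prod.cong[OF refl])
    fix i
    have "real (p + (q1 + (q2 + i))) = 2 * real p + real i" using q by simp
    then have "pi - A (p + (q1 + (q2 + i))) = (2 * pi / 3 + (- offset p \<tau> i)) / 2"
      unfolding A_def offset_def using p by (simp add: field_simps)
    then show "f (p + (q1 + (q2 + i))) = 1 + \<zeta> * of_real (mode (- offset p \<tau> i) ^ m)" unfolding f_def by (subst sq) auto
  qed
  finally have E: "(\<Prod>b<3 * p. f b) = (\<Prod>i<p. 1 + \<zeta> * of_real (mode (- offset p (- \<tau>) i) ^ m)) *
      ((\<Prod>i<q1. 1 + \<zeta> * of_real (mode (offset p \<tau> i) ^ m)) *
      ((\<Prod>i<q2. 1 + \<zeta> * of_real (mode (offset p (- \<tau>) i) ^ m)) * (\<Prod>i<p. 1 + \<zeta> * of_real (mode (- offset p \<tau> i) ^ m))))" .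
  have hole: "(\<Prod>i<p. 1 + \<zeta> * of_real (mode (- offset p t i) ^ m))
      = \<zeta> ^ p * of_real (\<Prod>i<p. mode (- offset p t i) ^ m) * (\<Prod>i<p. 1 + (1 / \<zeta>) * of_real ((1 / mode (- offset p t i)) ^ m))" if t: "\<bar>t\<bar> \<le> pi" for t
  proof -
    have "(\<Prod>i<p. 1 + \<zeta> * of_real (mode (- offset p t i) ^ m))
       = (\<Prod>i<p. (\<zeta> * of_real (mode (- offset p t i) ^ m)) * (1 + (1 / \<zeta>) * of_real ((1 / mode (- offset p t i)) ^ m)))"
    proof (rule prod.cong[OF refl])
      fix i assume i: "i \<in> {..<p}"
      have "mode (- offset p t i) > 0" using inverse_mode_le_exp(1) offset_hole[of i p t] i t by simp
      then show "1 + \<zeta> * of_real (mode (- offset p t i) ^ m) = (\<zeta> * of_real (mode (- offset p t i) ^ m)) * (1 + (1 / \<zeta>) * of_real ((1 / mode (- offset p t i)) ^ m))"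
        using \<zeta> by (simp add: field_simps)
    qed
    then show ?thesis by (simp add: prod.distrib)
  qed
  have \<tau>': "\<bar>- \<tau>\<bar> \<le> pi" using \<tau> by simp
  have S: "sea m p \<tau> = (\<Prod>i<p. mode (- offset p \<tau> i) ^ m) * (\<Prod>i<p. mode (- offset p (- \<tau>) i) ^ m)"
    unfolding sea_def power_mult_distrib prod.distrib ..
  have "(\<Prod>b<3 * p. f b) = \<zeta> ^ (2 * p) * of_real (sea m p \<tau>)
      * ((\<Prod>i<q1. 1 + \<zeta> * of_real (mode (offset p \<tau> i) ^ m)) * (\<Prod>i<q2. 1 + \<zeta> * of_real (mode (offset p (- \<tau>) i) ^ m)))
      * ((\<Prod>i<p. 1 + (1 / \<zeta>) * of_real ((1 / mode (- offset p (- \<tau>) i)) ^ m)) * (\<Prod>i<p. 1 + (1 / \<zeta>) * of_real ((1 / mode (- offset p \<tau> i)) ^ m)))"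
    unfolding E hole[OF \<tau>] hole[OF \<tau>'] S of_real_mult mult_2 power_add by (simp only: mult_ac)
  then show ?thesis unfolding f_def A_def q1_def q2_def .
qed

text \<open>With n = 3p the Fermi points fall between blocks of p modes. \<open>r\<close> belongs to
  half the mode spacing: a full step of 2 pi in the scaled angle gives r^2.\<close>

locale scaling_limit =
  fixes m p :: "nat \<Rightarrow> nat" and \<rho> r :: real
  assumes rho: "\<rho> > 0" and p: "filterlim p at_top sequentially" "\<And>j. p j > 0"
    and mn: "(\<lambda>j. real (m j) / real (3 * p j)) \<longlonglongrightarrow> 1 / (sqrt 3 * \<rho>)"
    and r: "r = exp (- pi / \<rho>)"
begin

lemma r01: "0 < r" "r < 1"
  using rho by (auto simp: r)

lemma n_at_top: "filterlim (\<lambda>j. 3 * p j) at_top sequentially"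
  unfolding filterlim_at_top
proof
  fix Z show "\<forall>\<^sub>F j in sequentially. Z \<le> 3 * p j"
    using p(1)[unfolded filterlim_at_top, rule_format, of Z] by eventually_elim simp
qed

lemma offset_limit:
  "exp (- (2 * pi * (real i + 1/2) + \<tau>) / \<rho>) = r ^ (2 * i + 1) * exp (- \<tau> / \<rho>)"
proof -
  have "r ^ (2 * i + 1) = exp (real (2 * i + 1) * (- pi / \<rho>))" unfolding r by (rule exp_of_nat_mult[symmetric])
  then show ?thesis using rho by (simp add: exp_add[symmetric] field_simps)
qed

lemma particle_tendsto:
  "(\<lambda>j. mode (offset (p j) \<tau> i) ^ m j) \<longlonglongrightarrow> r ^ (2 * i + 1) * exp (- \<tau> / \<rho>)"
  using mode_power_tendsto[OF rho n_at_top mn, of "2 * pi * (real i + 1/2) + \<tau>"]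
  unfolding offset_limit offset_def by simp

lemma hole_tendsto:
  "(\<lambda>j. (1 / mode (- offset (p j) \<tau> i)) ^ m j) \<longlonglongrightarrow> r ^ (2 * i + 1) * exp (- \<tau> / \<rho>)"
proof -
  define s where "s = 2 * pi * (real i + 1/2) + \<tau>"
  have "(\<lambda>j. 1 / mode (- s / real (3 * p j)) ^ m j) \<longlonglongrightarrow> 1 / exp (- (- s) / \<rho>)"
    by (intro tendsto_divide tendsto_const mode_power_tendsto[OF rho n_at_top mn]) simp
  also have "1 / exp (- (- s) / \<rho>) = r ^ (2 * i + 1) * exp (- \<tau> / \<rho>)"
    unfolding offset_limit[symmetric] s_def[symmetric] by (simp add: exp_minus inverse_eq_divide)
  finally show ?thesis unfolding offset_def s_def[symmetric] by (simp add: power_one_over)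
qed

text \<open>Eventually m/n exceeds half its limit, and the i-th offset is at least 2 pi i/n;
  inserted into the rate 1/4 of the mode estimates this yields the exponent.\<close>

definition decay :: real where
  "decay = exp (- pi / (4 * sqrt 3 * \<rho>))"

lemma decay01: "0 < decay" "decay < 1"
  using rho by (auto simp: decay_def)

lemma offset_decay:
  assumes \<tau>: "\<bar>\<tau>\<bar> \<le> pi"
  shows "\<forall>\<^sub>F j in sequentially. \<forall>i. exp (- offset (p j) \<tau> i / 4) ^ m j \<le> decay ^ i"
proof -
  have "1 / (sqrt 3 * \<rho>) > 1 / (2 * sqrt 3 * \<rho>)" using rho by (simp add: field_simps)
  then have "\<forall>\<^sub>F j in sequentially. real (m j) / real (3 * p j) > 1 / (2 * sqrt 3 * \<rho>)" by (rule order_tendstoD(1)[OF mn])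
  then show ?thesis
  proof (eventually_elim, intro allI)
    fix j i assume j: "real (m j) / real (3 * p j) > 1 / (2 * sqrt 3 * \<rho>)"
    have "real i * (pi / (4 * sqrt 3 * \<rho>)) = (1 / (2 * sqrt 3 * \<rho>)) * (real i * pi / 2)" by simp
    also have "\<dots> \<le> (real (m j) / real (3 * p j)) * (real i * pi / 2)" using j by (intro mult_right_mono) auto
    also have "\<dots> = real (m j) * ((2 * pi * real i / (3 * real (p j))) / 4)" by simp
    also have "\<dots> \<le> real (m j) * (offset (p j) \<tau> i / 4)"
      by (intro mult_left_mono divide_right_mono offset_bounds(1) p \<tau>) auto
    finally have "real (m j) * (- offset (p j) \<tau> i / 4) \<le> real i * (- pi / (4 * sqrt 3 * \<rho>))" by simp
    then show "exp (- offset (p j) \<tau> i / 4) ^ m j \<le> decay ^ i"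
      unfolding decay_def exp_of_nat_mult[symmetric] by simp
  qed
qed

lemma summable_decay: "summable (\<lambda>i. norm \<zeta> * decay ^ i)"
  using decay01 by (intro summable_mult summable_geometric) auto

lemma particle_product_tendsto:
  fixes \<zeta> :: complex
  assumes \<tau>: "\<bar>\<tau>\<bar> \<le> pi" and K: "filterlim K at_top sequentially" "\<And>j. 2 * K j \<le> p j + 1"
  shows "(\<lambda>j. \<Prod>i<K j. 1 + \<zeta> * of_real (mode (offset (p j) \<tau> i) ^ m j)) \<longlonglongrightarrow> half_product r (\<zeta> * exp (- \<tau> / \<rho>))"
proof (rule prod_tendsto_dominated[OF summable_decay[of \<zeta>] _ _ _ K(1)])
  show "(\<lambda>j. \<zeta> * of_real (mode (offset (p j) \<tau> i) ^ m j)) \<longlonglongrightarrow> \<zeta> * of_real (r ^ (2 * i + 1) * exp (- \<tau> / \<rho>))" for i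
    by (intro tendsto_intros particle_tendsto)
  show "(\<lambda>N. \<Prod>i<N. 1 + \<zeta> * of_real (r ^ (2 * i + 1) * exp (- \<tau> / \<rho>))) \<longlonglongrightarrow> half_product r (\<zeta> * exp (- \<tau> / \<rho>))"
    using half_product_lim[OF r01, of "\<zeta> * exp (- \<tau> / \<rho>)"] by (simp add: mult_ac exp_of_real)
  have "\<forall>\<^sub>F j in sequentially. 2 \<le> p j" using p(1) by (simp add: filterlim_at_top)
  then show "\<forall>\<^sub>F j in sequentially. \<forall>i<K j. norm (\<zeta> * of_real (mode (offset (p j) \<tau> i) ^ m j)) \<le> norm \<zeta> * decay ^ i"
    using offset_decay[OF \<tau>]
  proof (eventually_elim, intro allI impI)
    fix j i assume j: "2 \<le> p j" "\<forall>i. exp (- offset (p j) \<tau> i / 4) ^ m j \<le> decay ^ i" and i: "i < K j"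
    have "0 \<le> offset (p j) \<tau> i"
      using offset_bounds(1)[OF p(2) \<tau>, of i j] by (smt (verit) divide_nonneg_nonneg mult_nonneg_nonneg of_nat_0_le_iff pi_ge_zero)
    \<comment> \<open>Taking only about half of the particles, with p at least 2, keeps the offset
      below pi/2, where \<open>mode_le_exp\<close> is available.\<close>
    moreover have "real ((2 * i + 2) * 2) \<le> real (3 * p j)" using K(2)[of j] i j(1) by (subst of_nat_le_iff) presburger
    then have "(2 * real i + 2) * 2 \<le> 3 * real (p j)" by simp
    then have "(2 * real i + 2) * 2 * pi \<le> 3 * real (p j) * pi" by (intro mult_right_mono) auto
    then have "(2 * real i + 2) * pi / (3 * real (p j)) \<le> pi / 2" using p(2)[of j] by (simp add: field_simps)
    then have "offset (p j) \<tau> i \<le> pi / 2" using offset_bounds(2)[OF p(2) \<tau>, of j i] by linarith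
    ultimately have "mode (offset (p j) \<tau> i) \<le> exp (- offset (p j) \<tau> i / 4)" by (rule mode_le_exp)
    then have "mode (offset (p j) \<tau> i) ^ m j \<le> exp (- offset (p j) \<tau> i / 4) ^ m j" by (rule power_mono[OF _ mode_nonneg])
    also have "\<dots> \<le> decay ^ i" using j(2) by blast
    finally show "norm (\<zeta> * of_real (mode (offset (p j) \<tau> i) ^ m j)) \<le> norm \<zeta> * decay ^ i"
      using mode_nonneg by (auto simp: norm_mult norm_power intro!: mult_left_mono)
  qed
qed (use decay01 in auto)

lemma hole_product_tendsto:
  fixes \<zeta> :: complex
  assumes \<tau>: "\<bar>\<tau>\<bar> \<le> pi"
  shows "(\<lambda>j. \<Prod>i<p j. 1 + \<zeta> * of_real ((1 / mode (- offset (p j) \<tau> i)) ^ m j)) \<longlonglongrightarrow> half_product r (\<zeta> * exp (- \<tau> / \<rho>))"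
proof (rule prod_tendsto_dominated[OF summable_decay[of \<zeta>] _ _ _ p(1)])
  show "(\<lambda>j. \<zeta> * of_real ((1 / mode (- offset (p j) \<tau> i)) ^ m j)) \<longlonglongrightarrow> \<zeta> * of_real (r ^ (2 * i + 1) * exp (- \<tau> / \<rho>))" for i
    by (intro tendsto_mult tendsto_const tendsto_of_real hole_tendsto)
  show "(\<lambda>N. \<Prod>i<N. 1 + \<zeta> * of_real (r ^ (2 * i + 1) * exp (- \<tau> / \<rho>))) \<longlonglongrightarrow> half_product r (\<zeta> * exp (- \<tau> / \<rho>))"
    using half_product_lim[OF r01, of "\<zeta> * exp (- \<tau> / \<rho>)"] by (simp add: mult_ac exp_of_real)
  show "\<forall>\<^sub>F j in sequentially. \<forall>i<p j. norm (\<zeta> * of_real ((1 / mode (- offset (p j) \<tau> i)) ^ m j)) \<le> norm \<zeta> * decay ^ i"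
    using offset_decay[OF \<tau>]
  proof (eventually_elim, intro allI impI)
    fix j i assume j: "\<forall>i. exp (- offset (p j) \<tau> i / 4) ^ m j \<le> decay ^ i" and i: "i < p j"
    note le = inverse_mode_le_exp[OF offset_hole[OF i \<tau>]]
    have nn: "0 \<le> 1 / mode (- offset (p j) \<tau> i)" using le(1) by simp
    have "(1 / mode (- offset (p j) \<tau> i)) ^ m j \<le> exp (- offset (p j) \<tau> i / 4) ^ m j" by (rule power_mono[OF le(2) nn])
    also have "\<dots> \<le> decay ^ i" using j by blast
    finally have "norm \<zeta> * (1 / mode (- offset (p j) \<tau> i)) ^ m j \<le> norm \<zeta> * decay ^ i" by (rule mult_left_mono) simp
    moreover have "norm (of_real ((1 / mode (- offset (p j) \<tau> i)) ^ m j) :: complex) = (1 / mode (- offset (p j) \<tau> i)) ^ m j"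
      unfolding norm_of_real using nn by (intro abs_of_nonneg zero_le_power)
    ultimately show "norm (\<zeta> * of_real ((1 / mode (- offset (p j) \<tau> i)) ^ m j)) \<le> norm \<zeta> * decay ^ i"
      unfolding norm_mult by simp
  qed
qed (use decay01 in auto)

text \<open>Particles and holes at the same Fermi point recombine to one theta function by the
  triple product, so two Fermi points give two thetas and a squared constant; the ratio of the seas
  supplies the Gaussian.\<close>

lemma mode_product_tendsto:
  obtains Q :: real where "Q > 0" "\<And>(\<zeta> :: complex) \<tau>. \<zeta> \<noteq> 0 \<Longrightarrow> \<bar>\<tau>\<bar> \<le> pi \<Longrightarrow>
    (\<lambda>j. (\<Prod>b<3 * p j. 1 + \<zeta> * of_real ((2 * cos ((2 * pi * real b + pi + \<tau>) / (6 * real (p j)))) ^ (2 * m j)))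
       / (\<zeta> ^ (2 * p j) * of_real (sea (m j) (p j) 0)))
    \<longlonglongrightarrow> of_real (Q * exp (- \<tau>\<^sup>2 / (2 * pi * \<rho>))) * (theta r (\<zeta> * exp (- \<tau> / \<rho>)) * theta r (\<zeta> * exp (\<tau> / \<rho>)))"
proof -
  obtain Q0 :: real where Q0: "Q0 > 0" "\<And>w. w \<noteq> 0 \<Longrightarrow> half_product r w * half_product r (1 / w) = of_real Q0 * theta r w"
    using half_product_theta[OF r01] by blast
  define F where "F \<zeta> \<tau> j = (\<Prod>b<3 * p j. 1 + \<zeta> * of_real ((2 * cos ((2 * pi * real b + pi + \<tau>) / (6 * real (p j)))) ^ (2 * m j)))
       / (\<zeta> ^ (2 * p j) * of_real (sea (m j) (p j) 0))" for \<zeta> :: complex and \<tau> j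
  have "F \<zeta> \<tau> \<longlonglongrightarrow> of_real (Q0 * Q0 * exp (- \<tau>\<^sup>2 / (2 * pi * \<rho>))) * (theta r (\<zeta> * exp (- \<tau> / \<rho>)) * theta r (\<zeta> * exp (\<tau> / \<rho>)))"
    if \<zeta>: "\<zeta> \<noteq> 0" and \<tau>: "\<bar>\<tau>\<bar> \<le> pi" for \<zeta> \<tau>
  proof -
    have \<tau>': "\<bar>- \<tau>\<bar> \<le> pi" using \<tau> by simp
    define P1 where "P1 j = (\<Prod>i<p j - p j div 2. 1 + \<zeta> * of_real (mode (offset (p j) \<tau> i) ^ m j))" for j
    define P2 where "P2 j = (\<Prod>i<p j div 2. 1 + \<zeta> * of_real (mode (offset (p j) (- \<tau>) i) ^ m j))" for j
    define H1 where "H1 j = (\<Prod>i<p j. 1 + (1 / \<zeta>) * of_real ((1 / mode (- offset (p j) (- \<tau>) i)) ^ m j))" for j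
    define H2 where "H2 j = (\<Prod>i<p j. 1 + (1 / \<zeta>) * of_real ((1 / mode (- offset (p j) \<tau> i)) ^ m j))" for j
    have half: "filterlim (\<lambda>j. p j div 2) at_top sequentially" "filterlim (\<lambda>j. p j - p j div 2) at_top sequentially"
    proof -
      have "\<forall>\<^sub>F j in sequentially. Z \<le> p j div 2" "\<forall>\<^sub>F j in sequentially. Z \<le> p j - p j div 2" for Z
        using p(1)[unfolded filterlim_at_top, rule_format, of "2 * Z"] by (eventually_elim, simp)+
      then show "filterlim (\<lambda>j. p j div 2) at_top sequentially" "filterlim (\<lambda>j. p j - p j div 2) at_top sequentially"
        by (simp_all add: filterlim_at_top)
    qed
    have lim: "P1 \<longlonglongrightarrow> half_product r (\<zeta> * exp (- \<tau> / \<rho>))" "P2 \<longlonglongrightarrow> half_product r (\<zeta> * exp (- (- \<tau>) / \<rho>))"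
      "H1 \<longlonglongrightarrow> half_product r ((1 / \<zeta>) * exp (- (- \<tau>) / \<rho>))" "H2 \<longlonglongrightarrow> half_product r ((1 / \<zeta>) * exp (- \<tau> / \<rho>))"
      unfolding P1_def P2_def H1_def H2_def
      by (intro particle_product_tendsto hole_product_tendsto half \<tau> \<tau>'; simp)+
    have F: "F \<zeta> \<tau> j = of_real (sea (m j) (p j) \<tau> / sea (m j) (p j) 0) * ((P1 j * P2 j) * (H1 j * H2 j))" for j
    proof -
      have "sea (m j) (p j) 0 > 0" by (rule sea_ratio_bounds(1)[OF p(2) \<tau>])
      then show ?thesis unfolding F_def mode_product[OF p(2) \<tau> \<zeta>] P1_def[symmetric] P2_def[symmetric] H1_def[symmetric] H2_def[symmetric]
        using \<zeta> by (simp add: field_simps)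
    qed
    have L: "F \<zeta> \<tau> \<longlonglongrightarrow> of_real (exp (- \<tau>\<^sup>2 / (2 * pi * \<rho>))) *
      ((half_product r (\<zeta> * exp (- \<tau> / \<rho>)) * half_product r (\<zeta> * exp (- (- \<tau>) / \<rho>))) *
       (half_product r ((1 / \<zeta>) * exp (- (- \<tau>) / \<rho>)) * half_product r ((1 / \<zeta>) * exp (- \<tau> / \<rho>))))"
      unfolding F by (intro tendsto_mult tendsto_of_real lim sea_ratio_tendsto[OF rho p mn \<tau>])
    \<comment> \<open>\<open>w1\<close> belongs to the first Fermi point and \<open>w2\<close> to
      the second; holes carry the opposite displacement, which makes their arguments the
      inverses.\<close>
    define w1 where "w1 = \<zeta> * exp (- \<tau> / \<rho>)"
    define w2 where "w2 = \<zeta> * exp (\<tau> / \<rho>)"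
    have w: "w1 \<noteq> 0" "w2 \<noteq> 0" "(1 / \<zeta>) * exp (- (- \<tau>) / \<rho>) = 1 / w1" "(1 / \<zeta>) * exp (- \<tau> / \<rho>) = 1 / w2"
      using \<zeta> by (simp_all add: w1_def w2_def exp_minus field_simps)
    have e: "\<zeta> * exp (- (- \<tau>) / \<rho>) = w2" by (simp add: w2_def)
    have "(half_product r w1 * half_product r w2) * (half_product r (1 / w1) * half_product r (1 / w2))
      = (half_product r w1 * half_product r (1 / w1)) * (half_product r w2 * half_product r (1 / w2))" by (simp only: mult_ac)
    also have "\<dots> = of_real (Q0 * Q0) * (theta r w1 * theta r w2)" unfolding Q0(2)[OF w(1)] Q0(2)[OF w(2)] by simp
    finally show ?thesis using L unfolding w(3,4) e w1_def[symmetric] w2_def[symmetric] by (simp add: mult_ac)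
  qed
  then show ?thesis using that[of "Q0 * Q0"] Q0(1) unfolding F_def by simp
qed

end

section \<open>Asymptotics of the number of dimer configurations\<close>

definition ksign :: "int \<Rightarrow> int \<Rightarrow> real" where
  "ksign a b = (if even (a * b) then 1 else - 1)"

lemma ksign_square: "ksign a b * ksign a b = 1" "\<bar>ksign a b\<bar> = 1"
  by (auto simp: ksign_def)

lemma cis_pi_int: "cis (of_int k * pi) = (if even k then 1 else - 1)"
proof -
  have "cis (of_int k * pi) = (- 1) powi k" by (metis cis_pi cis_power_int)
  then show ?thesis by (simp add: power_int_minus_left)
qed

text \<open>The constant from \<open>mode_product_tendsto\<close> is only known to exist; fixing it
  as a parameter lets the definitions below refer to it.\<close>

locale dimer_limit = scaling_limit +
  fixes Q :: real
  assumes m_pos: "\<And>j. m j > 0" and Q: "Q > 0"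
    and modes: "\<And>(\<zeta> :: complex) \<tau>. \<zeta> \<noteq> 0 \<Longrightarrow> \<bar>\<tau>\<bar> \<le> pi \<Longrightarrow>
      (\<lambda>j. (\<Prod>b<3 * p j. 1 + \<zeta> * of_real ((2 * cos ((2 * pi * real b + pi + \<tau>) / (6 * real (p j)))) ^ (2 * m j)))
         / (\<zeta> ^ (2 * p j) * of_real (sea (m j) (p j) 0)))
      \<longlonglongrightarrow> of_real (Q * exp (- \<tau>\<^sup>2 / (2 * pi * \<rho>))) * (theta r (\<zeta> * exp (- \<tau> / \<rho>)) * theta r (\<zeta> * exp (\<tau> / \<rho>)))"
begin

definition configs :: "nat \<Rightarrow> edge set set" where
  "configs j = dimers (m j) (3 * p j)"

text \<open>Centred at the number 2p of modes in the sea, in accordance with the factor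
  \<open>\<zeta> ^ (2 * p j)\<close> that is divided out. The horizontal winding number is its
  negative.\<close>

definition drift :: "nat \<Rightarrow> edge set \<Rightarrow> int" where
  "drift j M = int (path_count (m j) M) - 2 * int (p j)"

definition turns :: "nat \<Rightarrow> edge set \<Rightarrow> int" where
  "turns j M = path_turns (3 * p j) M"

definition base :: "nat \<Rightarrow> real" where
  "base j = sea (m j) (p j) 0"

definition signed_sum :: "complex \<Rightarrow> real \<Rightarrow> nat \<Rightarrow> complex" where
  "signed_sum \<zeta> \<tau> j = (\<Sum>M\<in>configs j. of_real (ksign (drift j M) (turns j M) / base j) * \<zeta> powi drift j M * cis (of_int (turns j M) * \<tau>))"

definition unsigned_sum :: "complex \<Rightarrow> real \<Rightarrow> nat \<Rightarrow> complex" where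
  "unsigned_sum \<zeta> \<tau> j = (\<Sum>M\<in>configs j. of_real (1 / base j) * \<zeta> powi drift j M * cis (of_int (turns j M) * \<tau>))"

definition signed_limit :: "complex \<Rightarrow> real \<Rightarrow> complex" where
  "signed_limit \<zeta> \<tau> = of_real (Q * exp (- \<tau>\<^sup>2 / (2 * pi * \<rho>))) * (theta r (\<zeta> * exp (- \<tau> / \<rho>)) * theta r (\<zeta> * exp (\<tau> / \<rho>)))"

definition unsigned_limit :: "complex \<Rightarrow> real \<Rightarrow> complex" where
  "unsigned_limit \<zeta> \<tau> = (signed_limit \<zeta> \<tau> + signed_limit (- \<zeta>) \<tau> + signed_limit \<zeta> (\<tau> + pi) - signed_limit (- \<zeta>) (\<tau> + pi)) / 2"

lemma n2: "3 * p j \<ge> 2"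
  using p(2)[of j] by simp

lemma finite_configs: "finite (configs j)"
  unfolding configs_def by (rule finite_dimers(1)[OF m_pos n2])

lemma base_pos: "base j > 0"
  unfolding base_def by (rule sea_ratio_bounds(1)[OF p(2), of 0]) simp

text \<open>Evaluating at -\<open>\<zeta>\<close> and shifting the angle by pi multiplies the sign
  (-1)^(k + (k - 1)l) by (-1)^(k + l), which leaves (-1)^(kl). Since 2p is even, k may be replaced
  by the drift.\<close>

lemma signed_sum_eq:
  assumes \<zeta>: "\<zeta> \<noteq> 0"
  shows "signed_sum \<zeta> \<tau> j = (\<Prod>b<3 * p j. 1 + \<zeta> * of_real ((2 * cos ((2 * pi * real b + pi + \<tau>) / (6 * real (p j)))) ^ (2 * m j)))
         / (\<zeta> ^ (2 * p j) * of_real (sea (m j) (p j) 0))"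
proof -
  define n where "n = 3 * p j"
  define \<phi> :: complex where "\<phi> = of_real ((\<tau> + pi) / (2 * real n))"
  have n: "n > 0" using p(2)[of j] by (simp add: n_def)
  have "(\<Prod>b<n. 1 - (- \<zeta>) * (2 * cos (\<phi> + of_real (pi * real b / real n))) ^ (2 * m j))
     = (\<Sum>M\<in>configs j. (if even (int (path_count (m j) M) + (int (path_count (m j) M) - 1) * path_turns n M) then 1 else -1)
       * (- \<zeta>) ^ path_count (m j) M * exp (2 * of_nat n * of_int (path_turns n M) * \<i> * \<phi>))"
    unfolding configs_def n_def[symmetric] by (rule signed_partition_function[symmetric, OF m_pos]) (use n2 n_def in simp)
  also have "\<dots> = (\<Sum>M\<in>configs j. of_real (ksign (drift j M) (turns j M)) * \<zeta> ^ path_count (m j) M * cis (of_int (turns j M) * \<tau>))"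
  proof (rule sum.cong[OF refl])
    fix M
    define k where "k = path_count (m j) M"
    define l where "l = path_turns n M"
    have e: "exp (2 * of_nat n * of_int l * \<i> * \<phi>) = cis (of_int l * \<tau>) * cis (of_int l * pi)"
    proof -
      have "2 * of_nat n * \<phi> = of_real (\<tau> + pi)" unfolding \<phi>_def using n by (simp del: of_real_add)
      then have eq: "2 * of_nat n * of_int l * \<i> * \<phi> = \<i> * of_real (of_int l * \<tau> + of_int l * pi)"
        by (simp add: algebra_simps) (metis distrib_left mult.commute mult.left_commute)
      show ?thesis unfolding cis_mult unfolding eq cis_conv_exp ..
    qed
    have "even (drift j M * l) \<longleftrightarrow> even (int k * l)" by (simp add: drift_def k_def)
    then have ks: "ksign (drift j M) l = (if even (int k * l) then 1 else - 1)" by (simp add: ksign_def)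
    have "(if even (int k + (int k - 1) * l) then 1 else -1) * (- \<zeta>) ^ k * (cis (of_int l * \<tau>) * cis (of_int l * pi))
      = of_real (ksign (drift j M) l) * \<zeta> ^ k * cis (of_int l * \<tau>)"
      unfolding ks cis_pi_int power_minus[of \<zeta>] by (cases "even k"; cases "even l") (simp_all add: mult_ac)
    then show "(if even (int (path_count (m j) M) + (int (path_count (m j) M) - 1) * path_turns n M) then 1 else -1)
       * (- \<zeta>) ^ path_count (m j) M * exp (2 * of_nat n * of_int (path_turns n M) * \<i> * \<phi>)
       = of_real (ksign (drift j M) (turns j M)) * \<zeta> ^ path_count (m j) M * cis (of_int (turns j M) * \<tau>)"
      unfolding turns_def n_def[symmetric] l_def[symmetric] k_def[symmetric] e .
  qed
  finally have P: "(\<Prod>b<n. 1 - (- \<zeta>) * (2 * cos (\<phi> + of_real (pi * real b / real n))) ^ (2 * m j)) = \<dots>" .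
  have "(\<Prod>b<3 * p j. 1 + \<zeta> * of_real ((2 * cos ((2 * pi * real b + pi + \<tau>) / (6 * real (p j)))) ^ (2 * m j)))
    = (\<Prod>b<n. 1 - (- \<zeta>) * (2 * cos (\<phi> + of_real (pi * real b / real n))) ^ (2 * m j))"
    unfolding n_def[symmetric]
  proof (rule prod.cong[OF refl])
    fix b
    have "\<phi> + of_real (pi * real b / real n) = of_real ((\<tau> + pi) / (2 * real n) + pi * real b / real n)" by (simp add: \<phi>_def)
    also have "(\<tau> + pi) / (2 * real n) + pi * real b / real n = (2 * pi * real b + pi + \<tau>) / (6 * real (p j))"
      unfolding n_def using p(2)[of j] by (simp add: field_simps)
    finally have eq: "\<phi> + of_real (pi * real b / real n) = of_real ((2 * pi * real b + pi + \<tau>) / (6 * real (p j)))" .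
    show "1 + \<zeta> * of_real ((2 * cos ((2 * pi * real b + pi + \<tau>) / (6 * real (p j)))) ^ (2 * m j))
      = 1 - (- \<zeta>) * (2 * cos (\<phi> + of_real (pi * real b / real n))) ^ (2 * m j)"
      unfolding eq cos_of_real by simp
  qed
  then have "(\<Prod>b<3 * p j. 1 + \<zeta> * of_real ((2 * cos ((2 * pi * real b + pi + \<tau>) / (6 * real (p j)))) ^ (2 * m j)))
      / (\<zeta> ^ (2 * p j) * of_real (sea (m j) (p j) 0))
     = (\<Sum>M\<in>configs j. of_real (ksign (drift j M) (turns j M)) * \<zeta> ^ path_count (m j) M * cis (of_int (turns j M) * \<tau>) / (\<zeta> ^ (2 * p j) * of_real (base j)))"
    unfolding base_def sum_divide_distrib[symmetric] by (simp only: P)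
  also have "\<dots> = signed_sum \<zeta> \<tau> j"
    unfolding signed_sum_def
  proof (rule sum.cong[OF refl])
    fix M
    have "\<zeta> powi drift j M = \<zeta> powi int (path_count (m j) M) / \<zeta> powi (2 * int (p j))"
      unfolding drift_def using \<zeta> by (rule power_int_diff[OF disjI1])
    also have "\<zeta> powi (2 * int (p j)) = \<zeta> ^ (2 * p j)"
      using power_int_of_nat[of \<zeta> "2 * p j"] by simp
    finally show "of_real (ksign (drift j M) (turns j M)) * \<zeta> ^ path_count (m j) M * cis (of_int (turns j M) * \<tau>) / (\<zeta> ^ (2 * p j) * of_real (base j))
       = of_real (ksign (drift j M) (turns j M) / base j) * \<zeta> powi drift j M * cis (of_int (turns j M) * \<tau>)"
      by simp
  qed
  finally show ?thesis by simp
qed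

lemma signed_sum_tendsto:
  assumes "\<zeta> \<noteq> 0" "\<bar>\<tau>\<bar> \<le> pi"
  shows "signed_sum \<zeta> \<tau> \<longlonglongrightarrow> signed_limit \<zeta> \<tau>"
  unfolding ext[of "signed_sum \<zeta> \<tau>", OF signed_sum_eq[OF assms(1)]] signed_limit_def
  by (rule modes[OF assms])

text \<open>The Kasteleyn sign \<open>(-1)^(a * b)\<close> is a quadratic form on \<open>(\<int>/2)\<^sup>2\<close>, so four signed sums
  recover the unsigned one.\<close>

lemma unsigned_sum_eq:
  assumes \<zeta>: "\<zeta> \<noteq> 0"
  shows "unsigned_sum \<zeta> \<tau> j = (signed_sum \<zeta> \<tau> j + signed_sum (- \<zeta>) \<tau> j + signed_sum \<zeta> (\<tau> + pi) j - signed_sum (- \<zeta>) (\<tau> + pi) j) / 2"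
proof -
  define t where "t M = of_real (1 / base j) * \<zeta> powi drift j M * cis (of_int (turns j M) * \<tau>)" for M
  define s where "s M = ksign (drift j M) (turns j M)" for M
  define e where "e k = (if even k then 1 else - 1 :: complex)" for k :: int
  have neg: "(- \<zeta>) powi k = e k * \<zeta> powi k" for k by (simp add: power_int_minus_left e_def)
  have sh: "cis (of_int k * (\<tau> + pi)) = e k * cis (of_int k * \<tau>)" for k
  proof -
    have "cis (of_int k * (\<tau> + pi)) = cis (of_int k * pi) * cis (of_int k * \<tau>)" by (simp add: cis_mult algebra_simps)
    then show ?thesis by (simp add: cis_pi_int e_def)
  qed
  have "2 * t M = of_real (s M) * t M + of_real (s M) * e (drift j M) * t M + of_real (s M) * e (turns j M) * t M
      - of_real (s M) * e (drift j M) * e (turns j M) * t M" for M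
  proof -
    \<comment> \<open>The bracket is 2 except when both numbers are odd, where it is -2 and the sign
      is -1 as well.\<close>
    have "of_real (s M) * (1 + e (drift j M) + e (turns j M) - e (drift j M) * e (turns j M)) = 2"
      by (auto simp: s_def e_def ksign_def)
    then have "2 * t M = (of_real (s M) * (1 + e (drift j M) + e (turns j M) - e (drift j M) * e (turns j M))) * t M" by simp
    then show ?thesis by (simp add: algebra_simps)
  qed
  then have "2 * unsigned_sum \<zeta> \<tau> j = (\<Sum>M\<in>configs j. of_real (s M) * t M) + (\<Sum>M\<in>configs j. of_real (s M) * e (drift j M) * t M)
      + (\<Sum>M\<in>configs j. of_real (s M) * e (turns j M) * t M) - (\<Sum>M\<in>configs j. of_real (s M) * e (drift j M) * e (turns j M) * t M)"
    unfolding unsigned_sum_def t_def[symmetric] sum_distrib_left sum.distrib[symmetric] sum_subtractf[symmetric] by simp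
  also have "(\<Sum>M\<in>configs j. of_real (s M) * t M) = signed_sum \<zeta> \<tau> j"
    unfolding signed_sum_def by (intro sum.cong) (simp_all add: s_def t_def)
  also have "(\<Sum>M\<in>configs j. of_real (s M) * e (drift j M) * t M) = signed_sum (- \<zeta>) \<tau> j"
    unfolding signed_sum_def by (intro sum.cong) (simp_all add: s_def t_def neg)
  also have "(\<Sum>M\<in>configs j. of_real (s M) * e (turns j M) * t M) = signed_sum \<zeta> (\<tau> + pi) j"
    unfolding signed_sum_def by (intro sum.cong) (simp_all add: s_def t_def sh)
  also have "(\<Sum>M\<in>configs j. of_real (s M) * e (drift j M) * e (turns j M) * t M) = signed_sum (- \<zeta>) (\<tau> + pi) j"
    unfolding signed_sum_def by (intro sum.cong) (simp_all add: s_def t_def neg sh)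
  finally have E: "2 * unsigned_sum \<zeta> \<tau> j = signed_sum \<zeta> \<tau> j + signed_sum (- \<zeta>) \<tau> j
      + signed_sum \<zeta> (\<tau> + pi) j - signed_sum (- \<zeta>) (\<tau> + pi) j" .
  show ?thesis using arg_cong[OF E, of "\<lambda>x. x / 2"] by simp
qed

text \<open>The window is one-sided because both \<open>\<tau>\<close> and
  \<open>\<tau> + pi\<close> must lie in [-pi, pi].\<close>

lemma unsigned_sum_tendsto:
  assumes "\<zeta> \<noteq> 0" "\<tau> \<in> {-pi..0}"
  shows "unsigned_sum \<zeta> \<tau> \<longlonglongrightarrow> unsigned_limit \<zeta> \<tau>"
proof -
  have "\<bar>\<tau>\<bar> \<le> pi" "\<bar>\<tau> + pi\<bar> \<le> pi" using assms(2) by auto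
  then show ?thesis using assms(1)
    unfolding unsigned_sum_eq[OF assms(1)] unsigned_limit_def by (intro tendsto_intros signed_sum_tendsto) auto
qed

definition total :: "nat \<Rightarrow> real" where
  "total j = real (card (configs j)) / base j"

lemma total_eq: "unsigned_sum 1 0 j = of_real (total j)"
  by (simp add: unsigned_sum_def total_def)

text \<open>Deliberately left as a combination of theta values; \<open>number_limit_has_sum\<close>
  identifies it with the sum of the Gaussian weights.\<close>

definition total_limit :: real where
  "total_limit = Re (unsigned_limit 1 0)"

lemma total_tendsto: "total \<longlonglongrightarrow> total_limit"
  using tendsto_Re[OF unsigned_sum_tendsto[of 1 0]] by (simp add: total_eq total_limit_def)

text \<open>On the unit circle every term has modulus 1/\<open>base j\<close>, so the convergent
  unsigned total at 1 dominates all signed sums uniformly.\<close>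

lemma signed_sum_bounded:
  obtains B where "\<And>\<alpha> \<tau> j. norm (signed_sum (cis \<alpha>) \<tau> j) \<le> B"
proof -
  obtain B where B: "\<And>j. norm (total j) \<le> B"
    using total_tendsto convergent_imp_Bseq BseqE unfolding convergent_def by metis
  have "norm (signed_sum (cis \<alpha>) \<tau> j) \<le> total j" for \<alpha> \<tau> j
  proof -
    have "norm (signed_sum (cis \<alpha>) \<tau> j) \<le> (\<Sum>M\<in>configs j. 1 / base j)"
      unfolding signed_sum_def
      by (rule sum_norm_le) (use base_pos[of j] in \<open>simp add: norm_mult norm_divide cis_power_int ksign_square abs_of_pos\<close>)
    then show ?thesis by (simp add: total_def)
  qed
  then show ?thesis using B that[of B] by (metis abs_le_D1 order_trans real_norm_def)
qed

end

section \<open>Extraction of the coefficients by two Fourier integrals\<close>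

lemma of_real_exp_power_int: "of_real (exp x) powi a = (of_real (exp (of_int a * x)) :: complex)"
proof (cases a)
  case (nonneg n)
  then show ?thesis by (simp add: exp_of_nat_mult)
next
  case (neg n)
  then show ?thesis
    by (simp only: power_int_minus power_int_of_nat of_int_minus of_int_of_nat_eq mult_minus_left exp_minus exp_of_nat_mult of_real_inverse of_real_power)
qed

context dimer_limit
begin

text \<open>A term of the product of the two theta series with the power of \<open>\<zeta>\<close>
  removed; \<open>a\<close> and \<open>b\<close> are the charges at the two Fermi points, and a + b
  is the degree in \<open>\<zeta>\<close>.\<close>

definition pair_weight :: "real \<Rightarrow> int \<times> int \<Rightarrow> complex" where
  "pair_weight \<tau> = (\<lambda>(a, b). of_real (Q * exp (- \<tau>\<^sup>2 / (2 * pi * \<rho>))) *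
     ((of_real (r ^ (nat \<bar>a\<bar>)\<^sup>2) * of_real (exp (- \<tau> / \<rho>)) powi a) * (of_real (r ^ (nat \<bar>b\<bar>)\<^sup>2) * of_real (exp (\<tau> / \<rho>)) powi b)))"

lemma pair_weight_summable: "(\<lambda>x. norm (pair_weight \<tau> x)) summable_on UNIV"
proof -
  have "(\<lambda>p. norm (case p of (a, b) \<Rightarrow> (of_real (r ^ (nat \<bar>a\<bar>)\<^sup>2) * (of_real (exp (- \<tau> / \<rho>)) :: complex) powi a)
      * (of_real (r ^ (nat \<bar>b\<bar>)\<^sup>2) * of_real (exp (\<tau> / \<rho>)) powi b))) summable_on UNIV \<times> UNIV"
    by (intro infsum_mult_Times(1) theta_abs_summable[OF r01])
  from summable_on_cmult_right[OF this, of "norm (of_real (Q * exp (- \<tau>\<^sup>2 / (2 * pi * \<rho>))) :: complex)"]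
  show ?thesis unfolding norm_mult[symmetric] by (simp add: pair_weight_def case_prod_unfold)
qed

lemma signed_limit_series:
  "signed_limit (cis \<alpha>) \<tau> = (\<Sum>\<^sub>\<infinity>x\<in>UNIV. pair_weight \<tau> x * cis (of_int (fst x + snd x) * \<alpha>))"
proof -
  define A where "A s a = of_real (r ^ (nat \<bar>a\<bar>)\<^sup>2) * (cis \<alpha> * of_real (exp (s / \<rho>))) powi a" for s a
  have "signed_limit (cis \<alpha>) \<tau> = of_real (Q * exp (- \<tau>\<^sup>2 / (2 * pi * \<rho>))) * (infsum (A (- \<tau>)) UNIV * infsum (A \<tau>) UNIV)"
    unfolding signed_limit_def theta_def A_def by simp
  also have "infsum (A (- \<tau>)) UNIV * infsum (A \<tau>) UNIV = (\<Sum>\<^sub>\<infinity>(a, b)\<in>UNIV \<times> UNIV. A (- \<tau>) a * A \<tau> b)"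
    unfolding A_def by (intro infsum_mult_Times(2)[symmetric] theta_abs_summable[OF r01])
  also have "of_real (Q * exp (- \<tau>\<^sup>2 / (2 * pi * \<rho>))) * \<dots> = (\<Sum>\<^sub>\<infinity>x\<in>UNIV. of_real (Q * exp (- \<tau>\<^sup>2 / (2 * pi * \<rho>))) * (case x of (a, b) \<Rightarrow> A (- \<tau>) a * A \<tau> b))"
    unfolding UNIV_Times_UNIV by (rule infsum_cmult_right'[symmetric])
  also have "\<dots> = (\<Sum>\<^sub>\<infinity>x\<in>UNIV. pair_weight \<tau> x * cis (of_int (fst x + snd x) * \<alpha>))"
  proof (rule infsum_cong)
    fix x :: "int \<times> int"
    obtain a b where x: "x = (a, b)" by (cases x)
    have c: "cis (of_int (a + b) * \<alpha>) = cis \<alpha> powi a * cis \<alpha> powi b"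
      by (simp add: cis_power_int cis_mult distrib_right)
    show "of_real (Q * exp (- \<tau>\<^sup>2 / (2 * pi * \<rho>))) * (case x of (a, b) \<Rightarrow> A (- \<tau>) a * A \<tau> b) = pair_weight \<tau> x * cis (of_int (fst x + snd x) * \<alpha>)"
      unfolding x pair_weight_def prod.case fst_conv snd_conv c A_def power_int_mult_distrib by (simp only: mult_ac)
  qed
  finally show ?thesis .
qed

text \<open>The standard deviation in \<open>\<tau>\<close> of the periodized Gaussian; its square
  also becomes the coefficient of l^2 after the second Fourier transform.\<close>

definition width :: real where
  "width = sqrt (pi * \<rho>)"

lemma width: "width > 0" "width\<^sup>2 = pi * \<rho>"
  using rho by (auto simp: width_def)

text \<open>Completing the square: the coefficients of fixed total charge \<open>\<kappa>\<close> form a periodized Gaussian.\<close>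

lemma pair_weight_eq:
  "pair_weight \<tau> (a, \<kappa> - a) = of_real (Q * exp (- pi * (of_int \<kappa>)\<^sup>2 / (2 * \<rho>)))
     * of_real (exp (- (\<tau> - pi * of_int \<kappa> + of_int a * (2 * pi))\<^sup>2 / (2 * width\<^sup>2)))"
proof -
  have rp: "r ^ (nat \<bar>c\<bar>)\<^sup>2 = exp ((of_int c)\<^sup>2 * (- pi / \<rho>))" for c
  proof -
    have "r ^ (nat \<bar>c\<bar>)\<^sup>2 = exp (real ((nat \<bar>c\<bar>)\<^sup>2) * (- pi / \<rho>))" unfolding r by (rule exp_of_nat_mult[symmetric])
    then show ?thesis by simp
  qed
  have "- \<tau>\<^sup>2 / (2 * pi * \<rho>) + (((of_int a)\<^sup>2 * (- pi / \<rho>) + of_int a * (- \<tau> / \<rho>)) + ((of_int (\<kappa> - a))\<^sup>2 * (- pi / \<rho>) + of_int (\<kappa> - a) * (\<tau> / \<rho>)))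
    = - pi * (of_int \<kappa>)\<^sup>2 / (2 * \<rho>) + - (\<tau> - pi * of_int \<kappa> + of_int a * (2 * pi))\<^sup>2 / (2 * width\<^sup>2)"
    unfolding width(2) using rho by (simp add: field_simps power2_eq_square)
  then have "exp (- \<tau>\<^sup>2 / (2 * pi * \<rho>)) * ((exp ((of_int a)\<^sup>2 * (- pi / \<rho>)) * exp (of_int a * (- \<tau> / \<rho>))) * (exp ((of_int (\<kappa> - a))\<^sup>2 * (- pi / \<rho>)) * exp (of_int (\<kappa> - a) * (\<tau> / \<rho>))))
    = exp (- pi * (of_int \<kappa>)\<^sup>2 / (2 * \<rho>)) * exp (- (\<tau> - pi * of_int \<kappa> + of_int a * (2 * pi))\<^sup>2 / (2 * width\<^sup>2))"
    unfolding exp_add[symmetric] by simp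
  then show ?thesis
    unfolding pair_weight_def prod.case of_real_exp_power_int rp of_real_mult[symmetric] of_real_eq_iff mult.assoc by simp
qed

definition number :: "nat \<Rightarrow> int \<Rightarrow> int \<Rightarrow> real" where
  "number j \<kappa> l = real (card {M \<in> configs j. drift j M = \<kappa> \<and> turns j M = l}) / base j"

definition number_limit :: "int \<Rightarrow> int \<Rightarrow> real" where
  "number_limit \<kappa> l = (Q * width * sqrt (2 * pi) / (2 * pi)) * exp (- (pi / 2) * ((of_int \<kappa>)\<^sup>2 / \<rho> + \<rho> * (of_int l)\<^sup>2))"

text \<open>The first Fourier integral, over the angle of \<open>\<zeta>\<close> on the unit circle,
  isolates a fixed drift. On the limit side it keeps the pairs of charges with sum
  \<open>\<kappa>\<close>.\<close>

lemma drift_coefficient_tendsto: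
  assumes "\<tau> \<in> {-pi..pi}"
  shows "(\<lambda>j. \<Sum>M | M \<in> configs j \<and> drift j M = \<kappa>. of_real (ksign \<kappa> (turns j M) / base j) * cis (of_int (turns j M) * \<tau>))
    \<longlonglongrightarrow> of_real (Q * exp (- pi * (of_int \<kappa>)\<^sup>2 / (2 * \<rho>)))
      * (\<Sum>\<^sub>\<infinity>a. of_real (exp (- (\<tau> - pi * of_int \<kappa> + of_int a * (2 * pi))\<^sup>2 / (2 * width\<^sup>2))))"
proof -
  define w where "w j M = of_real (ksign (drift j M) (turns j M) / base j) * cis (of_int (turns j M) * \<tau>)" for j M
  have S: "(\<Sum>M\<in>configs j. w j M * cis (of_int (drift j M) * \<alpha>)) = signed_sum (cis \<alpha>) \<tau> j" for j \<alpha>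
    unfolding signed_sum_def w_def cis_power_int by (simp add: mult_ac)
  obtain B where B: "\<And>\<alpha> \<tau> j. norm (signed_sum (cis \<alpha>) \<tau> j) \<le> B" using signed_sum_bounded by blast
  have "(\<lambda>j. \<Sum>M | M \<in> configs j \<and> drift j M = \<kappa>. w j M)
      \<longlonglongrightarrow> integral {-pi..pi} (\<lambda>\<alpha>. signed_limit (cis \<alpha>) \<tau> * cis (- of_int \<kappa> * \<alpha>)) / (2 * pi)"
  proof (rule Fourier_coefficients_tendsto[OF finite_configs])
    show "norm (\<Sum>M\<in>configs j. w j M * cis (of_int (drift j M) * \<alpha>)) \<le> B" for j \<alpha> unfolding S by (rule B)
    show "(\<lambda>j. \<Sum>M\<in>configs j. w j M * cis (of_int (drift j M) * \<alpha>)) \<longlonglongrightarrow> signed_limit (cis \<alpha>) \<tau>" for \<alpha>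
      unfolding S by (rule signed_sum_tendsto) (use assms in auto)
  qed
  also have "integral {-pi..pi} (\<lambda>\<alpha>. signed_limit (cis \<alpha>) \<tau> * cis (- of_int \<kappa> * \<alpha>)) / (2 * pi)
      = (\<Sum>\<^sub>\<infinity>x | x \<in> UNIV \<and> fst x + snd x = \<kappa>. pair_weight \<tau> x)"
    unfolding signed_limit_series by (rule Fourier_coefficient_series[OF pair_weight_summable])
  also have "\<dots> = (\<Sum>\<^sub>\<infinity>a. pair_weight \<tau> (a, \<kappa> - a))"
    by (rule infsum_reindex_bij_witness[where i = "\<lambda>a. (a, \<kappa> - a)" and j = fst]) auto
  also have "\<dots> = of_real (Q * exp (- pi * (of_int \<kappa>)\<^sup>2 / (2 * \<rho>)))
      * (\<Sum>\<^sub>\<infinity>a. of_real (exp (- (\<tau> - pi * of_int \<kappa> + of_int a * (2 * pi))\<^sup>2 / (2 * width\<^sup>2))))"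
    unfolding pair_weight_eq by (rule infsum_cmult_right')
  finally show ?thesis
    unfolding w_def by (rule Lim_transform_eventually) (auto intro!: always_eventually sum.cong)
qed

text \<open>The second Fourier integral, over \<open>\<tau>\<close>, isolates a fixed number of
  turns. The sign is constant on the isolated class and its square is 1, so it can be removed
  afterwards.\<close>

lemma number_tendsto: "(\<lambda>j. number j \<kappa> l) \<longlonglongrightarrow> number_limit \<kappa> l"
proof -
  define K where "K = Q * exp (- pi * (of_int \<kappa>)\<^sup>2 / (2 * \<rho>))"
  define g :: "real \<Rightarrow> complex" where "g \<tau> = of_real K * (\<Sum>\<^sub>\<infinity>a. of_real (exp (- (\<tau> - pi * of_int \<kappa> + of_int a * (2 * pi))\<^sup>2 / (2 * width\<^sup>2))))" for \<tau> :: real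
  define D where "D j = {M \<in> configs j. drift j M = \<kappa>}" for j
  define w where "w j M = (of_real (ksign \<kappa> (turns j M) / base j) :: complex)" for j M
  have fin: "finite (D j)" for j using finite_configs by (simp add: D_def)
  obtain B where B: "\<And>j. norm (total j) \<le> B"
    using total_tendsto convergent_imp_Bseq BseqE unfolding convergent_def by metis
  have bound: "norm (\<Sum>M\<in>D j. w j M * cis (of_int (turns j M) * \<tau>)) \<le> B" for j \<tau>
  proof -
    have "norm (\<Sum>M\<in>D j. w j M * cis (of_int (turns j M) * \<tau>)) \<le> (\<Sum>M\<in>D j. 1 / base j)"
      by (rule sum_norm_le) (use base_pos[of j] in \<open>simp add: w_def norm_mult norm_divide ksign_square abs_of_pos\<close>)
    also have "\<dots> \<le> (\<Sum>M\<in>configs j. 1 / base j)"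
      by (rule sum_mono2) (use finite_configs base_pos[of j] in \<open>auto simp: D_def\<close>)
    also have "\<dots> = total j" by (simp add: total_def)
    also have "\<dots> \<le> B" using B[of j] by simp
    finally show ?thesis .
  qed
  have "(\<lambda>j. \<Sum>M | M \<in> D j \<and> turns j M = l. w j M) \<longlonglongrightarrow> integral {-pi..pi} (\<lambda>\<tau>. g \<tau> * cis (- of_int l * \<tau>)) / (2 * pi)"
  proof (rule Fourier_coefficients_tendsto[OF fin bound])
    show "(\<lambda>j. \<Sum>M\<in>D j. w j M * cis (of_int (turns j M) * \<tau>)) \<longlonglongrightarrow> g \<tau>" if "\<tau> \<in> {-pi..pi}" for \<tau>
      using drift_coefficient_tendsto[OF that, of \<kappa>] unfolding D_def w_def g_def K_def .
  qed
  also have "(\<lambda>j. \<Sum>M | M \<in> D j \<and> turns j M = l. w j M) = (\<lambda>j. of_real (ksign \<kappa> l * number j \<kappa> l))"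
  proof
    fix j
    have "{M. M \<in> D j \<and> turns j M = l} = {M \<in> configs j. drift j M = \<kappa> \<and> turns j M = l}" by (auto simp: D_def)
    then show "(\<Sum>M | M \<in> D j \<and> turns j M = l. w j M) = of_real (ksign \<kappa> l * number j \<kappa> l)"
      by (simp add: w_def number_def)
  qed
  also have "integral {-pi..pi} (\<lambda>\<tau>. g \<tau> * cis (- of_int l * \<tau>)) / (2 * pi) = of_real (ksign \<kappa> l * number_limit \<kappa> l)"
  proof -
    have "integral {-pi..pi} (\<lambda>\<tau>. g \<tau> * cis (- of_int l * \<tau>))
       = of_real K * (cis (- of_int l * (pi * of_int \<kappa>)) * of_real (width * sqrt (2 * pi) * exp (- width\<^sup>2 * (of_int l)\<^sup>2 / 2)))"
      unfolding g_def mult.assoc[of "of_real K"] integral_mult_right periodized_gaussian_Fourier[OF width(1)] ..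
    \<comment> \<open>The periodized Gaussian is centred at pi \<open>\<kappa>\<close>, and its
      phase is precisely the Kasteleyn sign of the left-hand side.\<close>
    also have "cis (- of_int l * (pi * of_int \<kappa>)) = of_real (ksign \<kappa> l)"
      using cis_pi_int[of "- l * \<kappa>"] by (simp add: ksign_def mult_ac)
    finally have "integral {-pi..pi} (\<lambda>\<tau>. g \<tau> * cis (- of_int l * \<tau>)) / (2 * pi)
      = of_real (K * (ksign \<kappa> l * (width * sqrt (2 * pi) * exp (- width\<^sup>2 * (of_int l)\<^sup>2 / 2))) / (2 * pi))" by simp
    moreover have "exp (- pi * (of_int \<kappa>)\<^sup>2 / (2 * \<rho>)) * exp (- width\<^sup>2 * (of_int l)\<^sup>2 / 2) = exp (- (pi / 2) * ((of_int \<kappa>)\<^sup>2 / \<rho> + \<rho> * (of_int l)\<^sup>2))"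
      unfolding exp_add[symmetric] width(2) using rho by (simp add: field_simps)
    then have "K * (ksign \<kappa> l * (width * sqrt (2 * pi) * exp (- width\<^sup>2 * (of_int l)\<^sup>2 / 2))) / (2 * pi) = ksign \<kappa> l * number_limit \<kappa> l"
      unfolding number_limit_def K_def by (simp add: mult_ac)
    ultimately show ?thesis by (simp only:)
  qed
  finally have "(\<lambda>j. ksign \<kappa> l * number j \<kappa> l) \<longlonglongrightarrow> ksign \<kappa> l * number_limit \<kappa> l"
    by (simp only: tendsto_of_real_iff)
  then have "(\<lambda>j. ksign \<kappa> l * (ksign \<kappa> l * number j \<kappa> l)) \<longlonglongrightarrow> ksign \<kappa> l * (ksign \<kappa> l * number_limit \<kappa> l)"
    by (rule tendsto_mult_left)
  then show ?thesis by (simp only: mult.assoc[symmetric] ksign_square mult_1_left)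
qed

end

section \<open>Tightness and normalization\<close>

lemma tendsto_imp_norm_le:
  assumes "X \<longlonglongrightarrow> L"
  obtains B where "\<And>j. norm (X j) \<le> B"
proof -
  have "Bseq X" using assms by (intro convergent_imp_Bseq) (auto simp: convergent_def)
  then show ?thesis using that by (auto elim!: BseqE)
qed

text \<open>The theta majorant gives uniform convergence on bounded sets of \<open>t\<close>.
  Continuity of the limit at \<open>\<tau> = 0\<close> is what the tail estimate for the turns
  relies on.\<close>

lemma theta_continuous:
  assumes r: "0 < r" "r < 1" and s: "norm s = 1"
  shows "continuous_on {- B..B} (\<lambda>t. theta r (s * of_real (exp t)))"
proof -
  have powi: "(s * of_real (exp t)) powi c = s powi c * of_real (exp (of_int c * t))" for t c
    by (simp only: power_int_mult_distrib of_real_exp_power_int)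
  have "uniform_limit {- B..B} (\<lambda>X t. \<Sum>c\<in>X. of_real (r ^ (nat \<bar>c\<bar>)\<^sup>2) * (s * of_real (exp t)) powi c)
     (\<lambda>t. \<Sum>\<^sub>\<infinity>c\<in>UNIV. of_real (r ^ (nat \<bar>c\<bar>)\<^sup>2) * (s * of_real (exp t)) powi c) (finite_subsets_at_top UNIV)"
  proof (rule Weierstrass_m_test_general[OF _ theta_majorant_summable[OF r, of "exp B"]])
    fix c :: int and t assume t: "t \<in> {- B..B}"
    have "of_int c * t \<le> real (nat \<bar>c\<bar>) * B"
    proof -
      have "of_int c * t \<le> \<bar>of_int c * t\<bar>" by (rule abs_ge_self)
      also have "\<dots> \<le> \<bar>of_int c\<bar> * B" unfolding abs_mult using t by (intro mult_left_mono) auto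
      finally show ?thesis by simp
    qed
    then have "exp (of_int c * t) \<le> exp B ^ nat \<bar>c\<bar>" by (simp add: exp_of_nat_mult[symmetric])
    then show "norm (of_real (r ^ (nat \<bar>c\<bar>)\<^sup>2) * (s * of_real (exp t)) powi c) \<le> r ^ (nat \<bar>c\<bar>)\<^sup>2 * exp B ^ nat \<bar>c\<bar>"
      unfolding powi using r s by (simp add: norm_mult norm_power norm_power_int mult_left_mono)
  qed auto
  then have "continuous_on {- B..B} (\<lambda>t. \<Sum>\<^sub>\<infinity>c\<in>UNIV. of_real (r ^ (nat \<bar>c\<bar>)\<^sup>2) * (s * of_real (exp t)) powi c)"
    unfolding powi by (intro uniform_limit_theorem[rotated]) (auto intro!: always_eventually continuous_intros)
  then show ?thesis unfolding theta_def .
qed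

context dimer_limit
begin

lemma signed_limit_continuous:
  assumes s: "norm \<zeta> = 1"
  shows "continuous_on A (signed_limit \<zeta>)"
proof -
  have th: "continuous_on {-B..B} (\<lambda>\<tau>. theta r (\<zeta> * of_real (exp (c * \<tau> / \<rho>))))" if "\<bar>c\<bar> = 1" for B c
  proof (rule continuous_on_compose2[OF theta_continuous[OF r01 s, of "B / \<rho>"], where f = "\<lambda>\<tau>. c * \<tau> / \<rho>", simplified])
    show "continuous_on {- B..B} (\<lambda>\<tau>. c * \<tau> / \<rho>)" using rho by (intro continuous_intros) auto
    show "(\<lambda>\<tau>. c * \<tau> / \<rho>) ` {- B..B} \<subseteq> {- (B / \<rho>)..B / \<rho>}"
      using rho that by (auto simp: field_simps abs_if split: if_splits)
  qed
  have "continuous_on {-B..B} (signed_limit \<zeta>)" for B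
    unfolding signed_limit_def using th[of "-1" B] th[of 1 B] rho
    by (intro continuous_intros) auto
  then have "isCont (signed_limit \<zeta>) x" for x
    by (rule continuous_on_interior[of "{- (\<bar>x\<bar> + 1)..\<bar>x\<bar> + 1}"]) (auto simp: abs_if)
  then show ?thesis by (simp add: continuous_at_imp_continuous_on)
qed

lemma unsigned_limit_continuous: "continuous_on A (unsigned_limit 1)"
  unfolding unsigned_limit_def
  by (intro continuous_intros signed_limit_continuous continuous_on_compose2[OF signed_limit_continuous[of _ UNIV]]) auto

lemma number_sum:
  assumes "finite F"
  shows "(\<Sum>(\<kappa>, l)\<in>F. number j \<kappa> l) = real (card {M \<in> configs j. (drift j M, turns j M) \<in> F}) / base j"
proof -
  have "card {M \<in> configs j. (drift j M, turns j M) \<in> F} = card (\<Union>x\<in>F. {M \<in> configs j. (drift j M, turns j M) = x})"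
    by (rule arg_cong[where f = card]) auto
  also have "\<dots> = (\<Sum>x\<in>F. card {M \<in> configs j. (drift j M, turns j M) = x})"
    by (rule card_UN_disjoint) (use assms finite_configs in auto)
  finally show ?thesis by (simp add: number_def sum_divide_distrib case_prod_unfold prod_eq_iff)
qed

text \<open>Markov's inequality for 2^a + 2^(-a): the unsigned sums at the real points 2 and 1/2
  converge, so they bound an exponential moment of the drift.\<close>

lemma drift_tail:
  obtains B where "B \<ge> 0" "\<And>K j. real (card {M \<in> configs j. \<bar>drift j M\<bar> > int K}) / base j \<le> B / 2 ^ K"
proof -
  have "(\<lambda>j. unsigned_sum 2 0 j + unsigned_sum (1 / 2) 0 j) \<longlonglongrightarrow> unsigned_limit 2 0 + unsigned_limit (1 / 2) 0"
    by (intro tendsto_intros unsigned_sum_tendsto) auto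
  then obtain B where B: "\<And>j. norm (unsigned_sum 2 0 j + unsigned_sum (1 / 2) 0 j) \<le> B"
    by (rule tendsto_imp_norm_le) blast
  have "real (card {M \<in> configs j. \<bar>drift j M\<bar> > int K}) / base j \<le> B / 2 ^ K" for K j
  proof -
    define v where "v M = ((2::real) powi drift j M + (1 / 2) powi drift j M) / base j" for M
    have v0: "v M \<ge> 0" for M using base_pos[of j] by (simp add: v_def)
    have eq: "unsigned_sum 2 0 j + unsigned_sum (1 / 2) 0 j = of_real (\<Sum>M\<in>configs j. v M)"
      unfolding unsigned_sum_def sum.distrib[symmetric] v_def of_real_sum
      by (intro sum.cong refl) (simp add: add_divide_distrib)
    have "\<bar>\<Sum>M\<in>configs j. v M\<bar> \<le> B" using B[of j] unfolding eq norm_of_real .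
    then have vB: "(\<Sum>M\<in>configs j. v M) \<le> B" by (rule abs_le_D1)
    have big: "2 ^ K / base j \<le> v M" if "\<bar>drift j M\<bar> > int K" for M
    proof -
      have e: "(1 / 2 :: real) powi a = 2 powi (- a)" for a 
        unfolding power_int_minus power_int_inverse[symmetric] by simp
      have "(2::real) ^ K = 2 powi int K" by simp
      also have "\<dots> \<le> 2 powi \<bar>drift j M\<bar>" using that by (intro power_int_increasing) auto
      also have "\<dots> \<le> 2 powi drift j M + (1 / 2) powi drift j M"
        unfolding e by (simp add: abs_if)
      finally show ?thesis unfolding v_def using base_pos[of j] by (intro divide_right_mono) auto
    qed
    have "real (card {M \<in> configs j. \<bar>drift j M\<bar> > int K}) * (2 ^ K / base j) \<le> (\<Sum>M\<in>{M \<in> configs j. \<bar>drift j M\<bar> > int K}. v M)"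
      using sum_bounded_below[of "{M \<in> configs j. \<bar>drift j M\<bar> > int K}" "2 ^ K / base j" v] big by simp
    also have "\<dots> \<le> (\<Sum>M\<in>configs j. v M)" by (rule sum_mono2) (use finite_configs v0 in auto)
    finally show ?thesis using vB by (simp add: field_simps)
  qed
  moreover have "B \<ge> 0" using B[of 0] norm_ge_zero order_trans by blast
  ultimately show ?thesis using that by blast
qed

text \<open>The tail of a law is controlled by the behaviour of its characteristic function near 0, as in
  the proof of Levy's continuity theorem.\<close>

lemma turns_tail:
  assumes \<epsilon>: "\<epsilon> > 0"
  obtains L :: nat where "\<forall>\<^sub>F j in sequentially. real (card {M \<in> configs j. \<bar>turns j M\<bar> > int L}) / base j < \<epsilon>"
proof -
  \<comment> \<open>The drop of the unsigned sum between 0 and \<open>\<tau>\<close>, in real part: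
    all its terms are nonnegative, so the large turns alone bound it from below.\<close>
  define \<phi> where "\<phi> j \<tau> = (\<Sum>M\<in>configs j. (1 - cos (of_int (turns j M) * \<tau>)) / base j)" for j \<tau>
  define g where "g \<tau> = Re (unsigned_limit 1 0 - unsigned_limit 1 \<tau>)" for \<tau>
  have \<phi>: "\<phi> j \<tau> = Re (unsigned_sum 1 0 j - unsigned_sum 1 \<tau> j)" for j \<tau>
    unfolding \<phi>_def unsigned_sum_def sum_subtractf[symmetric] Re_sum
    by (intro sum.cong refl) (simp add: diff_divide_distrib)
  have lim: "(\<lambda>j. \<phi> j \<tau>) \<longlonglongrightarrow> g \<tau>" if "\<tau> \<in> {-pi..0}" for \<tau>
    unfolding \<phi> g_def by (intro tendsto_intros unsigned_sum_tendsto that) auto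
  have gc: "continuous_on A g" for A unfolding g_def by (intro continuous_intros unsigned_limit_continuous)
  have "continuous (at 0) g" using gc[of UNIV] by (simp add: continuous_on_eq_continuous_at)
  moreover have "g 0 = 0" by (simp add: g_def)
  ultimately have "g \<midarrow>0\<rightarrow> 0" by (simp add: continuous_at)
  then obtain d where d: "d > 0" "\<And>x. x \<noteq> 0 \<Longrightarrow> \<bar>x\<bar> < d \<Longrightarrow> \<bar>g x\<bar> < \<epsilon> / 4"
    using LIM_D[of g 0 0 "\<epsilon> / 4"] \<epsilon> by auto
  \<comment> \<open>The averages run over [-\<open>\<delta>\<close>, 0]:
    \<open>\<delta> \<le> pi\<close> keeps this inside the window where the unsigned sums converge,
    and \<open>\<delta> < d\<close> keeps \<open>g\<close> below
    \<open>\<epsilon> / 4\<close>.\<close>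
  define \<delta> where "\<delta> = min (d / 2) pi"
  have \<delta>: "0 < \<delta>" "\<delta> \<le> pi" "\<delta> < d" using d(1) pi_gt_zero by (auto simp: \<delta>_def)
  obtain B where B: "\<And>j. norm (total j) \<le> B"
    using tendsto_imp_norm_le[OF total_tendsto] by blast
  have \<phi>int: "(\<phi> j has_integral (\<Sum>M\<in>configs j. (\<delta> - (if turns j M = 0 then \<delta> else sin (of_int (turns j M) * \<delta>) / of_int (turns j M))) / base j)) {-\<delta>..0}" for j
    unfolding \<phi>_def
  proof (intro has_integral_sum has_integral_divide has_integral_diff finite_configs)
    fix M
    show "((\<lambda>\<tau>. 1) has_integral \<delta>) {-\<delta>..0}" using has_integral_const_real[of "1::real" "-\<delta>" 0] \<delta> by simp
    define k where "k = turns j M"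
    show "((\<lambda>\<tau>. cos (of_int k * \<tau>)) has_integral (if k = 0 then \<delta> else sin (of_int k * \<delta>) / of_int k)) {-\<delta>..0}"
    proof (cases "k = 0")
      case True
      then show ?thesis using has_integral_const_real[of "1::real" "-\<delta>" 0] \<delta> by simp
    next
      case False
      have "((\<lambda>\<tau>. cos (of_int k * \<tau>)) has_integral (sin (of_int k * 0) / of_int k - sin (of_int k * (- \<delta>)) / of_int k)) {-\<delta>..0}"
        by (rule fundamental_theorem_of_calculus)
          (use \<delta> False in \<open>auto intro!: derivative_eq_intros simp: has_real_derivative_iff_has_vector_derivative[symmetric]\<close>)
      then show ?thesis using False by simp
    qed
  qed
  have "(\<lambda>j. integral {-\<delta>..0} (\<phi> j)) \<longlonglongrightarrow> integral {-\<delta>..0} g"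
  proof (rule dominated_convergence(2))
    show "\<phi> j integrable_on {-\<delta>..0}" for j using \<phi>int by blast
    show "(\<lambda>_. 2 * B) integrable_on {-\<delta>..0}" by (rule integrable_const_ivl)
    show "norm (\<phi> j \<tau>) \<le> 2 * B" for j \<tau>
    proof -
      have "norm (\<phi> j \<tau>) \<le> (\<Sum>M\<in>configs j. 2 / base j)"
        unfolding \<phi>_def
      proof (rule sum_norm_le)
        fix M
        have "\<bar>1 - cos (of_int (turns j M) * \<tau>)\<bar> \<le> 2" using cos_ge_minus_one[of "of_int (turns j M) * \<tau>"] cos_le_one[of "of_int (turns j M) * \<tau>"] by linarith
        then show "norm ((1 - cos (of_int (turns j M) * \<tau>)) / base j) \<le> 2 / base j"
          using base_pos[of j] by (simp add: divide_right_mono)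
      qed
      also have "\<dots> = 2 * total j" by (simp add: total_def)
      also have "\<dots> \<le> 2 * B" using B[of j] by simp
      finally show ?thesis .
    qed
    show "(\<lambda>j. \<phi> j \<tau>) \<longlonglongrightarrow> g \<tau>" if "\<tau> \<in> {-\<delta>..0}" for \<tau> using lim that \<delta> by auto
  qed
  moreover have "integral {-\<delta>..0} g < \<delta> * (\<epsilon> / 2)"
  proof -
    have "integral {-\<delta>..0} g \<le> integral {-\<delta>..0} (\<lambda>_. \<epsilon> / 4)"
    proof (rule integral_le)
      show "g integrable_on {-\<delta>..0}" by (rule integrable_continuous_real[OF gc])
      show "g x \<le> \<epsilon> / 4" if "x \<in> {-\<delta>..0}" for x using d(2)[of x] that \<delta> \<open>g 0 = 0\<close> \<epsilon> by (cases "x = 0") auto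
    qed (rule integrable_const_ivl)
    also have "\<dots> = \<delta> * (\<epsilon> / 4)" using \<delta> by simp
    also have "\<dots> < \<delta> * (\<epsilon> / 2)" using \<delta> \<epsilon> by simp
    finally show ?thesis .
  qed
  ultimately have ev: "\<forall>\<^sub>F j in sequentially. integral {-\<delta>..0} (\<phi> j) < \<delta> * (\<epsilon> / 2)" by (rule order_tendstoD(2))
  \<comment> \<open>Beyond 2/\<open>\<delta>\<close> the quotient sin(l \<open>\<delta>\<close>)/l
    is at most \<open>\<delta>\<close>/2, so each such configuration contributes at least half of
    \<open>\<delta>\<close> to the integral.\<close>
  define L where "L = nat \<lceil>2 / \<delta>\<rceil>"
  have L: "2 / \<delta> \<le> real L" unfolding L_def by linarith
  have tail: "real (card {M \<in> configs j. \<bar>turns j M\<bar> > int L}) / base j * (\<delta> / 2) \<le> integral {-\<delta>..0} (\<phi> j)" for j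
  proof -
    define c where "c M = (\<delta> - (if turns j M = 0 then \<delta> else sin (of_int (turns j M) * \<delta>) / of_int (turns j M))) / base j" for M
    have c0: "c M \<ge> 0" for M
    proof -
      have "sin (of_int (turns j M) * \<delta>) / of_int (turns j M) \<le> \<delta>" if nz: "turns j M \<noteq> 0"
      proof -
        have "\<bar>sin (of_int (turns j M) * \<delta>) / of_int (turns j M)\<bar> \<le> \<bar>of_int (turns j M) * \<delta>\<bar> / \<bar>of_int (turns j M)\<bar>"
          unfolding abs_divide by (intro divide_right_mono abs_sin_x_le_abs_x) auto
        also have "\<dots> = \<delta>" using nz \<delta> by (simp add: abs_mult)
        finally show ?thesis by linarith
      qed
      then show ?thesis using base_pos[of j] by (simp add: c_def)
    qed
    have big: "\<delta> / 2 / base j \<le> c M" if M: "\<bar>turns j M\<bar> > int L" for M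
    proof -
      have a: "real_of_int \<bar>turns j M\<bar> > 2 / \<delta>"
      proof -
        have "real L < real_of_int \<bar>turns j M\<bar>" using M by linarith
        then show ?thesis using L by linarith
      qed
      then have nz: "turns j M \<noteq> 0" using \<delta> by (auto simp: field_simps)
      have "\<bar>sin (of_int (turns j M) * \<delta>) / of_int (turns j M)\<bar> \<le> 1 / real_of_int \<bar>turns j M\<bar>"
        unfolding abs_divide of_int_abs by (intro divide_right_mono abs_sin_le_one) auto
      also have "\<dots> \<le> \<delta> / 2" using a \<delta> nz by (simp add: field_simps)
      finally have "\<delta> / 2 \<le> \<delta> - sin (of_int (turns j M) * \<delta>) / of_int (turns j M)" by linarith
      moreover have "c M = (\<delta> - sin (of_int (turns j M) * \<delta>) / of_int (turns j M)) / base j" using nz by (simp add: c_def)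
      ultimately show ?thesis using divide_right_mono[OF _ less_imp_le[OF base_pos[of j]]] by metis
    qed
    have "real (card {M \<in> configs j. \<bar>turns j M\<bar> > int L}) * (\<delta> / 2 / base j) \<le> (\<Sum>M\<in>{M \<in> configs j. \<bar>turns j M\<bar> > int L}. c M)"
      using sum_bounded_below[of "{M \<in> configs j. \<bar>turns j M\<bar> > int L}" "\<delta> / 2 / base j" c] big by simp
    also have "\<dots> \<le> (\<Sum>M\<in>configs j. c M)" by (rule sum_mono2) (use finite_configs c0 in auto)
    also have "\<dots> = integral {-\<delta>..0} (\<phi> j)" using integral_unique[OF \<phi>int[of j]] by (simp add: c_def)
    finally show ?thesis by simp
  qed
  from ev have "\<forall>\<^sub>F j in sequentially. real (card {M \<in> configs j. \<bar>turns j M\<bar> > int L}) / base j < \<epsilon>"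
  proof eventually_elim
    case (elim j)
    have "\<delta> * (\<epsilon> / 2) = \<epsilon> * (\<delta> / 2)" by simp
    then have "real (card {M \<in> configs j. \<bar>turns j M\<bar> > int L}) / base j * (\<delta> / 2) < \<epsilon> * (\<delta> / 2)"
      using tail[of j] elim by linarith
    then show ?case by (rule mult_right_less_imp_less) (use \<delta> in simp)
  qed
  then show ?thesis using that by blast
qed

text \<open>Finite partial sums never exceed the limit of the total. Conversely, both tail estimates
  confine all but a small part of the total to a finite box, so no mass escapes.\<close>

lemma number_limit_has_sum: "((\<lambda>(\<kappa>, l). number_limit \<kappa> l) has_sum total_limit) UNIV"
proof -
  define f where "f = (\<lambda>(\<kappa>, l). number_limit \<kappa> l)"
  have f0: "f x \<ge> 0" for x using Q width(1) by (cases x) (simp add: f_def number_limit_def)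
  have lim: "(\<lambda>j. \<Sum>(\<kappa>, l)\<in>F. number j \<kappa> l) \<longlonglongrightarrow> sum f F" for F
    unfolding f_def case_prod_unfold by (intro tendsto_sum number_tendsto)
  have le: "sum f F \<le> total_limit" if F: "finite F" for F
  proof (rule LIMSEQ_le[OF lim total_tendsto])
    have "(\<Sum>(\<kappa>, l)\<in>F. number j \<kappa> l) \<le> total j" for j
      unfolding number_sum[OF F] total_def using base_pos[of j] finite_configs
      by (intro divide_right_mono) (auto intro!: card_mono)
    then show "\<exists>N. \<forall>j\<ge>N. (\<Sum>(\<kappa>, l)\<in>F. number j \<kappa> l) \<le> total j" by blast
  qed
  have sm: "f summable_on UNIV"
    by (rule nonneg_bdd_above_summable_on) (use f0 le in \<open>auto intro!: bdd_aboveI2[of _ _ total_limit]\<close>)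
  have "infsum f UNIV \<le> total_limit" by (rule infsum_le_finite_sums[OF sm]) (use le in auto)
  moreover have "total_limit \<le> infsum f UNIV"
  proof (rule field_le_epsilon)
    fix e :: real assume e: "e > 0"
    obtain B where B: "B \<ge> 0" "\<And>K j. real (card {M \<in> configs j. \<bar>drift j M\<bar> > int K}) / base j \<le> B / 2 ^ K"
      using drift_tail by blast
    have "(\<lambda>K. B / 2 ^ K) \<longlonglongrightarrow> 0" by real_asymp
    then have "\<forall>\<^sub>F K in sequentially. B / 2 ^ K < e / 2" by (rule order_tendstoD) (use e in simp)
    then obtain K where K: "B / 2 ^ K < e / 2" unfolding eventually_sequentially by blast
    have "e / 2 > 0" using e by simp
    then obtain L :: nat where L: "\<forall>\<^sub>F j in sequentially. real (card {M \<in> configs j. \<bar>turns j M\<bar> > int L}) / base j < e / 2"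
      using turns_tail by blast
    define F where "F = {- int K..int K} \<times> {- int L..int L}"
    have F: "finite F" by (simp add: F_def)
    have "total_limit \<le> sum f F + e"
    proof (rule tendsto_le[OF _ _ total_tendsto])
      show "(\<lambda>j. (\<Sum>(\<kappa>, l)\<in>F. number j \<kappa> l) + e) \<longlonglongrightarrow> sum f F + e" by (intro tendsto_intros lim)
      show "\<forall>\<^sub>F j in sequentially. total j \<le> (\<Sum>(\<kappa>, l)\<in>F. number j \<kappa> l) + e"
        using L
      proof eventually_elim
        case (elim j)
        have "configs j \<subseteq> {M \<in> configs j. (drift j M, turns j M) \<in> F} \<union> ({M \<in> configs j. \<bar>drift j M\<bar> > int K} \<union> {M \<in> configs j. \<bar>turns j M\<bar> > int L})"
          by (auto simp: F_def)
        then have "card (configs j) \<le> card ({M \<in> configs j. (drift j M, turns j M) \<in> F} \<union> ({M \<in> configs j. \<bar>drift j M\<bar> > int K} \<union> {M \<in> configs j. \<bar>turns j M\<bar> > int L}))"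
          by (rule card_mono[rotated]) (use finite_configs in auto)
        also have "\<dots> \<le> card {M \<in> configs j. (drift j M, turns j M) \<in> F} + (card {M \<in> configs j. \<bar>drift j M\<bar> > int K} + card {M \<in> configs j. \<bar>turns j M\<bar> > int L})"
          by (rule order_trans[OF card_Un_le add_left_mono[OF card_Un_le]])
        finally have "real (card (configs j)) \<le> real (card {M \<in> configs j. (drift j M, turns j M) \<in> F}) + (real (card {M \<in> configs j. \<bar>drift j M\<bar> > int K}) + real (card {M \<in> configs j. \<bar>turns j M\<bar> > int L}))"
          by linarith
        then have "total j \<le> (real (card {M \<in> configs j. (drift j M, turns j M) \<in> F}) + (real (card {M \<in> configs j. \<bar>drift j M\<bar> > int K}) + real (card {M \<in> configs j. \<bar>turns j M\<bar> > int L}))) / base j"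
          unfolding total_def using base_pos[of j] by (intro divide_right_mono) auto
        then show ?case unfolding number_sum[OF F] add_divide_distrib using B(2)[of j K] K elim by linarith
      qed
    qed simp
    moreover have "sum f F \<le> infsum f UNIV" by (rule finite_sum_le_infsum[OF sm F]) (use f0 in auto)
    ultimately show "total_limit \<le> infsum f UNIV + e" by linarith
  qed
  ultimately show ?thesis using sm unfolding f_def[symmetric] by (simp add: has_sum_iff)
qed

end

section \<open>Convergence in distribution\<close>

text \<open>Scheffe's lemma: pointwise convergence of mass functions of equal total mass is
  convergence in L1, which controls the expectation of any bounded function.\<close>

lemma pmf_expectation_tendsto:
  fixes P :: "nat \<Rightarrow> 'a pmf" and Q :: "'a pmf" and f :: "'a \<Rightarrow> real"
  assumes lim: "\<And>x. (\<lambda>j. pmf (P j) x) \<longlonglongrightarrow> pmf Q x" and f: "bounded (range f)"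
  shows "(\<lambda>j. measure_pmf.expectation (P j) f) \<longlonglongrightarrow> measure_pmf.expectation Q f"
proof -
  obtain B where B: "\<And>x. \<bar>f x\<bar> \<le> B" using f by (auto simp: bounded_iff)
  have B0: "B \<ge> 0" using B order_trans[OF abs_ge_zero] by blast
  have int: "integrable (count_space UNIV) (\<lambda>x. pmf p x * f x)" for p
  proof -
    have "integrable (measure_pmf p) f" using B by (intro measure_pmf.integrable_const_bound[where B = B]) auto
    then show ?thesis unfolding measure_pmf_eq_density by (subst (asm) integrable_density) auto
  qed
  have ex: "measure_pmf.expectation p f = (\<integral>x. pmf p x * f x \<partial>count_space UNIV)" for p
    unfolding measure_pmf_eq_density by (subst integral_density) auto
  have "(\<lambda>j. \<integral>\<^sup>+ x. norm (pmf (P j) x - pmf Q x) \<partial>count_space UNIV) \<longlonglongrightarrow> 0"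
  proof (rule Scheffe_lemma2)
    show "integrable (count_space UNIV) (pmf Q)" by (rule integrable_pmf)
    show "(\<integral>\<^sup>+ x. norm (pmf (P j) x) \<partial>count_space UNIV) \<le> (\<integral>\<^sup>+ x. norm (pmf Q x) \<partial>count_space UNIV)" for j
      by (simp add: nn_integral_pmf measure_pmf.emeasure_space_1[simplified])
  qed (use lim in auto)
  then have up: "(\<lambda>j. ennreal B * (\<integral>\<^sup>+ x. norm (pmf (P j) x - pmf Q x) \<partial>count_space UNIV)) \<longlonglongrightarrow> 0"
    using ennreal_tendsto_cmult[of "ennreal B"] by fastforce
  have le: "ennreal \<bar>measure_pmf.expectation (P j) f - measure_pmf.expectation Q f\<bar> \<le> ennreal B * (\<integral>\<^sup>+ x. norm (pmf (P j) x - pmf Q x) \<partial>count_space UNIV)" for j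
  proof -
    have "measure_pmf.expectation (P j) f - measure_pmf.expectation Q f = (\<integral>x. pmf (P j) x * f x - pmf Q x * f x \<partial>count_space UNIV)"
      unfolding ex by (rule Bochner_Integration.integral_diff[OF int int, symmetric])
    then have "ennreal \<bar>measure_pmf.expectation (P j) f - measure_pmf.expectation Q f\<bar> \<le> (\<integral>\<^sup>+ x. norm (pmf (P j) x * f x - pmf Q x * f x) \<partial>count_space UNIV)"
      using integral_norm_bound_ennreal[OF Bochner_Integration.integrable_diff[OF int int, of "P j" Q]] by simp
    also have "\<dots> \<le> (\<integral>\<^sup>+ x. ennreal B * norm (pmf (P j) x - pmf Q x) \<partial>count_space UNIV)"
    proof (rule nn_integral_mono)
      fix x
      have "norm (pmf (P j) x * f x - pmf Q x * f x) = \<bar>f x\<bar> * norm (pmf (P j) x - pmf Q x)"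
        by (simp add: abs_mult[symmetric] algebra_simps)
      also have "\<dots> \<le> B * norm (pmf (P j) x - pmf Q x)" using B by (intro mult_right_mono) auto
      finally show "ennreal (norm (pmf (P j) x * f x - pmf Q x * f x)) \<le> ennreal B * ennreal (norm (pmf (P j) x - pmf Q x))"
        using B0 by (simp add: ennreal_mult[symmetric])
    qed
    also have "\<dots> = ennreal B * (\<integral>\<^sup>+ x. norm (pmf (P j) x - pmf Q x) \<partial>count_space UNIV)"
      by (rule nn_integral_cmult) simp
    finally show ?thesis .
  qed
  have "(\<lambda>j. ennreal \<bar>measure_pmf.expectation (P j) f - measure_pmf.expectation Q f\<bar>) \<longlonglongrightarrow> 0"
  proof (rule tendsto_sandwich[OF _ _ tendsto_const up])
    show "\<forall>\<^sub>F j in sequentially. 0 \<le> ennreal \<bar>measure_pmf.expectation (P j) f - measure_pmf.expectation Q f\<bar>" by simp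
    show "\<forall>\<^sub>F j in sequentially. ennreal \<bar>measure_pmf.expectation (P j) f - measure_pmf.expectation Q f\<bar>
        \<le> ennreal B * (\<integral>\<^sup>+ x. norm (pmf (P j) x - pmf Q x) \<partial>count_space UNIV)"
      by (rule always_eventually[OF allI[OF le]])
  qed
  then have "(\<lambda>j. \<bar>measure_pmf.expectation (P j) f - measure_pmf.expectation Q f\<bar>) \<longlonglongrightarrow> 0"
    by (subst (asm) ennreal_tendsto_0_iff) auto
  then show ?thesis by (subst LIM_zero_iff[symmetric], subst tendsto_rabs_zero_iff[symmetric])
qed

lemma pmf_embed_pmf_has_sum:
  assumes f: "\<And>x. f x \<ge> 0" "(f has_sum 1) UNIV"
  shows "pmf (embed_pmf f) x = f x"
proof (rule pmf_embed_pmf[OF f(1)])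
  have "(\<lambda>x. norm (f x)) summable_on UNIV" using f by (auto simp: has_sum_iff)
  then have a: "Infinite_Set_Sum.abs_summable_on f UNIV" by (simp only: abs_summable_equivalent)
  then have "(\<integral>\<^sup>+ x. ennreal (f x) \<partial>count_space UNIV) = ennreal (infsetsum f UNIV)"
    by (rule nn_integral_conv_infsetsum) (use f in auto)
  also have "infsetsum f UNIV = 1" using infsetsum_infsum[OF a] f(2) by (simp add: has_sum_iff)
  finally show "(\<integral>\<^sup>+ x. ennreal (f x) \<partial>count_space UNIV) = 1" by simp
qed

context dimer_limit
begin

lemma number_limit_gauss:
  obtains C where "C > 0" "\<And>\<kappa> l. number_limit \<kappa> l = C * gauss_weight \<rho> (\<kappa>, l)"
proof (rule that[of "Q * width * sqrt (2 * pi) / (2 * pi)"])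
  show "Q * width * sqrt (2 * pi) / (2 * pi) > 0" using Q width(1) by simp
qed (simp add: number_limit_def gauss_weight_def)

lemma total_limit_pos: "total_limit > 0"
proof -
  have nn: "number_limit \<kappa> l > 0" for \<kappa> l using Q width(1) by (simp add: number_limit_def)
  have "(\<Sum>(\<kappa>, l)\<in>{(0, 0)}. number_limit \<kappa> l) \<le> total_limit"
    by (rule finite_sum_le_has_sum[OF number_limit_has_sum]) (use nn less_imp_le in auto)
  then show ?thesis using nn[of 0 0] by simp
qed

text \<open>The limits of the counts are one constant C times the Gaussian weights; summing
  identifies \<open>total_limit\<close> as C times \<open>gauss_Z\<close>, and C cancels in the
  quotient.\<close>

lemma gauss_weight_normalized:
  "((\<lambda>x. gauss_weight \<rho> x / gauss_Z \<rho>) has_sum 1) UNIV"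
  "number_limit \<kappa> l / total_limit = gauss_weight \<rho> (\<kappa>, l) / gauss_Z \<rho>"
proof -
  obtain C where C: "C > 0" "\<And>\<kappa> l. number_limit \<kappa> l = C * gauss_weight \<rho> (\<kappa>, l)" using number_limit_gauss by blast
  have "((\<lambda>x. C * gauss_weight \<rho> x) has_sum total_limit) UNIV"
    using number_limit_has_sum unfolding C(2) by (simp add: case_prod_unfold)
  then have "((\<lambda>x. (1 / C) * (C * gauss_weight \<rho> x)) has_sum ((1 / C) * total_limit)) UNIV" by (rule has_sum_cmult_right)
  then have h: "(gauss_weight \<rho> has_sum (total_limit / C)) UNIV" using C(1) by simp
  then have Z: "gauss_Z \<rho> = total_limit / C" unfolding gauss_Z_def by (simp add: has_sum_iff)
  then have "gauss_Z \<rho> > 0" using C(1) total_limit_pos by simp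
  then have one: "1 / gauss_Z \<rho> * (total_limit / C) = 1" unfolding Z[symmetric] by simp
  show "((\<lambda>x. gauss_weight \<rho> x / gauss_Z \<rho>) has_sum 1) UNIV"
    using has_sum_cmult_right[OF h, of "1 / gauss_Z \<rho>", unfolded one] by simp
  show "number_limit \<kappa> l / total_limit = gauss_weight \<rho> (\<kappa>, l) / gauss_Z \<rho>"
    unfolding C(2) Z using C(1) by simp
qed

lemma pmf_wind_limit: "pmf (wind_limit \<rho>) x = gauss_weight \<rho> x / gauss_Z \<rho>"
  unfolding wind_limit_def
proof (rule pmf_embed_pmf_has_sum[OF _ gauss_weight_normalized(1)])
  have "gauss_weight \<rho> x \<ge> 0" for x by (cases x) (simp add: gauss_weight_def)
  then show "gauss_weight \<rho> x / gauss_Z \<rho> \<ge> 0" for x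
    unfolding gauss_Z_def by (intro divide_nonneg_nonneg infsum_nonneg) auto
qed

text \<open>The probability of a winding number is a quotient of two counts on the same scale
  \<open>base j\<close>, both of which have limits, the denominator a positive one.\<close>

lemma pmf_wind_tendsto:
  assumes R: "R \<in> dimers 1 3" "\<And>t. card {e \<in> R. snd e = t} = 2"
  shows "(\<lambda>j. pmf (wind_pmf R (m j) (3 * p j)) x) \<longlonglongrightarrow> pmf (wind_limit \<rho>) x"
proof -
  obtain k l where x: "x = (k, l)" by (cases x)
  have "pmf (wind_pmf R (m j) (3 * p j)) (k, l) = number j (- k) l / total j" for j
  proof -
    define W where "W = wind (m j) (3 * p j) (reference R (m j) (3 * p j))"
    have n: "3 * p j > 0" "3 dvd 3 * p j" using p(2)[of j] by auto
    have ne: "configs j \<noteq> {}" using reference_dimers[OF R(1) n(2)] unfolding configs_def by blast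
    have "W M = (- drift j M, turns j M)" if "M \<in> configs j" for M
      using wind_reference[OF m_pos n R] that by (simp add: W_def configs_def drift_def turns_def)
    then have "configs j \<inter> W -` {(k, l)} = {M \<in> configs j. drift j M = - k \<and> turns j M = l}" by auto
    moreover have "pmf (wind_pmf R (m j) (3 * p j)) (k, l) = real (card (configs j \<inter> W -` {(k, l)})) / real (card (configs j))"
      unfolding wind_pmf_def W_def[symmetric] configs_def[symmetric] pmf_map
      by (rule measure_pmf_of_set[OF ne finite_configs])
    ultimately show ?thesis using base_pos[of j] by (simp add: number_def total_def)
  qed
  moreover have "(\<lambda>j. number j (- k) l / total j) \<longlonglongrightarrow> number_limit (- k) l / total_limit"
    using total_limit_pos by (intro tendsto_divide number_tendsto total_tendsto) auto
  \<comment> \<open>The reversed sign of the drift is absorbed because the weight is even in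
    \<open>k\<close>.\<close>
  moreover have "number_limit (- k) l / total_limit = pmf (wind_limit \<rho>) x"
    unfolding gauss_weight_normalized(2) pmf_wind_limit x by (simp add: gauss_weight_def)
  ultimately show ?thesis unfolding x by simp
qed

end

theorem theorem2:
  fixes \<rho> :: real and m n :: "nat \<Rightarrow> nat" and R :: "edge set"
  assumes "\<rho> > 0"
    and "R \<in> dimers 1 3"
    and "\<And>t. card {e \<in> R. snd e = t} = 2"
    and "\<And>i. m i > 0" and "\<And>i. n i > 0" and "\<And>i. 3 dvd n i"
    and "filterlim m at_top sequentially" and "filterlim n at_top sequentially"
    and "(\<lambda>i. real (n i) / (sqrt 3 * real (m i))) \<longlonglongrightarrow> \<rho>"
  shows "(\<forall>k l. pmf (wind_limit \<rho>) (k, l) =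
            exp (- (pi / 2) * ((of_int k)\<^sup>2 / \<rho> + \<rho> * (of_int l)\<^sup>2)) / gauss_Z \<rho>)
         \<and> converges_in_distribution (\<lambda>i. wind_pmf R (m i) (n i)) (wind_limit \<rho>)"
proof -
  define p where "p i = n i div 3" for i
  have np: "3 * p i = n i" for i using assms(6)[of i] by (simp add: p_def)
  have ppos: "p i > 0" for i using np[of i] assms(5)[of i] by simp
  have "filterlim p at_top sequentially"
    unfolding filterlim_at_top
  proof
    fix Z
    show "\<forall>\<^sub>F i in sequentially. Z \<le> p i"
      using assms(8)[unfolded filterlim_at_top, rule_format, of "3 * Z"] by eventually_elim (simp flip: np)
  qed
  moreover have "(\<lambda>i. real (m i) / real (3 * p i)) \<longlonglongrightarrow> 1 / (sqrt 3 * \<rho>)"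
  proof -
    have "(\<lambda>i. inverse (real (n i) / (sqrt 3 * real (m i))) / sqrt 3) \<longlonglongrightarrow> inverse \<rho> / sqrt 3"
      using assms(1) by (intro tendsto_divide tendsto_inverse assms(9) tendsto_const) auto
    then show ?thesis unfolding np using assms(4) by (simp add: field_simps)
  qed
  ultimately interpret scaling_limit m p \<rho> "exp (- pi / \<rho>)"
    using assms(1) ppos by unfold_locales auto
  obtain Q where Q: "Q > 0" "\<And>(\<zeta> :: complex) \<tau>. \<zeta> \<noteq> 0 \<Longrightarrow> \<bar>\<tau>\<bar> \<le> pi \<Longrightarrow>
    (\<lambda>j. (\<Prod>b<3 * p j. 1 + \<zeta> * of_real ((2 * cos ((2 * pi * real b + pi + \<tau>) / (6 * real (p j)))) ^ (2 * m j)))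
       / (\<zeta> ^ (2 * p j) * of_real (sea (m j) (p j) 0)))
    \<longlonglongrightarrow> of_real (Q * exp (- \<tau>\<^sup>2 / (2 * pi * \<rho>)))
      * (theta (exp (- pi / \<rho>)) (\<zeta> * exp (- \<tau> / \<rho>)) * theta (exp (- pi / \<rho>)) (\<zeta> * exp (\<tau> / \<rho>)))"
    using mode_product_tendsto by blast
  \<comment> \<open>The constant just obtained and its limit relation discharge the remaining
    assumptions of the locale.\<close>
  interpret dimer_limit m p \<rho> "exp (- pi / \<rho>)" Q
    using assms(4) Q by unfold_locales
  have "converges_in_distribution (\<lambda>i. wind_pmf R (m i) (n i)) (wind_limit \<rho>)"
    unfolding converges_in_distribution_def
    using pmf_expectation_tendsto[OF pmf_wind_tendsto[OF assms(2,3), unfolded np]] by blast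
  then show ?thesis by (simp add: pmf_wind_limit gauss_weight_def)
qed

end
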